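(* Let $p$ be an odd prime and let $G$ be a finite $p$-group with $\exp(G)=p^n$. Suppose that $G$ satisfies the following properties: (i) $G^{p}$ is powerful; (ii) $\exp(G^{p})=p^{n-1}$; (iii) $\gamma_{p+1}(G)\subset G^{p}$. Then $\exp(G\wedge G)$ divides $\exp(G)$. In particular, $\exp(M(G))$ divides $\exp(G)$.
   Context: Conventions: $x^y=y^{-1}xy$, $[x,y]=x^{-1}x^y=x^{-1}y^{-1}xy$. $\exp(G)$ denotes the exponent of $G$. $\gamma_i(G)$ denotes the $i$-th term of the lower central series of $G$ ($\gamma_1(G)=G$, $\gamma_{i+1}(G)=[\gamma_i(G),G]$). For a positive integer $m$, $G^{m}$ is the subgroup of $G$ generated by all $m$-th powers $g^m$, $g\in G$. For an odd prime $p$, a finite $p$-group $N$ is powerful if $[N,N]\le N^p$. $G\wedge G$ denotes the nonabelian exterior square of $G$: the group generated by symbols $g\wedge h$ ($g,h\in G$) subject to the relations $gh\wedge k=(g^h\wedge k^h)(h\wedge k)$, $g\wedge hk=(g\wedge k)(g^k\wedge h^k)$ and $g\wedge g=1$ for all $g,h,k\in G$. $M(G)$ denotes the Schur multiplier $H_2(G,\mathbb{Z})$, which is isomorphic to the kernel of the homomorphism $G\wedge G\to [G,G]$, $g\wedge h\mapsto [g,h]$. *)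

theory Defs
  imports "HOL-Algebra.Algebra" "HOL-Computational_Algebra.Primes"
begin

section \<open>Exponents, power subgroups and the lower central series\<close>

text \<open>The exponent is 0 if no positive power annihilates the group; thus a group whose exponent
  divides a positive number really has finite exponent.\<close>

definition group_exponent :: "('a, 'b) monoid_scheme \<Rightarrow> nat" where
  "group_exponent G =
     (if \<exists>m>0. \<forall>x\<in>carrier G. x [^]\<^bsub>G\<^esub> (m::nat) = \<one>\<^bsub>G\<^esub>
      then LEAST m. m > 0 \<and> (\<forall>x\<in>carrier G. x [^]\<^bsub>G\<^esub> m = \<one>\<^bsub>G\<^esub>)
      else 0)"

definition power_subgroup :: "('a, 'b) monoid_scheme \<Rightarrow> nat \<Rightarrow> 'a set" where
  "power_subgroup G m = generate G ((\<lambda>g. g [^]\<^bsub>G\<^esub> m) ` carrier G)"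

definition conj_by :: "('a, 'b) monoid_scheme \<Rightarrow> 'a \<Rightarrow> 'a \<Rightarrow> 'a" where
  "conj_by G x y = inv\<^bsub>G\<^esub> y \<otimes>\<^bsub>G\<^esub> x \<otimes>\<^bsub>G\<^esub> y"

definition commutator :: "('a, 'b) monoid_scheme \<Rightarrow> 'a \<Rightarrow> 'a \<Rightarrow> 'a" where
  "commutator G x y = inv\<^bsub>G\<^esub> x \<otimes>\<^bsub>G\<^esub> conj_by G x y"

definition commutator_subgroup :: "('a, 'b) monoid_scheme \<Rightarrow> 'a set \<Rightarrow> 'a set \<Rightarrow> 'a set" where
  "commutator_subgroup G H K = generate G {commutator G h k | h k. h \<in> H \<and> k \<in> K}"

text \<open>The series is indexed from 1; the value at 0 is a dummy.\<close>

fun lower_central :: "('a, 'b) monoid_scheme \<Rightarrow> nat \<Rightarrow> 'a set" where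
  "lower_central G 0 = carrier G"
| "lower_central G (Suc 0) = carrier G"
| "lower_central G (Suc (Suc i)) =
     commutator_subgroup G (lower_central G (Suc i)) (carrier G)"

text \<open>Only meant for an odd prime \<open>p\<close> and a finite \<open>p\<close>-group \<open>N\<close>.\<close>

definition powerful :: "nat \<Rightarrow> ('a, 'b) monoid_scheme \<Rightarrow> bool" where
  "powerful p N \<longleftrightarrow> commutator_subgroup N (carrier N) (carrier N) \<subseteq> power_subgroup N p"


section \<open>Groups given by generators and relations\<close>

text \<open>In a word, the letter \<open>(True, x)\<close> stands for the generator \<open>x\<close> and \<open>(False, x)\<close> for its
  formal inverse. A relation \<open>u = v\<close> is given as the pair \<open>(u, v)\<close>.\<close>

type_synonym 'x word = "(bool \<times> 'x) list"

inductive_set word_cong :: "'x set \<Rightarrow> ('x word \<times> 'x word) set \<Rightarrow> ('x word \<times> 'x word) set"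
  for S R where
  refl: "w \<in> lists (UNIV \<times> S) \<Longrightarrow> (w, w) \<in> word_cong S R"
| sym: "(u, v) \<in> word_cong S R \<Longrightarrow> (v, u) \<in> word_cong S R"
| trans: "\<lbrakk>(u, v) \<in> word_cong S R; (v, w) \<in> word_cong S R\<rbrakk> \<Longrightarrow> (u, w) \<in> word_cong S R"
| append: "\<lbrakk>(u, u') \<in> word_cong S R; (v, v') \<in> word_cong S R\<rbrakk>
    \<Longrightarrow> (u @ v, u' @ v') \<in> word_cong S R"
| cancel: "x \<in> S \<Longrightarrow> ([(b, x), (\<not> b, x)], []) \<in> word_cong S R"
| rel: "\<lbrakk>(u, v) \<in> R; u \<in> lists (UNIV \<times> S); v \<in> lists (UNIV \<times> S)\<rbrakk> \<Longrightarrow> (u, v) \<in> word_cong S R"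

definition presented_group :: "'x set \<Rightarrow> ('x word \<times> 'x word) set \<Rightarrow> 'x word set monoid" where
  "presented_group S R =
     \<lparr>carrier = lists (UNIV \<times> S) // word_cong S R,
      monoid.mult = (\<lambda>A B. \<Union>u\<in>A. \<Union>v\<in>B. word_cong S R `` {u @ v}),
      one = word_cong S R `` {[]}\<rparr>"

lemma word_cong_in_lists:
  "(u, v) \<in> word_cong S R \<Longrightarrow> u \<in> lists (UNIV \<times> S) \<and> v \<in> lists (UNIV \<times> S)"
  by (induction rule: word_cong.induct) auto

lemma equiv_word_cong: "equiv (lists (UNIV \<times> S)) (word_cong S R)"
proof (rule equivI)
  show "word_cong S R \<subseteq> lists (UNIV \<times> S) \<times> lists (UNIV \<times> S)"
    using word_cong_in_lists by fastforce
  show "refl_on (lists (UNIV \<times> S)) (word_cong S R)"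
    using word_cong.refl by (fastforce simp: refl_on_def)
  show "Relation.sym (word_cong S R)" by (auto intro: symI word_cong.sym)
  show "Relation.trans (word_cong S R)" by (auto intro: transI word_cong.trans)
qed

lemma presented_group_mult:
  assumes "u \<in> lists (UNIV \<times> S)" "v \<in> lists (UNIV \<times> S)"
  shows "word_cong S R `` {u} \<otimes>\<^bsub>presented_group S R\<^esub> word_cong S R `` {v}
       = word_cong S R `` {u @ v}"
proof -
  have "word_cong S R `` {u' @ v'} = word_cong S R `` {u @ v}"
    if "u' \<in> word_cong S R `` {u}" "v' \<in> word_cong S R `` {v}" for u' v'
    using that by (intro equiv_class_eq[OF equiv_word_cong])
      (auto intro: word_cong.append word_cong.sym)
  moreover have "u \<in> word_cong S R `` {u}" "v \<in> word_cong S R `` {v}"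
    using assms by (auto intro: word_cong.refl)
  ultimately have "(\<Union>u'\<in>word_cong S R `` {u}. \<Union>v'\<in>word_cong S R `` {v}. word_cong S R `` {u' @ v'})
      = word_cong S R `` {u @ v}"
    by blast
  then show ?thesis by (simp add: presented_group_def)
qed

lemma word_cong_inverse:
  "w \<in> lists (UNIV \<times> S) \<Longrightarrow> (rev (map (apfst Not) w) @ w, []) \<in> word_cong S R"
proof (induction w)
  case Nil
  show ?case by (simp add: word_cong.refl)
next
  case (Cons a w)
  obtain b x where a: "a = (b, x)" by (cases a)
  have w: "w \<in> lists (UNIV \<times> S)" "x \<in> S" using Cons.prems a by auto
  have w': "rev (map (apfst Not) w) \<in> lists (UNIV \<times> S)"
    using w by (fastforce simp: in_lists_conv_set)
  have "([(\<not> b, x), (b, x)], []) \<in> word_cong S R"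
    using word_cong.cancel[OF w(2), of "\<not> b"] by simp
  then have "(rev (map (apfst Not) w) @ [(\<not> b, x), (b, x)] @ w, rev (map (apfst Not) w) @ [] @ w)
      \<in> word_cong S R"
    by (intro word_cong.append word_cong.refl w w')
  then show ?case
    using Cons.IH[OF w(1)] a by (auto intro: word_cong.trans)
qed

lemma group_presented_group:
  fixes S :: "'x set"
  shows "group (presented_group S R)" (is "group ?P")
proof (rule groupI)
  have carr: "carrier ?P = {word_cong S R `` {w} | w. w \<in> lists (UNIV \<times> S)}"
    by (auto simp: presented_group_def quotient_def)
  have one: "\<one>\<^bsub>?P\<^esub> = word_cong S R `` {[]}" by (simp add: presented_group_def)
  have carrE: "\<exists>w. w \<in> lists (UNIV \<times> S) \<and> x = word_cong S R `` {w}" if "x \<in> carrier ?P" for x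
    using that unfolding carr by blast
  have carrI: "word_cong S R `` {w} \<in> carrier ?P" if "w \<in> lists (UNIV \<times> S)" for w
    using that unfolding carr by blast
  have app: "u @ v \<in> lists (UNIV \<times> S)" if "u \<in> lists (UNIV \<times> S)" "v \<in> lists (UNIV \<times> S)"
    for u v :: "'x word"
    using that by simp
  have nil: "[] \<in> lists (UNIV \<times> S)" by simp
  show "x \<otimes>\<^bsub>?P\<^esub> y \<in> carrier ?P" if "x \<in> carrier ?P" "y \<in> carrier ?P" for x y
    using carrE[OF that(1)] carrE[OF that(2)] by (metis presented_group_mult carrI app)
  show "\<one>\<^bsub>?P\<^esub> \<in> carrier ?P" unfolding one by (rule carrI[OF nil])
  show "x \<otimes>\<^bsub>?P\<^esub> y \<otimes>\<^bsub>?P\<^esub> z = x \<otimes>\<^bsub>?P\<^esub> (y \<otimes>\<^bsub>?P\<^esub> z)"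
    if xyz: "x \<in> carrier ?P" "y \<in> carrier ?P" "z \<in> carrier ?P" for x y z
  proof -
    obtain u v w where "u \<in> lists (UNIV \<times> S)" "v \<in> lists (UNIV \<times> S)" "w \<in> lists (UNIV \<times> S)"
      "x = word_cong S R `` {u}" "y = word_cong S R `` {v}" "z = word_cong S R `` {w}"
      using carrE[OF xyz(1)] carrE[OF xyz(2)] carrE[OF xyz(3)] by blast
    then show ?thesis by (simp only: presented_group_mult app append_assoc)
  qed
  show "\<one>\<^bsub>?P\<^esub> \<otimes>\<^bsub>?P\<^esub> x = x" if "x \<in> carrier ?P" for x
    using carrE[OF that] nil unfolding one by (metis presented_group_mult append_Nil)
  show "\<exists>y\<in>carrier ?P. y \<otimes>\<^bsub>?P\<^esub> x = \<one>\<^bsub>?P\<^esub>" if x: "x \<in> carrier ?P" for x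
  proof -
    obtain w where w: "x = word_cong S R `` {w}" "w \<in> lists (UNIV \<times> S)"
      using carrE[OF x] by blast
    let ?w = "rev (map (apfst Not) w)"
    have w': "?w \<in> lists (UNIV \<times> S)" using w(2) by (fastforce simp: in_lists_conv_set)
    have "word_cong S R `` {?w} \<otimes>\<^bsub>?P\<^esub> x = \<one>\<^bsub>?P\<^esub>"
      unfolding w(1) one presented_group_mult[OF w' w(2)]
      by (rule equiv_class_eq[OF equiv_word_cong word_cong_inverse[OF w(2)]])
    then show ?thesis using w' unfolding carr by blast
  qed
qed


section \<open>The nonabelian exterior square\<close>

text \<open>The pair \<open>(g, h)\<close> is the symbol $g \wedge h$.\<close>

abbreviation wedge :: "'a \<Rightarrow> 'a \<Rightarrow> ('a \<times> 'a) word" where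
  "wedge g h \<equiv> [(True, (g, h))]"

definition exterior_relations ::
    "('a, 'b) monoid_scheme \<Rightarrow> (('a \<times> 'a) word \<times> ('a \<times> 'a) word) set" where
  "exterior_relations G =
     {(wedge (g \<otimes>\<^bsub>G\<^esub> h) k, wedge (conj_by G g h) (conj_by G k h) @ wedge h k) | g h k.
        g \<in> carrier G \<and> h \<in> carrier G \<and> k \<in> carrier G}
   \<union> {(wedge g (h \<otimes>\<^bsub>G\<^esub> k), wedge g k @ wedge (conj_by G g k) (conj_by G h k)) | g h k.
        g \<in> carrier G \<and> h \<in> carrier G \<and> k \<in> carrier G}
   \<union> {(wedge g g, []) | g. g \<in> carrier G}"

definition exterior_square :: "('a, 'b) monoid_scheme \<Rightarrow> ('a \<times> 'a) word set monoid" where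
  "exterior_square G = presented_group (carrier G \<times> carrier G) (exterior_relations G)"


section \<open>The Schur multiplier\<close>

text \<open>$H_2(G,\mathbb{Z})$ as cycles modulo boundaries in the (inhomogeneous, unnormalised) bar
  complex: the group of \<open>n\<close>-chains is free abelian on \<open>n\<close>-tuples of group elements, with
  $\partial_2 [g|h] = [h] - [gh] + [g]$ and
  $\partial_3 [g|h|k] = [h|k] - [gh|k] + [g|hk] - [g|h]$.\<close>

definition bar_boundary2 :: "('a, 'b) monoid_scheme \<Rightarrow> ('a \<times> 'a \<Rightarrow>\<^sub>0 int) \<Rightarrow> ('a \<Rightarrow>\<^sub>0 int)" where
  "bar_boundary2 G =
     frag_extend (\<lambda>(g, h). frag_of h - frag_of (g \<otimes>\<^bsub>G\<^esub> h) + frag_of g)"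

definition bar_boundary3 ::
    "('a, 'b) monoid_scheme \<Rightarrow> ('a \<times> 'a \<times> 'a \<Rightarrow>\<^sub>0 int) \<Rightarrow> ('a \<times> 'a \<Rightarrow>\<^sub>0 int)" where
  "bar_boundary3 G =
     frag_extend (\<lambda>(g, h, k). frag_of (h, k) - frag_of (g \<otimes>\<^bsub>G\<^esub> h, k)
                              + frag_of (g, h \<otimes>\<^bsub>G\<^esub> k) - frag_of (g, h))"

definition bar_cycles2 :: "('a, 'b) monoid_scheme \<Rightarrow> ('a \<times> 'a \<Rightarrow>\<^sub>0 int) set" where
  "bar_cycles2 G = kernel (free_Abelian_group (carrier G \<times> carrier G))
                          (free_Abelian_group (carrier G)) (bar_boundary2 G)"

definition bar_boundaries2 :: "('a, 'b) monoid_scheme \<Rightarrow> ('a \<times> 'a \<Rightarrow>\<^sub>0 int) set" where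
  "bar_boundaries2 G =
     bar_boundary3 G ` carrier (free_Abelian_group (carrier G \<times> carrier G \<times> carrier G))"

definition schur_multiplier :: "('a, 'b) monoid_scheme \<Rightarrow> ('a \<times> 'a \<Rightarrow>\<^sub>0 int) set monoid" where
  "schur_multiplier G =
     (free_Abelian_group (carrier G \<times> carrier G))\<lparr>carrier := bar_cycles2 G\<rparr> Mod bar_boundaries2 G"

lemma (in group) bar_boundary2_boundary3:
  assumes "Poly_Mapping.keys c \<subseteq> carrier G \<times> carrier G \<times> carrier G"
  shows "bar_boundary2 G (bar_boundary3 G c) = 0"
  using assms
proof (induction c rule: frag_induction)
  case (one x)
  then show ?case
    by (auto simp: bar_boundary2_def bar_boundary3_def frag_extend_diff frag_extend_add m_assoc)
qed (simp_all add: bar_boundary2_def bar_boundary3_def frag_extend_diff)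

lemma (in group) bar_boundary2_hom:
  "group_hom (free_Abelian_group (carrier G \<times> carrier G)) (free_Abelian_group (carrier G))
     (bar_boundary2 G)"
proof (intro group_hom.intro group_hom_axioms.intro homI group_free_Abelian_group)
  fix x assume "x \<in> carrier (free_Abelian_group (carrier G \<times> carrier G))"
  then show "bar_boundary2 G x \<in> carrier (free_Abelian_group (carrier G))"
    unfolding bar_boundary2_def carrier_free_Abelian_group_iff
    by (intro order_trans[OF keys_frag_extend] UN_least)
       (auto dest!: subsetD[OF keys_add] subsetD[OF keys_diff])
qed (simp add: bar_boundary2_def frag_extend_add)

lemma (in group) bar_boundary3_hom:
  "group_hom (free_Abelian_group (carrier G \<times> carrier G \<times> carrier G))
     (free_Abelian_group (carrier G \<times> carrier G)) (bar_boundary3 G)"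
proof (intro group_hom.intro group_hom_axioms.intro homI group_free_Abelian_group)
  fix x assume "x \<in> carrier (free_Abelian_group (carrier G \<times> carrier G \<times> carrier G))"
  then show "bar_boundary3 G x \<in> carrier (free_Abelian_group (carrier G \<times> carrier G))"
    unfolding bar_boundary3_def carrier_free_Abelian_group_iff
    by (intro order_trans[OF keys_frag_extend] UN_least)
       (auto dest!: subsetD[OF keys_add] subsetD[OF keys_diff])
qed (simp add: bar_boundary3_def frag_extend_add)

lemma (in group) group_schur_multiplier: "group (schur_multiplier G)"
proof -
  let ?C = "free_Abelian_group (carrier G \<times> carrier G)"
  have Z: "subgroup (bar_cycles2 G) ?C"
    unfolding bar_cycles2_def by (rule group_hom.subgroup_kernel[OF bar_boundary2_hom])
  have B: "subgroup (bar_boundaries2 G) ?C"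
    unfolding bar_boundaries2_def by (rule group_hom.img_is_subgroup[OF bar_boundary3_hom])
  have BZ: "bar_boundaries2 G \<subseteq> bar_cycles2 G"
  proof
    fix c assume c: "c \<in> bar_boundaries2 G"
    then have "c \<in> carrier ?C" by (rule subgroup.mem_carrier[OF B])
    with c show "c \<in> bar_cycles2 G"
      by (auto simp only: bar_boundaries2_def bar_cycles2_def kernel_def
          carrier_free_Abelian_group_iff one_free_Abelian_group bar_boundary2_boundary3)
  qed
  have "subgroup (bar_boundaries2 G) (?C\<lparr>carrier := bar_cycles2 G\<rparr>)"
    by (rule group.subgroup_incl[OF group_free_Abelian_group B Z BZ])
  moreover have "comm_group (?C\<lparr>carrier := bar_cycles2 G\<rparr>)"
    using subgroup.subgroup_is_group[OF Z group_free_Abelian_group]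
    by (rule group.group_comm_groupI) simp
  ultimately have "bar_boundaries2 G \<lhd> ?C\<lparr>carrier := bar_cycles2 G\<rparr>"
    by (simp add: comm_group.subgroup_imp_normal)
  then show ?thesis
    unfolding schur_multiplier_def by (rule normal.factorgroup_is_group)
qed

end

theory Submission
  imports Defs
begin

text \<open>
  Let \<open>H\<close> be a group with a surjection onto \<open>G\<close> whose kernel is central. Everything
  follows from \<open>[H, H]\<^bsup>p^n\<^esup> = 1\<close>, which splits along the preimage \<open>M\<close> of \<open>N = G\<^sup>p\<close>.

  The iterated power subgroups \<open>N\<^sub>i\<close> of the powerful group \<open>N\<close> satisfy
  \<open>[N\<^sub>i, N] \<subseteq> N\<^sub>i\<^sub>+\<^sub>1\<close> and reach 1 after \<open>n - 1\<close> steps. If \<open>M\<^sub>i\<close> is the preimage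
  of \<open>N\<^sub>i\<close>, then modulo \<open>[M\<^sub>i\<^sub>+\<^sub>1, H]\<close> the group \<open>M\<^sub>i\<close> has class 2 and central \<open>p\<close>-th
  powers, so \<open>[M\<^sub>i, H]\<^sup>p \<subseteq> [M\<^sub>i\<^sub>+\<^sub>1, H]\<close>; hence \<open>[M, H]\<close> has exponent dividing
  \<open>p\<^bsup>n-1\<^esup>\<close>.

  The quotient \<open>K = H / [M, H]\<close> has class at most \<open>p + 1\<close> and central \<open>p\<close>-th powers.
  Evaluating the polynomial sequence \<open>k \<mapsto> [u, v\<^sup>k]\<close> at \<open>k = p\<close> shows that the third and
  later terms of the lower central series have exponent \<open>p\<close> and that \<open>[u, v]\<^sup>p\<close> is inverse
  to \<open>[u, v, \<dots>, v]\<close> with \<open>p\<close> entries \<open>v\<close>. Replacing \<open>v\<close> by \<open>v\<^sup>a u\<close> and comparing the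
  terms of degree 1 in \<open>a\<close> shows that these commutators vanish, whence \<open>[K, K]\<^sup>p = 1\<close>.

  For the exterior square, \<open>H\<close> is built from \<open>G \<and> G\<close> by adjoining infinite cyclic groups,
  one for each element of \<open>G\<close>, so that \<open>G \<and> G\<close> becomes \<open>[H, H]\<close>. For the Schur multiplier,
  \<open>H\<close> is the extension of \<open>G\<close> by 2-chains modulo boundaries with the tautological cocycle,
  in which cycles are products of commutators.
\<close>

section \<open>Commutator calculus\<close>

text \<open>The exponent p^n arises as p times p^(n-1): the factor p bounds [K, K], the rest [M, H].
  Passing to central extensions settles both claims by one theorem, without relating the Schur
  multiplier to the exterior square. The obstacle is the class p + 1 of K. A polynomial sequence has
  a Taylor expansion in factors c_i^(n choose i); at n = p the exponents with 0 < i < p are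
  divisible by p, so only c_1^p and c_p count. For commutators of weight at least 3, c_p falls into
  the trivial term p + 2 of the lower central series. For weight 2 it is [u, v, ..., v], which a
  priori may survive in the last term. The parameter a removes it. Since a^p = a modulo p, the
  relations say that an expression of degree p - 1 in a, taken at nonzero residues only, is constant
  and equal to its own coefficient of degree p - 1. Summing over these residues kills the degrees
  strictly between 0 and p - 1; the top coefficient cancels against the constant, so the coefficient
  of degree 0, the wanted commutator up to inversion, is trivial.\<close>

context group
begin

lemma inv_mult_cancel [simp]:
  assumes "x \<in> carrier G" "y \<in> carrier G"
  shows "inv x \<otimes> (x \<otimes> y) = y" "x \<otimes> (inv x \<otimes> y) = y"
  using assms by (simp_all flip: m_assoc)

lemmas word_simps = commutator_def conj_by_def m_assoc inv_mult_group

lemma conj_by_closed [simp]: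
  "x \<in> carrier G \<Longrightarrow> y \<in> carrier G \<Longrightarrow> conj_by G x y \<in> carrier G"
  by (simp add: conj_by_def)

lemma commutator_closed [simp]:
  "x \<in> carrier G \<Longrightarrow> y \<in> carrier G \<Longrightarrow> commutator G x y \<in> carrier G"
  by (simp add: commutator_def)

lemma mult_commutator:
  "x \<in> carrier G \<Longrightarrow> y \<in> carrier G \<Longrightarrow> y \<otimes> x \<otimes> commutator G x y = x \<otimes> y"
  by (simp add: word_simps)

lemma commutator_eq_one_iff:
  assumes "x \<in> carrier G" "y \<in> carrier G"
  shows "commutator G x y = \<one> \<longleftrightarrow> x \<otimes> y = y \<otimes> x"
proof -
  have "commutator G x y = inv (y \<otimes> x) \<otimes> (x \<otimes> y)"
    using assms by (simp add: word_simps)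
  then show ?thesis
    using assms by (metis inv_equality inv_inv inv_closed l_inv m_closed)
qed

lemma conj_by_pow:
  assumes "x \<in> carrier G" "y \<in> carrier G"
  shows "conj_by G (x [^] (n::nat)) y = conj_by G x y [^] n"
proof (induction n)
  case (Suc n)
  have "conj_by G (x [^] Suc n) y = conj_by G (x [^] n) y \<otimes> conj_by G x y"
    using assms by (simp add: conj_by_def m_assoc)
  then show ?case using Suc by simp
qed (use assms in \<open>simp add: conj_by_def\<close>)

lemma commutator_swap:
  "x \<in> carrier G \<Longrightarrow> y \<in> carrier G \<Longrightarrow> commutator G y x = inv (commutator G x y)"
  by (simp add: word_simps)

lemma mult_commutator_eq_conj_by:
  "x \<in> carrier G \<Longrightarrow> y \<in> carrier G \<Longrightarrow> x \<otimes> commutator G x y = conj_by G x y"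
  by (simp add: word_simps)

lemma pow_commute:
  assumes "x \<in> carrier G" "y \<in> carrier G" "x \<otimes> y = y \<otimes> x"
  shows "x [^] (n::nat) \<otimes> y = y \<otimes> x [^] n"
  using group_commutes_pow[OF assms(3,1,2)] .

lemma pow_mult_swap_class2:
  assumes x: "x \<in> carrier G" and u: "u \<in> carrier G"
    and zx: "commutator G u x \<otimes> x = x \<otimes> commutator G u x"
    and zu: "commutator G u x \<otimes> u = u \<otimes> commutator G u x"
  shows "u [^] (n::nat) \<otimes> x = x \<otimes> u [^] n \<otimes> commutator G u x [^] n"
proof (induction n)
  case (Suc n)
  let ?z = "commutator G u x"
  have z: "?z \<in> carrier G" using x u by simp
  have "u [^] Suc n \<otimes> x = u [^] n \<otimes> (x \<otimes> u \<otimes> ?z)"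
    using x u mult_commutator[OF u x] by (simp add: m_assoc)
  also have "\<dots> = (u [^] n \<otimes> x) \<otimes> u \<otimes> ?z" using x u z by (simp add: m_assoc)
  also have "\<dots> = x \<otimes> u [^] n \<otimes> (?z [^] n \<otimes> u) \<otimes> ?z" using x u z Suc by (simp add: m_assoc)
  also have "?z [^] n \<otimes> u = u \<otimes> ?z [^] n" by (rule pow_commute[OF z u zu])
  finally show ?case using x u z by (simp add: m_assoc)
qed (use x in simp)

lemma mult_pow_class2:
  assumes x: "x \<in> carrier G" and u: "u \<in> carrier G"
    and zx: "commutator G u x \<otimes> x = x \<otimes> commutator G u x"
    and zu: "commutator G u x \<otimes> u = u \<otimes> commutator G u x"
  shows "(x \<otimes> u) [^] (n::nat) = x [^] n \<otimes> u [^] n \<otimes> commutator G u x [^] (n choose 2)"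
proof (induction n)
  case (Suc n)
  let ?z = "commutator G u x" and ?T = "n choose 2"
  have z: "?z \<in> carrier G" using x u by simp
  have zT: "?z [^] ?T \<otimes> (x \<otimes> u) = x \<otimes> u \<otimes> ?z [^] ?T"
  proof (rule pow_commute)
    have "?z \<otimes> (x \<otimes> u) = x \<otimes> (?z \<otimes> u)" using z x u zx by (simp flip: m_assoc)
    then show "?z \<otimes> (x \<otimes> u) = x \<otimes> u \<otimes> ?z" using z x u zu by (simp add: m_assoc)
  qed (use z x u in auto)
  have "(x \<otimes> u) [^] Suc n = x [^] n \<otimes> u [^] n \<otimes> (?z [^] ?T \<otimes> (x \<otimes> u))"
    using x u z Suc by (simp add: m_assoc)
  also have "\<dots> = x [^] n \<otimes> (u [^] n \<otimes> x) \<otimes> u \<otimes> ?z [^] ?T" using x u z zT by (simp add: m_assoc)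
  also have "u [^] n \<otimes> x = x \<otimes> u [^] n \<otimes> ?z [^] n" by (rule pow_mult_swap_class2[OF assms])
  also have "x [^] n \<otimes> (x \<otimes> u [^] n \<otimes> ?z [^] n) \<otimes> u \<otimes> ?z [^] ?T
      = x [^] Suc n \<otimes> u [^] n \<otimes> (?z [^] n \<otimes> u) \<otimes> ?z [^] ?T"
    using x u z by (simp add: m_assoc)
  also have "?z [^] n \<otimes> u = u \<otimes> ?z [^] n" by (rule pow_commute[OF z u zu])
  also have "x [^] Suc n \<otimes> u [^] n \<otimes> (u \<otimes> ?z [^] n) \<otimes> ?z [^] ?T
      = x [^] Suc n \<otimes> u [^] Suc n \<otimes> ?z [^] (n + ?T)"
    using x u z by (simp add: m_assoc nat_pow_mult[symmetric])
  also have "n + ?T = Suc n choose 2" by (simp add: numeral_2_eq_2)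
  finally show ?case .
qed (simp add: binomial_eq_0)

lemma dvd_pow_eq_one:
  assumes "x \<in> carrier G" "x [^] (m::nat) = \<one>" "m dvd n"
  shows "x [^] n = \<one>"
  using assms by (auto elim!: dvdE simp flip: nat_pow_pow)

text \<open>As \<open>u [^] p\<close> commutes with x, the swap formula forces [u, x]^p = 1; p
  divides p choose 2 because p is odd, so the correction factor of \<open>mult_pow_class2\<close>
  disappears.\<close>

lemma mult_pow_odd_class2:
  assumes x: "x \<in> carrier G" and u: "u \<in> carrier G"
    and zx: "commutator G u x \<otimes> x = x \<otimes> commutator G u x"
    and zu: "commutator G u x \<otimes> u = u \<otimes> commutator G u x"
    and ux: "u [^] p \<otimes> x = x \<otimes> u [^] p" and p: "odd (p::nat)"
  shows "(x \<otimes> u) [^] p = x [^] p \<otimes> u [^] p"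
proof -
  let ?z = "commutator G u x"
  have z: "?z \<in> carrier G" using x u by simp
  have "x \<otimes> u [^] p \<otimes> ?z [^] p = x \<otimes> u [^] p"
    using pow_mult_swap_class2[OF x u zx zu, of p] ux by simp
  then have "?z [^] p = \<one>" using x u z by simp
  moreover have "p dvd p choose 2"
  proof -
    obtain b where "p = 2 * b + 1" using p by (elim oddE)
    then have "p choose 2 = b * p" by (simp add: choose_two)
    then show ?thesis by simp
  qed
  ultimately have "?z [^] (p choose 2) = \<one>" using z dvd_pow_eq_one by blast
  then show ?thesis using mult_pow_class2[OF x u zx zu, of p] x u by simp
qed

lemma commutator_mult_left:
  assumes "x \<in> carrier G" "y \<in> carrier G" "z \<in> carrier G"
  shows "commutator G (x \<otimes> y) z = conj_by G (commutator G x z) y \<otimes> commutator G y z"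
  using assms by (simp add: word_simps)

lemma commutator_inv_left:
  assumes "x \<in> carrier G" "z \<in> carrier G"
  shows "commutator G (inv x) z = conj_by G (inv (commutator G x z)) (inv x)"
  using assms by (simp add: word_simps)

lemma normal_conj_by:
  assumes "N \<lhd> G" "x \<in> N" "y \<in> carrier G"
  shows "conj_by G x y \<in> N"
  using normal.inv_op_closed1[OF assms(1,3,2)] by (simp add: conj_by_def)

lemma normal_conjI:
  assumes "subgroup N G" "\<And>x y. x \<in> N \<Longrightarrow> y \<in> carrier G \<Longrightarrow> conj_by G x y \<in> N"
  shows "N \<lhd> G"
proof (rule normal_invI[OF assms(1)])
  fix x h assume "x \<in> carrier G" "h \<in> N"
  then show "x \<otimes> h \<otimes> inv x \<in> N" using assms(2)[of h "inv x"] by (simp add: conj_by_def)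
qed

lemma normal_commutator_left:
  assumes "N \<lhd> G" "x \<in> N" "y \<in> carrier G"
  shows "commutator G x y \<in> N"
  using assms normal_conj_by[OF assms] normal_imp_subgroup[OF assms(1)]
  by (simp add: commutator_def subgroup.m_closed subgroup.m_inv_closed)

lemma normal_commutator_right:
  assumes "N \<lhd> G" "x \<in> N" "y \<in> carrier G"
  shows "commutator G y x \<in> N"
  using normal_commutator_left[OF assms] commutator_swap[of x y] assms
    normal_imp_subgroup[OF assms(1)]
  by (simp add: subgroup.m_inv_closed subgroup.mem_carrier)

lemma generate_image_closed:
  assumes "S \<subseteq> carrier G" "f \<in> hom G G" "f ` S \<subseteq> generate G S" "x \<in> generate G S"
  shows "f x \<in> generate G S"
proof -
  interpret f: group_hom G G f using assms(2) by unfold_locales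
  show ?thesis using assms(4)
  proof induction
    case one then show ?case by (simp add: generate.one)
  next
    case (incl h) then show ?case using assms(3) by blast
  next
    case (inv h)
    then have "f h \<in> generate G S" "h \<in> carrier G" using assms(1,3) by auto
    then show ?case using generate_m_inv_closed[OF assms(1)] by simp
  next
    case (eng h k)
    then show ?case using generate_in_carrier[OF assms(1)] by (simp add: generate.eng)
  qed
qed

lemma conj_by_hom: "y \<in> carrier G \<Longrightarrow> (\<lambda>x. conj_by G x y) \<in> hom G G"
  by (auto intro!: homI simp: word_simps)

lemma normal_generate_conjI:
  assumes "S \<subseteq> carrier G"
    and "\<And>x y. x \<in> S \<Longrightarrow> y \<in> carrier G \<Longrightarrow> conj_by G x y \<in> generate G S"
  shows "generate G S \<lhd> G"
  using assms generate_image_closed[OF assms(1) conj_by_hom]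
  by (intro normal_conjI generate_is_subgroup) blast+

lemma commutator_subgroup_normal:
  assumes "H \<lhd> G" "K \<lhd> G"
  shows "commutator_subgroup G H K \<lhd> G"
  unfolding commutator_subgroup_def
proof (rule normal_generate_conjI)
  have HK: "H \<subseteq> carrier G" "K \<subseteq> carrier G"
    using assms normal_imp_subgroup subgroup.subset by blast+
  then show "{commutator G h k |h k. h \<in> H \<and> k \<in> K} \<subseteq> carrier G"
    by (auto intro!: commutator_closed)
  fix x y assume "x \<in> {commutator G h k |h k. h \<in> H \<and> k \<in> K}" and y: "y \<in> carrier G"
  then obtain h k where hk: "h \<in> H" "k \<in> K" "x = commutator G h k" by blast
  have "conj_by G x y = commutator G (conj_by G h y) (conj_by G k y)"
    using hk HK y subsetD[OF HK(1) hk(1)] subsetD[OF HK(2) hk(2)] by (simp add: word_simps)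
  moreover have "conj_by G h y \<in> H" "conj_by G k y \<in> K" using hk y assms normal_conj_by by auto
  ultimately show "conj_by G x y \<in> generate G {commutator G h k |h k. h \<in> H \<and> k \<in> K}"
    by (auto intro!: generate.incl)
qed

lemma commutator_subgroup_incl:
  "h \<in> H \<Longrightarrow> k \<in> K \<Longrightarrow> commutator G h k \<in> commutator_subgroup G H K"
  unfolding commutator_subgroup_def by (blast intro: generate.incl)

lemma commutator_subgroup_least:
  assumes "subgroup N G" "\<And>h k. h \<in> H \<Longrightarrow> k \<in> K \<Longrightarrow> commutator G h k \<in> N"
  shows "commutator_subgroup G H K \<subseteq> N"
  unfolding commutator_subgroup_def using assms by (intro generate_subgroup_incl) auto

lemma carrier_normal: "carrier G \<lhd> G"
  using subgroup_self by (intro normal_conjI) auto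

lemma normal_subset: "N \<lhd> G \<Longrightarrow> N \<subseteq> carrier G"
  by (simp add: normal_imp_subgroup subgroup.subset)

lemma normal_pow_closed: "N \<lhd> G \<Longrightarrow> x \<in> N \<Longrightarrow> x [^] (n::nat) \<in> N"
  by (induction n)
    (auto dest: normal_imp_subgroup simp: subgroup.one_closed subgroup.m_closed)

lemma lower_central_normal: "lower_central G i \<lhd> G"
proof (induction i)
  case (Suc i)
  then show ?case
    by (cases i) (simp_all add: carrier_normal commutator_subgroup_normal)
qed (simp add: carrier_normal)

end

lemma (in group_hom) hom_commutator:
  "x \<in> carrier G \<Longrightarrow> y \<in> carrier G \<Longrightarrow> h (commutator G x y) = commutator H (h x) (h y)"
  by (simp add: commutator_def conj_by_def)

context normal
begin

lemma quotient_hom: "group_hom G (G Mod H) (\<lambda>x. H #> x)"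
  by (intro group_hom.intro group_hom_axioms.intro factorgroup_is_group r_coset_hom_Mod is_group)

lemma quotient_eq_one_iff:
  assumes "x \<in> carrier G"
  shows "H #> x = \<one>\<^bsub>G Mod H\<^esub> \<longleftrightarrow> x \<in> H"
proof
  assume "H #> x = \<one>\<^bsub>G Mod H\<^esub>"
  then show "x \<in> H" using assms rcos_self[OF assms is_subgroup] by simp
next
  assume "x \<in> H"
  then show "H #> x = \<one>\<^bsub>G Mod H\<^esub>" using coset_join2[OF assms is_subgroup] by simp
qed

lemma quotient_surj: "carrier (G Mod H) = (\<lambda>x. H #> x) ` carrier G"
  by (rule carrier_FactGroup)

end

section \<open>Subgroups and powers modulo a normal subgroup\<close>

context group
begin

text \<open>This is the preimage of the centraliser of the image of K in \<open>G Mod R\<close>. It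
  lets commutator conditions modulo R be checked on generators.\<close>

lemma subgroup_commutators_in_normal:
  assumes R: "R \<lhd> G" and K: "K \<subseteq> carrier G"
  shows "subgroup {x \<in> carrier G. \<forall>g\<in>K. commutator G x g \<in> R} G"
proof (rule subgroupI)
  note sg = normal_imp_subgroup[OF R]
  show "{x \<in> carrier G. \<forall>g\<in>K. commutator G x g \<in> R} \<noteq> {}"
    using K sg by (auto intro!: exI[of _ \<one>] simp: word_simps subgroup.one_closed subset_eq)
  fix x assume x: "x \<in> {x \<in> carrier G. \<forall>g\<in>K. commutator G x g \<in> R}"
  have "commutator G (inv x) g \<in> R" if "g \<in> K" for g
  proof -
    have "g \<in> carrier G" "x \<in> carrier G" "commutator G x g \<in> R" using that K x by auto
    then show ?thesis
      using sg by (simp add: commutator_inv_left normal_conj_by[OF R] subgroup.m_inv_closed)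
  qed
  then show "inv x \<in> {x \<in> carrier G. \<forall>g\<in>K. commutator G x g \<in> R}" using x by auto
  fix y assume y: "y \<in> {x \<in> carrier G. \<forall>g\<in>K. commutator G x g \<in> R}"
  have "commutator G (x \<otimes> y) g \<in> R" if "g \<in> K" for g
  proof -
    have "g \<in> carrier G" "x \<in> carrier G" "commutator G x g \<in> R"
      "y \<in> carrier G" "commutator G y g \<in> R" using that K x y by auto
    then show ?thesis
      using sg by (simp add: commutator_mult_left normal_conj_by[OF R] subgroup.m_closed)
  qed
  then show "x \<otimes> y \<in> {x \<in> carrier G. \<forall>g\<in>K. commutator G x g \<in> R}" using x y by auto
qed auto

lemma generate_commutator_in_normal:
  assumes "R \<lhd> G" "K \<subseteq> carrier G" "S \<subseteq> carrier G"
    and "\<And>s g. s \<in> S \<Longrightarrow> g \<in> K \<Longrightarrow> commutator G s g \<in> R"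
    and "x \<in> generate G S" "g \<in> K"
  shows "commutator G x g \<in> R"
  using generate_subgroup_incl[OF _ subgroup_commutators_in_normal[OF assms(1,2)], of S]
    assms(3-) by blast

text \<open>This is \<open>mult_pow_odd_class2\<close> in \<open>G Mod R\<close>, where the three
  commutator hypotheses become commutation relations.\<close>

lemma pow_mult_mod_normal:
  assumes R: "R \<lhd> G" and xu: "x \<in> carrier G" "u \<in> carrier G" and p: "odd (p::nat)"
    and "commutator G (commutator G u x) x \<in> R" "commutator G (commutator G u x) u \<in> R"
    and "commutator G (u [^] p) x \<in> R"
  shows "R #> ((x \<otimes> u) [^] p) = R #> (x [^] p \<otimes> u [^] p)"
proof -
  interpret R: normal R G by (rule R)
  interpret q: group_hom G "G Mod R" "\<lambda>x. R #> x" by (rule R.quotient_hom)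
  have comm: "(R #> a) \<otimes>\<^bsub>G Mod R\<^esub> (R #> b) = (R #> b) \<otimes>\<^bsub>G Mod R\<^esub> (R #> a)"
    if "commutator G a b \<in> R" "a \<in> carrier G" "b \<in> carrier G" for a b
    using that R.quotient_eq_one_iff[of "commutator G a b"]
    by (simp add: q.hom_commutator q.H.commutator_eq_one_iff del: mult_FactGroup one_FactGroup)
  have "((R #> x) \<otimes>\<^bsub>G Mod R\<^esub> (R #> u)) [^]\<^bsub>G Mod R\<^esub> p
      = (R #> x) [^]\<^bsub>G Mod R\<^esub> p \<otimes>\<^bsub>G Mod R\<^esub> (R #> u) [^]\<^bsub>G Mod R\<^esub> p"
  proof (rule q.H.mult_pow_odd_class2)
    have "commutator (G Mod R) (R #> u) (R #> x) = R #> commutator G u x"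
      using xu by (simp add: q.hom_commutator)
    then show "commutator (G Mod R) (R #> u) (R #> x) \<otimes>\<^bsub>G Mod R\<^esub> (R #> x)
        = (R #> x) \<otimes>\<^bsub>G Mod R\<^esub> commutator (G Mod R) (R #> u) (R #> x)"
      "commutator (G Mod R) (R #> u) (R #> x) \<otimes>\<^bsub>G Mod R\<^esub> (R #> u)
        = (R #> u) \<otimes>\<^bsub>G Mod R\<^esub> commutator (G Mod R) (R #> u) (R #> x)"
      using xu comm assms(5,6) by simp_all
    show "(R #> u) [^]\<^bsub>G Mod R\<^esub> p \<otimes>\<^bsub>G Mod R\<^esub> (R #> x)
        = (R #> x) \<otimes>\<^bsub>G Mod R\<^esub> (R #> u) [^]\<^bsub>G Mod R\<^esub> p"
      using xu comm[OF assms(7)] by (simp flip: q.hom_nat_pow)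
  qed (use xu p q.hom_closed in blast)+
  then show ?thesis
    using xu by (simp add: q.hom_nat_pow q.hom_mult del: mult_FactGroup one_FactGroup)
qed

lemma normal_coset_eqD:
  assumes R: "R \<lhd> G" and "R #> x = R #> y" "x \<in> carrier G" "y \<in> carrier G"
  shows "x \<in> R \<longleftrightarrow> y \<in> R" "inv y \<otimes> x \<in> R"
proof -
  interpret R: normal R G by (rule R)
  interpret q: group_hom G "G Mod R" "\<lambda>x. R #> x" by (rule R.quotient_hom)
  show "x \<in> R \<longleftrightarrow> y \<in> R" using R.quotient_eq_one_iff assms by metis
  have "R #> (inv y \<otimes> x) = inv\<^bsub>G Mod R\<^esub> (R #> y) \<otimes>\<^bsub>G Mod R\<^esub> (R #> x)"
    using assms(3,4) by (metis q.hom_mult q.hom_inv inv_closed)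
  also have "\<dots> = \<one>\<^bsub>G Mod R\<^esub>"
    using assms(2,4) q.H.l_inv[OF q.hom_closed] by metis
  finally show "inv y \<otimes> x \<in> R"
    using R.quotient_eq_one_iff[of "inv y \<otimes> x"] assms(3,4) by blast
qed

lemma pow_mult_closed_mod_normal:
  assumes "R \<lhd> G" "x \<in> carrier G" "u \<in> carrier G" "odd (p::nat)"
    and "commutator G (commutator G u x) x \<in> R" "commutator G (commutator G u x) u \<in> R"
    and "x [^] p \<in> R" "u [^] p \<in> R"
  shows "(x \<otimes> u) [^] p \<in> R"
proof -
  have "x [^] p \<otimes> u [^] p \<in> R"
    using assms normal_imp_subgroup subgroup.m_closed by metis
  moreover have "commutator G (u [^] p) x \<in> R" using assms normal_commutator_left by blast
  ultimately show ?thesis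
    using normal_coset_eqD(1)[OF assms(1) pow_mult_mod_normal[OF assms(1-6)]] assms(2,3) by simp
qed

text \<open>Modulo [M', G] the subgroup M' is central, so M has class at most 2 and central p-th
  powers. Hence the p-th power map is multiplicative on M, the elements that it sends to 1 form a
  subgroup, and only the generators [x, g] are left to check.\<close>

lemma commutator_subgroup_pow_in:
  assumes M: "M \<lhd> G" and M': "M' \<lhd> G" and p: "odd (p::nat)"
    and MM: "\<And>x y. x \<in> M \<Longrightarrow> y \<in> M \<Longrightarrow> commutator G x y \<in> M'"
    and Mp: "\<And>x. x \<in> M \<Longrightarrow> x [^] p \<in> M'"
    and c: "c \<in> commutator_subgroup G M (carrier G)"
  shows "c [^] p \<in> commutator_subgroup G M' (carrier G)"
proof -
  let ?R = "commutator_subgroup G M' (carrier G)"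
  have R: "?R \<lhd> G" using M' carrier_normal by (rule commutator_subgroup_normal)
  have R': "commutator G m g \<in> ?R" if "m \<in> M'" "g \<in> carrier G" for m g
    using that by (rule commutator_subgroup_incl)
  have MC: "x \<in> carrier G" if "x \<in> M" for x using that normal_subset[OF M] by blast
  note sM = normal_imp_subgroup[OF M] and sR = normal_imp_subgroup[OF R]
  have closed: "subgroup {x \<in> M. x [^] p \<in> ?R} G"
  proof (rule subgroupI)
    show "{x \<in> M. x [^] p \<in> ?R} \<noteq> {}"
      using subgroup.one_closed[OF sM] subgroup.one_closed[OF sR] by auto
    fix x assume x: "x \<in> {x \<in> M. x [^] p \<in> ?R}"
    then show "inv x \<in> {x \<in> M. x [^] p \<in> ?R}"
      using MC by (auto simp: nat_pow_inv subgroup.m_inv_closed[OF sM] subgroup.m_inv_closed[OF sR])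
    fix y assume y: "y \<in> {x \<in> M. x [^] p \<in> ?R}"
    show "x \<otimes> y \<in> {x \<in> M. x [^] p \<in> ?R}"
      using x y MC MM R' pow_mult_closed_mod_normal[OF R _ _ p, of x y]
      by (auto simp: subgroup.m_closed[OF sM])
  qed (use MC in auto)
  have gen: "commutator G x g \<in> {x \<in> M. x [^] p \<in> ?R}" if x: "x \<in> M" and g: "g \<in> carrier G" for x g
  proof -
    let ?u = "commutator G x g"
    have xC: "x \<in> carrier G" using MC x .
    have u: "?u \<in> M" "?u \<in> carrier G" using normal_commutator_left[OF M x g] MC by auto
    \<comment> \<open>As x [x, g] is the conjugate of x by g, the left side is the class of the
      conjugate of x^p. Comparison gives [x, g]^p = [x^p, g] modulo [M', G], and x^p lies in
      M'.\<close>
    have "?R #> ((x \<otimes> ?u) [^] p) = ?R #> (x [^] p \<otimes> ?u [^] p)"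
      using xC u x MM Mp R' by (intro pow_mult_mod_normal[OF R _ _ p]) auto
    then have "?R #> (conj_by G (x [^] p) g) = ?R #> (x [^] p \<otimes> ?u [^] p)"
      using xC g by (simp add: mult_commutator_eq_conj_by conj_by_pow)
    then have "inv (x [^] p \<otimes> ?u [^] p) \<otimes> conj_by G (x [^] p) g \<in> ?R"
      by (rule normal_coset_eqD(2)[OF R]) (use xC g u in auto)
    then have "inv (?u [^] p) \<otimes> commutator G (x [^] p) g \<in> ?R"
      using xC g u by (simp add: commutator_def inv_mult_group m_assoc)
    moreover have "commutator G (x [^] p) g \<in> ?R" using R' Mp x g by blast
    ultimately have "inv (?u [^] p) \<in> ?R"
      using xC g u sR
      by (metis commutator_closed inv_closed m_closed nat_pow_closed inv_solve_right
          subgroup.m_closed subgroup.m_inv_closed)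
    then show ?thesis using u sR by (metis (mono_tags, lifting) inv_inv mem_Collect_eq
        nat_pow_closed subgroup.m_inv_closed)
  qed
  show ?thesis using commutator_subgroup_least[OF closed gen] c by blast
qed

section \<open>Finite p-groups\<close>

text \<open>The class equation: if 1 were the only central element, all other conjugacy classes
  would have size divisible by p, and the order would be 1 modulo p.\<close>

lemma prime_power_order_center_nontrivial:
  assumes p: "Factorial_Ring.prime p" and fin: "finite (carrier G)"
    and ord: "order G = p ^ k" and nontriv: "carrier G \<noteq> {\<one>}"
  shows "\<exists>z\<in>carrier G. z \<noteq> \<one> \<and> (\<forall>g\<in>carrier G. g \<otimes> z = z \<otimes> g)"
proof (rule ccontr)
  assume contra: "\<not> ?thesis"
  define \<phi> where "\<phi> = (\<lambda>g. (\<lambda>h \<in> carrier G. g \<otimes> h \<otimes> (inv g)))"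
  interpret act: group_action G "carrier G" \<phi> unfolding \<phi>_def by (rule action_by_conjugation)
  let ?O = "orbits G (carrier G) \<phi>"
  have finO: "finite ?O"
    using fin by (simp add: orbits_def)
  have orb1: "orbit G \<phi> \<one> = {\<one>}"
    by (auto simp: orbit_def \<phi>_def intro: exI[of _ \<one>])
  have dvd: "p dvd card (orbit G \<phi> x)" if x: "x \<in> carrier G" "x \<noteq> \<one>" for x
  proof -
    have "card (orbit G \<phi> x) dvd p ^ k"
      using act.orbit_stabilizer_theorem[OF x(1)] ord by (metis dvd_triv_left)
    then obtain i where i: "card (orbit G \<phi> x) = p ^ i"
      using p divides_primepow_nat by blast
    show ?thesis
    proof (cases i)
      case 0
      then have "card (orbit G \<phi> x) = 1" using i by simp
      then obtain y where "orbit G \<phi> x = {y}" by (auto simp: card_1_singleton_iff)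
      then have "orbit G \<phi> x = {x}" using act.orbit_refl[OF x(1)] by auto
      then have "g \<otimes> x \<otimes> inv g = x" if "g \<in> carrier G" for g
        using that x by (auto simp: orbit_def \<phi>_def)
      then have "g \<otimes> x = x \<otimes> g" if "g \<in> carrier G" for g
        using that x by (metis inv_solve_right m_closed)
      then show ?thesis using contra x by blast
    qed (use i in auto)
  qed
  have one: "{\<one>} \<in> ?O" using orb1 by (auto simp: orbits_def)
  have "card (carrier G) = (\<Sum>orb\<in>?O. card orb)"
  proof -
    have "(card :: 'a set \<Rightarrow> nat) = sum (\<lambda>_. 1)" by (rule ext) simp
    then show ?thesis using act.disjoint_sum[OF fin, of "\<lambda>_. 1 :: nat"] by simp
  qed
  also have "\<dots> = 1 + (\<Sum>orb\<in>?O - {{\<one>}}. card orb)"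
    using sum.remove[OF finO one, of card] by simp
  finally have card: "p ^ k = 1 + (\<Sum>orb\<in>?O - {{\<one>}}. card orb)" using ord by (simp add: order_def)
  have "p dvd (\<Sum>orb\<in>?O - {{\<one>}}. card orb)"
  proof (rule dvd_sum)
    fix orb assume "orb \<in> ?O - {{\<one>}}"
    then obtain x where "x \<in> carrier G" "orb = orbit G \<phi> x" "orb \<noteq> {\<one>}" by (auto simp: orbits_def)
    then show "p dvd card orb" using dvd orb1 by metis
  qed
  moreover have "k \<noteq> 0"
  proof
    assume "k = 0"
    then have "card (carrier G) = 1" using ord by (simp add: order_def)
    then show False using nontriv one_closed by (metis card_1_singletonE singletonD)
  qed
  then have "p dvd p ^ k" by simp
  ultimately have "p dvd 1" using card by (metis dvd_add_left_iff)
  then show False using p by (metis not_prime_unit)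
qed

section \<open>The upper central series of a finite p-group\<close>

fun upper_central :: "nat \<Rightarrow> 'a set" where
  "upper_central 0 = {\<one>}"
| "upper_central (Suc i) = {x \<in> carrier G. \<forall>g\<in>carrier G. commutator G x g \<in> upper_central i}"

lemma upper_central_normal: "upper_central i \<lhd> G"
proof (induction i)
  case (Suc i)
  have "subgroup (upper_central (Suc i)) G"
    using subgroup_commutators_in_normal[OF Suc, of "carrier G"] by simp
  moreover have "conj_by G x y \<in> upper_central (Suc i)"
    if x: "x \<in> upper_central (Suc i)" and y: "y \<in> carrier G" for x y
  proof -
    have xC: "x \<in> carrier G" using x by simp
    have "commutator G (conj_by G x y) g \<in> upper_central i" if g: "g \<in> carrier G" for g
    proof -
      have "commutator G (conj_by G x y) g = conj_by G (commutator G x (conj_by G g (inv y))) y"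
        using xC y g by (simp add: word_simps)
      then show ?thesis using x y g by (auto intro: normal_conj_by[OF Suc])
    qed
    then show ?thesis using xC y by simp
  qed
  ultimately show ?case by (rule normal_conjI)
qed (simp add: one_is_normal)

lemma upper_central_Suc: "upper_central i \<subseteq> upper_central (Suc i)"
  using normal_commutator_left[OF upper_central_normal] normal_subset[OF upper_central_normal, of i]
  by auto

text \<open>A nontrivial central element of the p-group \<open>G Mod upper_central i\<close> lifts
  to a new element of the next term.\<close>

lemma upper_central_psubset:
  assumes p: "Factorial_Ring.prime p" and fin: "finite (carrier G)"
    and ord: "order G = p ^ k" and proper: "upper_central i \<noteq> carrier G"
  shows "upper_central i \<subset> upper_central (Suc i)"
proof -
  let ?Z = "upper_central i"
  interpret Z: normal ?Z G by (rule upper_central_normal)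
  interpret q: group_hom G "G Mod ?Z" "\<lambda>x. ?Z #> x" by (rule Z.quotient_hom)
  have "order (G Mod ?Z) dvd p ^ k"
    using lagrange[OF Z.is_subgroup] ord by (metis FactGroup_def dvd_triv_left order_def
        partial_object.select_convs(1))
  then obtain j where j: "order (G Mod ?Z) = p ^ j" using p divides_primepow_nat by blast
  obtain x where x: "x \<in> carrier G" "x \<notin> ?Z" using proper Z.subset by blast
  have "?Z #> x \<noteq> \<one>\<^bsub>G Mod ?Z\<^esub>" "?Z #> x \<in> carrier (G Mod ?Z)"
    using x Z.quotient_eq_one_iff[of x] by (auto simp: Z.quotient_surj)
  then have "carrier (G Mod ?Z) \<noteq> {\<one>\<^bsub>G Mod ?Z\<^esub>}" by blast
  moreover have "finite (carrier (G Mod ?Z))" using fin by (simp add: Z.quotient_surj)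
  ultimately obtain z where z: "z \<in> carrier (G Mod ?Z)" "z \<noteq> \<one>\<^bsub>G Mod ?Z\<^esub>"
    "\<And>g. g \<in> carrier (G Mod ?Z) \<Longrightarrow> g \<otimes>\<^bsub>G Mod ?Z\<^esub> z = z \<otimes>\<^bsub>G Mod ?Z\<^esub> g"
    using q.H.prime_power_order_center_nontrivial[OF p _ j] by blast
  obtain y where y: "y \<in> carrier G" "z = ?Z #> y" using z(1) by (auto simp: Z.quotient_surj)
  have "y \<notin> ?Z" using y z(2) Z.quotient_eq_one_iff[of y] by blast
  moreover have "commutator G y g \<in> ?Z" if g: "g \<in> carrier G" for g
  proof -
    have "commutator (G Mod ?Z) z (?Z #> g) = \<one>\<^bsub>G Mod ?Z\<^esub>"
      using z(1) z(3)[of "?Z #> g"] g q.H.commutator_eq_one_iff[of z "?Z #> g"]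
      by (simp add: q.hom_closed del: mult_FactGroup one_FactGroup)
    then show ?thesis
      using y g Z.quotient_eq_one_iff[of "commutator G y g"] by (simp add: q.hom_commutator)
  qed
  ultimately show ?thesis using upper_central_Suc[of i] y(1) by auto
qed

lemma upper_central_reaches_carrier:
  assumes p: "Factorial_Ring.prime p" and fin: "finite (carrier G)" and ord: "order G = p ^ k"
  shows "\<exists>c. upper_central c = carrier G"
proof (rule ccontr)
  assume contra: "\<not> ?thesis"
  have "i \<le> card (upper_central i)" for i
  proof (induction i)
    case (Suc i)
    have "upper_central i \<subset> upper_central (Suc i)"
      using upper_central_psubset[OF assms] contra by blast
    then have "card (upper_central i) < card (upper_central (Suc i))"
      using fin by (intro psubset_card_mono) auto
    then show ?case using Suc by simp
  qed simp
  moreover have "card (upper_central i) \<le> card (carrier G)" for i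
    using fin normal_subset[OF upper_central_normal] by (intro card_mono) auto
  ultimately show False by (metis not_less_eq_eq order_trans)
qed

lemma normal_join: "A \<lhd> G \<Longrightarrow> B \<lhd> G \<Longrightarrow> generate G (A \<union> B) \<lhd> G"
  using normal_conj_by normal_subset by (intro normal_generate_conjI) (blast intro: generate.incl)+

text \<open>A form of nilpotency: to prove \<open>A \<subseteq> B\<close> one may calculate modulo \<open>[A, G]\<close>.\<close>

lemma p_group_subset_mod_commutators:
  assumes p: "Factorial_Ring.prime p" and fin: "finite (carrier G)" and ord: "order G = p ^ k"
    and A: "A \<subseteq> carrier G" and B: "B \<lhd> G"
    and step: "\<And>R. R \<lhd> G \<Longrightarrow> B \<subseteq> R \<Longrightarrow>
      (\<And>x g. x \<in> A \<Longrightarrow> g \<in> carrier G \<Longrightarrow> commutator G x g \<in> R) \<Longrightarrow> A \<subseteq> R"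
  shows "A \<subseteq> B"
proof -
  let ?R = "\<lambda>j. generate G (B \<union> upper_central j)"
  have R: "?R j \<lhd> G" for j by (rule normal_join[OF B upper_central_normal])
  have BR: "B \<subseteq> ?R j" for j by (auto intro: generate.incl)
  \<comment> \<open>Write Z_j for \<open>upper_central j\<close>. If A lies in B Z_{j+1}, then
    [A, G] lies in B Z_j, which is what \<open>step\<close> asks of R = B Z_j. The descent runs from
    Z_c = G to Z_0 = 1.\<close>
  have down: "A \<subseteq> ?R j" if AR: "A \<subseteq> ?R (Suc j)" for j
  proof (rule step[OF R BR])
    fix x g assume x: "x \<in> A" and g: "g \<in> carrier G"
    show "commutator G x g \<in> ?R j"
    proof (rule generate_commutator_in_normal[OF R, of "carrier G" "B \<union> upper_central (Suc j)"])
      show "B \<union> upper_central (Suc j) \<subseteq> carrier G" using normal_subset[OF B] by auto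
      fix s h assume "s \<in> B \<union> upper_central (Suc j)" and h: "h \<in> carrier G"
      then consider "s \<in> B" | "s \<in> upper_central (Suc j)" by blast
      then show "commutator G s h \<in> ?R j"
      proof cases
        case 1
        then show ?thesis using normal_commutator_left[OF B _ h] BR by blast
      next
        case 2
        then have "commutator G s h \<in> upper_central j" using h by simp
        then show ?thesis by (simp add: generate.incl)
      qed
    qed (use AR x g in auto)
  qed
  obtain c where c: "upper_central c = carrier G"
    using upper_central_reaches_carrier[OF p fin ord] by blast
  have "A \<subseteq> ?R (c - i)" for i
  proof (induction i)
    case 0
    then show ?case using A c by (auto intro: generate.incl)
  next
    case (Suc i)
    show ?case
    proof (cases "i < c")
      case True
      then have "c - i = Suc (c - Suc i)" by simp
      then show ?thesis using down[of "c - Suc i"] Suc by simp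
    qed (use Suc in simp)
  qed
  from this[of c] have "A \<subseteq> generate G (B \<union> {\<one>})" by simp
  also have "\<dots> \<subseteq> B"
    using normal_imp_subgroup[OF B] by (intro generate_subgroup_incl) (auto simp:
        subgroup.one_closed)
  finally show ?thesis .
qed

end

section \<open>Powerful subgroups\<close>

context group
begin

text \<open>Power subgroups are kept as sets inside one ambient group, so that the operation can be
  iterated with \<open>^^\<close>; \<open>power_subgroup\<close> would need a new group structure at
  every step.\<close>

definition pth_powers :: "nat \<Rightarrow> 'a set \<Rightarrow> 'a set" where
  "pth_powers p A = generate G ((\<lambda>x. x [^] p) ` A)"

lemma pth_powers_incl: "x \<in> A \<Longrightarrow> x [^] p \<in> pth_powers p A"
  unfolding pth_powers_def by (blast intro: generate.incl)

lemma pth_powers_least: "subgroup N G \<Longrightarrow> (\<And>x. x \<in> A \<Longrightarrow> x [^] p \<in> N) \<Longrightarrow> pth_powers p A \<subseteq> N"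
  unfolding pth_powers_def by (intro generate_subgroup_incl) auto

lemma pth_powers_normal:
  assumes "A \<lhd> G"
  shows "pth_powers p A \<lhd> G"
  unfolding pth_powers_def
proof (rule normal_generate_conjI)
  show "(\<lambda>x. x [^] p) ` A \<subseteq> carrier G" using normal_subset[OF assms] by auto
  fix x y assume "x \<in> (\<lambda>x. x [^] p) ` A" and y: "y \<in> carrier G"
  then obtain a where a: "a \<in> A" "x = a [^] p" by blast
  then have "conj_by G x y = conj_by G a y [^] p"
    using y normal_subset[OF assms] by (auto intro: conj_by_pow)
  then show "conj_by G x y \<in> generate G ((\<lambda>x. x [^] p) ` A)"
    using normal_conj_by[OF assms a(1) y] by (auto intro: generate.incl)
qed

lemma pth_powers_subset: "A \<lhd> G \<Longrightarrow> pth_powers p A \<subseteq> A"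
  using normal_pow_closed normal_imp_subgroup by (intro pth_powers_least)

text \<open>By \<open>p_group_subset_mod_commutators\<close> one may calculate as if [M^p, N] were
  central and (M^p)^p trivial. Then u = [x, g] lies in M^p, so u^p = 1 and [u, x] is central; hence
  the conjugate (x u)^p of x^p equals x^p. This is the theorem of Lubotzky and Mann that p-th powers
  of a powerfully embedded subgroup are powerfully embedded.\<close>

lemma powerfully_embedded_pth_powers:
  assumes p: "Factorial_Ring.prime p" "odd p" and fin: "finite (carrier G)" and ord: "order G = p
      ^ k"
    and M: "M \<lhd> G" and N: "N \<lhd> G" and MN: "M \<subseteq> N"
    and emb: "commutator_subgroup G M N \<subseteq> pth_powers p M"
  shows "commutator_subgroup G (pth_powers p M) N \<subseteq> pth_powers p (pth_powers p M)"
proof (rule p_group_subset_mod_commutators[OF p(1) fin ord])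
  let ?P = "pth_powers p M" and ?Y = "pth_powers p (pth_powers p M)"
  let ?X = "commutator_subgroup G ?P N"
  have P: "?P \<lhd> G" by (rule pth_powers_normal[OF M])
  show "?Y \<lhd> G" by (rule pth_powers_normal[OF P])
  show "?X \<subseteq> carrier G" by (rule normal_subset[OF commutator_subgroup_normal[OF P N]])
  fix R assume R: "R \<lhd> G" and YR: "?Y \<subseteq> R"
    and XR: "\<And>x g. x \<in> ?X \<Longrightarrow> g \<in> carrier G \<Longrightarrow> commutator G x g \<in> R"
  have sub: "M \<subseteq> carrier G" "N \<subseteq> carrier G" using normal_subset M N by auto
  have gen: "commutator G (x [^] p) g \<in> R" if x: "x \<in> M" and g: "g \<in> N" for x g
  proof -
    let ?u = "commutator G x g"
    have C: "x \<in> carrier G" "g \<in> carrier G" "?u \<in> carrier G"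
      using subsetD[OF sub(1) x] subsetD[OF sub(2) g] by auto
    have u: "?u \<in> ?P" using emb commutator_subgroup_incl[OF x g] by blast
    then have "?u [^] p \<in> R" using YR pth_powers_incl[OF u] by blast
    moreover have "commutator G ?u x \<in> ?X" using x MN by (intro commutator_subgroup_incl u) blast
    ultimately have "R #> ((x \<otimes> ?u) [^] p) = R #> (x [^] p \<otimes> ?u [^] p)"
      using C XR normal_commutator_left[OF R] by (intro pow_mult_mod_normal[OF R _ _ p(2)]) auto
    then have "inv (x [^] p \<otimes> ?u [^] p) \<otimes> (x \<otimes> ?u) [^] p \<in> R"
      by (rule normal_coset_eqD(2)[OF R]) (use C in auto)
    moreover have "(x \<otimes> ?u) [^] p = conj_by G (x [^] p) g"
      using C by (simp add: mult_commutator_eq_conj_by conj_by_pow)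
    ultimately have "?u [^] p \<otimes> (inv (x [^] p \<otimes> ?u [^] p) \<otimes> conj_by G (x [^] p) g) \<in> R"
      using subgroup.m_closed[OF normal_imp_subgroup[OF R] \<open>?u [^] p \<in> R\<close>] by simp
    moreover have "?u [^] p \<otimes> (inv (x [^] p \<otimes> ?u [^] p) \<otimes> conj_by G (x [^] p) g)
        = commutator G (x [^] p) g"
      using C by (simp add: commutator_def[of G "x [^] p"] inv_mult_group m_assoc)
    ultimately show ?thesis by simp
  qed
  have "commutator G x g \<in> R" if x: "x \<in> ?P" and g: "g \<in> N" for x g
  proof (rule generate_commutator_in_normal[OF R sub(2) _ _ _ g])
    show "(\<lambda>x. x [^] p) ` M \<subseteq> carrier G" using sub by auto
    show "x \<in> generate G ((\<lambda>x. x [^] p) ` M)" using x by (simp add: pth_powers_def)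
  qed (use gen in blast)
  then show "?X \<subseteq> R" by (intro commutator_subgroup_least normal_imp_subgroup[OF R])
qed

lemma iterated_pth_powers_normal: "N \<lhd> G \<Longrightarrow> (pth_powers p ^^ i) N \<lhd> G"
  by (induction i) (simp_all add: pth_powers_normal)

lemma iterated_pth_powers_subset: "N \<lhd> G \<Longrightarrow> (pth_powers p ^^ i) N \<subseteq> N"
  by (induction i) (auto dest: pth_powers_subset[OF iterated_pth_powers_normal])

context
  fixes p k N
  assumes p: "Factorial_Ring.prime p" "odd p" and fin: "finite (carrier G)" and ord: "order G = p
      ^ k"
    and N: "N \<lhd> G" and powerful: "commutator_subgroup G N N \<subseteq> pth_powers p N"
begin

lemma powerful_commutator_iterated_pth_powers:
  "commutator_subgroup G ((pth_powers p ^^ i) N) N \<subseteq> (pth_powers p ^^ Suc i) N"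
proof (induction i)
  case (Suc i)
  then show ?case
    using powerfully_embedded_pth_powers[OF p fin ord iterated_pth_powers_normal[OF N] N
        iterated_pth_powers_subset[OF N], of i] by simp
qed (simp add: powerful)

text \<open>The exponent of N bounds p^i-th powers of elements, whereas the filtration consists of
  iterated power subgroups; this connects the two. In the inductive step [N_i, N_i] lies in N_{i+1},
  which is central modulo R, so the elements of N_i with p-th power in R form a subgroup, and the
  generators x^(p^i) supplied by induction belong to it.\<close>

lemma powerful_iterated_pth_powers:
  "(pth_powers p ^^ i) N \<subseteq> pth_powers (p ^ i) N"
proof (induction i)
  case 0
  have "x \<in> pth_powers 1 N" if "x \<in> N" for x
    using pth_powers_incl[OF that, of 1] subsetD[OF normal_subset[OF N] that] by simp
  then show ?case by auto
next
  case (Suc i)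
  let ?N = "\<lambda>i. (pth_powers p ^^ i) N"
  have Nn: "?N i \<lhd> G" for i by (rule iterated_pth_powers_normal[OF N])
  have NC: "N \<subseteq> carrier G" "?N i \<subseteq> carrier G" for i using normal_subset N Nn by blast+
  have pow: "x [^] (p ^ i) \<in> ?N i" if "x \<in> N" for x i
  proof (induction i)
    case (Suc i)
    then show ?case using that NC(1) pth_powers_incl[OF Suc, of p]
      by (auto simp: nat_pow_pow mult.commute)
  qed (use that NC in auto)
  show ?case
  proof (rule p_group_subset_mod_commutators[OF p(1) fin ord NC(2) pth_powers_normal[OF N]])
    fix R assume R: "R \<lhd> G" and YR: "pth_powers (p ^ Suc i) N \<subseteq> R"
      and XR: "\<And>x g. x \<in> ?N (Suc i) \<Longrightarrow> g \<in> carrier G \<Longrightarrow> commutator G x g \<in> R"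
    note sR = normal_imp_subgroup[OF R] and sN = normal_imp_subgroup[OF Nn[of i]]
    have "subgroup {y \<in> ?N i. y [^] p \<in> R} G"
    proof (rule subgroupI)
      show "{y \<in> ?N i. y [^] p \<in> R} \<noteq> {}"
        using subgroup.one_closed[OF sR] subgroup.one_closed[OF sN] by auto
      fix x assume x: "x \<in> {y \<in> ?N i. y [^] p \<in> R}"
      then show "inv x \<in> {y \<in> ?N i. y [^] p \<in> R}"
        using subsetD[OF NC(2), of x i]
        by (simp add: nat_pow_inv subgroup.m_inv_closed[OF sN] subgroup.m_inv_closed[OF sR])
      fix y assume y: "y \<in> {y \<in> ?N i. y [^] p \<in> R}"
      have C: "x \<in> carrier G" "y \<in> carrier G" using x y NC by auto
      have "commutator G y x \<in> ?N (Suc i)"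
        using x y powerful_commutator_iterated_pth_powers[of i] iterated_pth_powers_subset[OF N]
          commutator_subgroup_incl[of y "?N i" x N] by blast
      then show "x \<otimes> y \<in> {y \<in> ?N i. y [^] p \<in> R}"
        using x y C XR pow_mult_closed_mod_normal[OF R C p(2)]
        by (auto simp: subgroup.m_closed[OF sN])
    qed (use NC in auto)
    moreover have "x [^] (p ^ i) \<in> {y \<in> ?N i. y [^] p \<in> R}" if x: "x \<in> N" for x
    proof -
      have "(x [^] (p ^ i)) [^] p = x [^] (p ^ Suc i)"
        using x NC(1) by (auto simp: nat_pow_pow mult.commute)
      then show ?thesis using pow[OF x] pth_powers_incl[OF x, of "p ^ Suc i"] YR by auto
    qed
    ultimately have "pth_powers (p ^ i) N \<subseteq> {y \<in> ?N i. y [^] p \<in> R}"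
      by (rule pth_powers_least)
    then have "?N i \<subseteq> {y \<in> ?N i. y [^] p \<in> R}" using Suc by blast
    then have "pth_powers p (?N i) \<subseteq> R" by (intro pth_powers_least[OF sR]) blast
    then show "?N (Suc i) \<subseteq> R" by simp
  qed
qed

end

end

section \<open>Polynomial sequences in filtered groups\<close>

text \<open>The case j = 0 says that every term is normalised by \<open>L 0\<close>. This may be a
  proper subgroup, as in the rescaled filtrations of \<open>scaled_filtered\<close>.\<close>

locale filtered_group = group +
  fixes L :: "nat \<Rightarrow> 'a set"
  assumes L_subgroup: "subgroup (L i) G"
    and L_Suc: "L (Suc i) \<subseteq> L i"
    and L_commutator: "x \<in> L i \<Longrightarrow> y \<in> L j \<Longrightarrow> commutator G x y \<in> L (i + j)"
begin

lemma L_carrier: "x \<in> L i \<Longrightarrow> x \<in> carrier G"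
  by (rule subgroup.mem_carrier[OF L_subgroup])

lemma L_mult: "x \<in> L i \<Longrightarrow> y \<in> L i \<Longrightarrow> x \<otimes> y \<in> L i"
  by (rule subgroup.m_closed[OF L_subgroup])

lemma L_inv: "x \<in> L i \<Longrightarrow> inv x \<in> L i"
  by (rule subgroup.m_inv_closed[OF L_subgroup])

lemma L_one: "\<one> \<in> L i"
  by (rule subgroup.one_closed[OF L_subgroup])

lemma L_pow: "x \<in> L i \<Longrightarrow> x [^] (n::nat) \<in> L i"
  by (induction n) (simp_all add: L_one L_mult)

lemma L_antimono: "i \<le> j \<Longrightarrow> L j \<subseteq> L i"
  by (rule lift_Suc_antimono_le[of L, OF L_Suc])

definition diff :: "(nat \<Rightarrow> 'a) \<Rightarrow> nat \<Rightarrow> 'a" where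
  "diff f n = inv (f n) \<otimes> f (Suc n)"

text \<open>The sequences all of whose differences of order \<open>j \<le> d\<close> lie in \<open>L (k + j)\<close>. Bounding the
  order makes the Lazard--Leibman theorem that they form groups a simple induction on \<open>d\<close>.\<close>

fun pol :: "nat \<Rightarrow> nat \<Rightarrow> (nat \<Rightarrow> 'a) \<Rightarrow> bool" where
  "pol 0 k f \<longleftrightarrow> (\<forall>n. f n \<in> L k)"
| "pol (Suc d) k f \<longleftrightarrow> (\<forall>n. f n \<in> L k) \<and> pol d (Suc k) (diff f)"

lemma pol_value: "pol d k f \<Longrightarrow> f n \<in> L k"
  by (cases d) auto

lemma pol_carrier: "pol d k f \<Longrightarrow> f n \<in> carrier G"
  using pol_value L_carrier by blast

lemma pol_Suc_imp: "pol (Suc d) k f \<Longrightarrow> pol d k f"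
  by (induction d arbitrary: k f) auto

lemma pol_mono: "pol d k f \<Longrightarrow> j \<le> k \<Longrightarrow> pol d j f"
proof (induction d arbitrary: j k f)
  case (Suc d)
  have "\<And>n. f n \<in> L j" using Suc.prems L_antimono pol_value by blast
  then show ?case using Suc by auto
qed (use L_antimono in auto)

lemma diff_carrier [simp]: "(\<And>n. f n \<in> carrier G) \<Longrightarrow> diff f n \<in> carrier G"
  by (simp add: diff_def)

lemma mult_diff: "(\<And>n. f n \<in> carrier G) \<Longrightarrow> f n \<otimes> diff f n = f (Suc n)"
  by (simp add: diff_def)

lemma diff_mult:
  assumes "\<And>n. f n \<in> carrier G" "\<And>n. g n \<in> carrier G"
  shows "diff (\<lambda>n. f n \<otimes> g n) = (\<lambda>n. diff f n \<otimes> (commutator G (diff f n) (g n) \<otimes> diff g n))"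
  using assms by (auto simp: diff_def word_simps)

lemma diff_inv:
  assumes "\<And>n. f n \<in> carrier G"
  shows "diff (\<lambda>n. inv (f n)) = (\<lambda>n. inv (diff f n) \<otimes> commutator G (inv (diff f n)) (inv (f n)))"
  using assms by (auto simp: diff_def word_simps)

text \<open>If f and g have degrees i and j, each factor on the right is built from commutators of
  total degree at least i + j + 1 in f, g and their differences. This is the form that the induction
  in \<open>pol_closed\<close> can use.\<close>

lemma diff_commutator:
  assumes f: "\<And>n. f n \<in> carrier G" and g: "\<And>n. g n \<in> carrier G"
  shows "diff (\<lambda>n. commutator G (f n) (g n)) =
    (\<lambda>n. let h = commutator G (f n) (g n); a = diff f n; b = diff g n;
             t = commutator G (f n) b; s = t \<otimes> commutator G t a; v = commutator G a (g n) in
       s \<otimes> commutator G s h \<otimes> commutator G h (b \<otimes> a) \<otimes> commutator G a b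
       \<otimes> (v \<otimes> commutator G v b))"
proof
  fix n
  define h where "h = commutator G (f n) (g n)"
  define a where "a = diff f n"
  define b where "b = diff g n"
  define t where "t = commutator G (f n) b"
  define s where "s = t \<otimes> commutator G t a"
  define v where "v = commutator G a (g n)"
  have abC: "a \<in> carrier G" "b \<in> carrier G" using f g by (simp_all add: a_def b_def)
  have C: "t \<in> carrier G" "v \<in> carrier G" "h \<in> carrier G" "s \<in> carrier G"
    using f g abC by (simp_all add: t_def v_def h_def s_def)
  have "commutator G (f (Suc n)) (g (Suc n)) = commutator G (f n \<otimes> a) (g n \<otimes> b)"
    using f g by (simp add: a_def b_def mult_diff)
  also have "\<dots> = conj_by G t a \<otimes> conj_by G h (b \<otimes> a) \<otimes> commutator G a b \<otimes> conj_by G v b"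
    using f g abC by (simp add: t_def h_def v_def word_simps)
  also have "conj_by G t a = s" using C abC by (simp add: s_def mult_commutator_eq_conj_by)
  also have "conj_by G v b = v \<otimes> commutator G v b"
    using C abC by (simp add: mult_commutator_eq_conj_by)
  also have "inv h \<otimes> (s \<otimes> conj_by G h (b \<otimes> a) \<otimes> commutator G a b \<otimes> (v \<otimes> commutator G v b))
    = s \<otimes> commutator G s h \<otimes> commutator G h (b \<otimes> a) \<otimes> commutator G a b \<otimes> (v \<otimes> commutator G v b)"
    using C abC by (simp add: word_simps)
  finally show "diff (\<lambda>n. commutator G (f n) (g n)) n =
    (let h = commutator G (f n) (g n); a = diff f n; b = diff g n;
             t = commutator G (f n) b; s = t \<otimes> commutator G t a; v = commutator G a (g n) in
       s \<otimes> commutator G s h \<otimes> commutator G h (b \<otimes> a) \<otimes> commutator G a b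
       \<otimes> (v \<otimes> commutator G v b))"
    unfolding Let_def a_def[symmetric] b_def[symmetric] t_def[symmetric] s_def[symmetric]
      v_def[symmetric] h_def[symmetric]
    by (simp add: diff_def h_def)
qed

text \<open>The three closure properties need a joint induction: the difference of a product or an
  inverse contains commutators, and that of a commutator contains products.\<close>

lemma pol_closed:
  "(\<forall>k f g. pol d k f \<longrightarrow> pol d k g \<longrightarrow> pol d k (\<lambda>n. f n \<otimes> g n)) \<and>
   (\<forall>k f. pol d k f \<longrightarrow> pol d k (\<lambda>n. inv (f n))) \<and>
   (\<forall>i j f g. pol d i f \<longrightarrow> pol d j g \<longrightarrow> pol d (i + j) (\<lambda>n. commutator G (f n) (g n)))"
proof (induction d)
  case 0
  then show ?case by (simp add: L_mult L_inv L_commutator)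
next
  case (Suc d)
  have mult: "pol d k (\<lambda>n. f n \<otimes> g n)" if "pol d k f" "pol d k g" for k f g
    using Suc that by blast
  have inv: "pol d k (\<lambda>n. inv (f n))" if "pol d k f" for k f
    using Suc that by blast
  have comm: "pol d k (\<lambda>n. commutator G (f n) (g n))"
    if "pol d i f" "pol d j g" "k \<le> i + j" for i j k f g
    using Suc that pol_mono by blast
  show ?case
  proof (intro conjI allI impI)
    fix k f g assume fg: "pol (Suc d) k f" "pol (Suc d) k g"
    have C: "\<And>n. f n \<in> carrier G" "\<And>n. g n \<in> carrier G" using fg pol_carrier by blast+
    have d: "pol d (Suc k) (diff f)" "pol d (Suc k) (diff g)" "pol d k g"
      using fg pol_Suc_imp by auto
    have "pol d (Suc k) (diff (\<lambda>n. f n \<otimes> g n))"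
      unfolding diff_mult[OF C] by (intro mult comm[OF d(1,3)] d) simp
    then show "pol (Suc d) k (\<lambda>n. f n \<otimes> g n)" using fg by (simp add: L_mult)
  next
    fix k f assume f: "pol (Suc d) k f"
    have C: "\<And>n. f n \<in> carrier G" using f pol_carrier by blast
    have d: "pol d (Suc k) (diff f)" "pol d k f"
      using f pol_Suc_imp by auto
    have "pol d (Suc k) (diff (\<lambda>n. inv (f n)))"
      unfolding diff_inv[OF C] by (intro mult inv comm[OF inv[OF d(1)] inv[OF d(2)]] d) simp
    then show "pol (Suc d) k (\<lambda>n. inv (f n))" using f by (simp add: L_inv)
  next
    fix i j f g assume fg: "pol (Suc d) i f" "pol (Suc d) j g"
    have C: "\<And>n. f n \<in> carrier G" "\<And>n. g n \<in> carrier G" using fg pol_carrier by blast+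
    have d: "pol d (Suc i) (diff f)" "pol d (Suc j) (diff g)" "pol d i f" "pol d j g"
      using fg pol_Suc_imp by auto
    let ?h = "\<lambda>n. commutator G (f n) (g n)" and ?t = "\<lambda>n. commutator G (f n) (diff g n)"
    let ?s = "\<lambda>n. ?t n \<otimes> commutator G (?t n) (diff f n)"
    let ?k = "Suc (i + j)" and ?v = "\<lambda>n. commutator G (diff f n) (g n)"
    have h: "pol d (i + j) ?h" by (rule comm[OF d(3,4)]) simp
    have t: "pol d ?k ?t" by (rule comm[OF d(3,2)]) simp
    have v: "pol d ?k ?v" by (rule comm[OF d(1,4)]) simp
    have s: "pol d ?k ?s" by (intro mult t comm[OF t d(1)]) simp
    \<comment> \<open>In the factor [h, b a] the extra degree over i + j must come from b a;
      differences have degree at least 1 even when i = j = 0.\<close>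
    have ba: "pol d 1 (\<lambda>n. diff g n \<otimes> diff f n)"
      by (intro mult pol_mono[OF d(1)] pol_mono[OF d(2)]) simp_all
    have "pol d ?k (diff ?h)"
      unfolding diff_commutator[OF C] Let_def
      by (intro mult s v comm[OF s h] comm[OF h ba] comm[OF d(1,2)] comm[OF v d(2)]) simp_all
    then show "pol (Suc d) (i + j) ?h" using pol_value fg L_commutator by simp
  qed
qed

definition poly_seq :: "nat \<Rightarrow> (nat \<Rightarrow> 'a) \<Rightarrow> bool" where
  "poly_seq k f \<longleftrightarrow> (\<forall>d. pol d k f)"

lemma poly_seq_iff: "poly_seq k f \<longleftrightarrow> (\<forall>n. f n \<in> L k) \<and> poly_seq (Suc k) (diff f)"
proof
  assume "poly_seq k f"
  then show "(\<forall>n. f n \<in> L k) \<and> poly_seq (Suc k) (diff f)"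
    unfolding poly_seq_def by (metis pol.simps(2))
next
  assume "(\<forall>n. f n \<in> L k) \<and> poly_seq (Suc k) (diff f)"
  then have "pol d k f" for d unfolding poly_seq_def by (cases d) auto
  then show "poly_seq k f" unfolding poly_seq_def by blast
qed

lemma poly_seq_value: "poly_seq k f \<Longrightarrow> f n \<in> L k"
  and poly_seq_diff: "poly_seq k f \<Longrightarrow> poly_seq (Suc k) (diff f)"
  using poly_seq_iff by blast+

lemma poly_seq_carrier: "poly_seq k f \<Longrightarrow> f n \<in> carrier G"
  using poly_seq_value L_carrier by blast

lemma poly_seq_mult: "poly_seq k f \<Longrightarrow> poly_seq k g \<Longrightarrow> poly_seq k (\<lambda>n. f n \<otimes> g n)"
  and poly_seq_inv: "poly_seq k f \<Longrightarrow> poly_seq k (\<lambda>n. inv (f n))"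
  and poly_seq_commutator:
    "poly_seq i f \<Longrightarrow> poly_seq j g \<Longrightarrow> poly_seq (i + j) (\<lambda>n. commutator G (f n) (g n))"
  unfolding poly_seq_def using pol_closed by blast+

lemma poly_seq_mono: "poly_seq k f \<Longrightarrow> j \<le> k \<Longrightarrow> poly_seq j f"
  unfolding poly_seq_def using pol_mono by blast

lemma diff_const: "c \<in> carrier G \<Longrightarrow> diff (\<lambda>n. c) = (\<lambda>n. \<one>)"
  by (auto simp: diff_def)

lemma poly_seq_one: "poly_seq k (\<lambda>n. \<one>)"
proof -
  have "pol d k (\<lambda>n. \<one>)" for d
    by (induction d arbitrary: k) (simp_all add: L_one diff_const)
  then show ?thesis by (simp add: poly_seq_def)
qed

lemma poly_seq_const: "c \<in> L k \<Longrightarrow> poly_seq k (\<lambda>n. c)"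
  using L_carrier by (subst poly_seq_iff) (simp add: diff_const poly_seq_one)

section \<open>Binomial powers and Taylor expansion\<close>

lemma diff_binomial:
  assumes "c \<in> carrier G"
  shows "diff (\<lambda>n. c [^] (n choose Suc i)) = (\<lambda>n. c [^] (n choose i))"
proof
  fix n
  have "c [^] (Suc n choose Suc i) = c [^] (n choose Suc i) \<otimes> c [^] (n choose i)"
    using assms by (simp add: nat_pow_mult add.commute)
  then show "diff (\<lambda>n. c [^] (n choose Suc i)) n = c [^] (n choose i)"
    using assms by (simp add: diff_def)
qed

lemma poly_seq_binomial: "c \<in> L (k + i) \<Longrightarrow> poly_seq k (\<lambda>n. c [^] (n choose i))"
proof (induction i arbitrary: k)
  case 0
  then show ?case using L_carrier by (simp add: poly_seq_const)
next
  case (Suc i)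
  have "c \<in> L k" using Suc.prems L_antimono[of k "k + Suc i"] by auto
  then show ?case
    using Suc by (subst poly_seq_iff) (simp add: diff_binomial L_pow L_carrier)
qed

lemma poly_seq_pow: "c \<in> L (Suc k) \<Longrightarrow> poly_seq k (\<lambda>n. c [^] n)"
  using poly_seq_binomial[of c k 1] by simp

lemma poly_seq_iterated_diff: "poly_seq k f \<Longrightarrow> poly_seq (k + i) ((diff ^^ i) f)"
  by (induction i) (auto dest: poly_seq_diff)

text \<open>Only the last term of Newton's forward difference formula is left. For a sequence of
  degree k this places the first nontrivial value, at m, in \<open>L (k + m)\<close>.\<close>

lemma iterated_diff_vanishing:
  assumes "\<And>n. f n \<in> carrier G" "\<And>n. n < m \<Longrightarrow> f n = \<one>"
  shows "(diff ^^ m) f 0 = f m"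
  using assms
proof (induction m arbitrary: f)
  case (Suc m)
  have "(diff ^^ m) (diff f) 0 = diff f m"
    using Suc.prems by (intro Suc.IH) (auto simp: diff_def)
  also have "\<dots> = f (Suc m)" using Suc.prems by (simp add: diff_def)
  finally show ?case by (simp add: funpow_Suc_right del: funpow.simps)
qed simp

lemma iterated_diff_binomial_top:
  assumes "c \<in> carrier G" "i < m"
  shows "(diff ^^ m) (\<lambda>n. c [^] (n choose i)) = (\<lambda>n. \<one>)"
  using assms(2)
proof (induction m arbitrary: i)
  case (Suc m)
  have one: "(diff ^^ m) (\<lambda>n. \<one>) = (\<lambda>n. \<one>)" by (induction m) (simp_all add: diff_const)
  show ?case
  proof (cases i)
    case 0
    then show ?thesis using assms(1) one by (simp add: funpow_Suc_right diff_const del: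
        funpow.simps)
  next
    case (Suc j)
    then show ?thesis
      using Suc.IH[of j] Suc.prems assms(1) \<open>i = Suc j\<close>
      by (simp add: funpow_Suc_right diff_binomial del: funpow.simps)
  qed
qed simp

text \<open>The difference of a product leaves a commutator of degree at least k + (k + 1), hence at
  least k + 2 as k is positive; the differences still to be taken carry it into the trivial
  term.\<close>

lemma iterated_diff_mult:
  assumes "poly_seq k f" "poly_seq k g" "0 < k" "L (Suc (k + m)) = {\<one>}"
  shows "(diff ^^ m) (\<lambda>n. f n \<otimes> g n) = (\<lambda>n. (diff ^^ m) f n \<otimes> (diff ^^ m) g n)"
  using assms
proof (induction m arbitrary: k f g)
  case (Suc m)
  let ?c = "\<lambda>n. commutator G (diff f n) (g n)"
  note C = poly_seq_carrier[OF Suc.prems(1)] poly_seq_carrier[OF Suc.prems(2)]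
  note d = poly_seq_diff[OF Suc.prems(1)] poly_seq_diff[OF Suc.prems(2)]
  have c: "poly_seq (Suc (Suc k)) ?c"
    using poly_seq_mono[OF poly_seq_commutator[OF d(1) Suc.prems(2)]] Suc.prems(3) by simp
  have L1: "L (Suc (Suc k + m)) = {\<one>}" using Suc.prems(4) by simp
  have "(diff ^^ m) ?c n = \<one>" for n
    using poly_seq_value[OF poly_seq_iterated_diff[OF c, of m], of n] L1 by simp
  moreover have "poly_seq (Suc k) ?c" using poly_seq_mono[OF c] by simp
  ultimately have "(diff ^^ m) (\<lambda>n. diff f n \<otimes> (?c n \<otimes> diff g n))
      = (\<lambda>n. (diff ^^ m) (diff f) n \<otimes> (diff ^^ m) (diff g) n)"
    using Suc.IH[OF d(1) poly_seq_mult[OF _ d(2)] _ L1] Suc.IH[OF _ d(2) _ L1]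
      poly_seq_carrier[OF poly_seq_iterated_diff[OF d(2), of m]] by simp
  then show ?case by (simp add: funpow_Suc_right diff_mult[OF C] del: funpow.simps)
qed simp

text \<open>Removing the binomial factors of orders \<open>2, \<dots>, m - 1\<close> from the Taylor expansion of \<open>f\<close>.\<close>

lemma poly_seq_truncate:
  assumes p: "Factorial_Ring.prime p" and f: "poly_seq k f" "f 0 = \<one>" "f 1 = \<one>"
    and expo: "\<And>c. c \<in> L (k + 2) \<Longrightarrow> c [^] p = \<one>"
    and m: "2 \<le> m" "m \<le> p"
  shows "\<exists>F. poly_seq k F \<and> (\<forall>n<m. F n = \<one>) \<and> F p = f p \<and>
    (0 < k \<and> L (Suc (k + p)) = {\<one>} \<longrightarrow> (diff ^^ p) F = (diff ^^ p) f)"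
  using m
proof (induction m rule: dec_induct)
  case base
  have "\<forall>n<2. f n = \<one>" using f(2,3) by (auto simp: less_2_cases_iff)
  then show ?case using f(1) by blast
next
  case (step m)
  then obtain F where F: "poly_seq k F" "\<And>n. n < m \<Longrightarrow> F n = \<one>" "F p = f p"
    "0 < k \<Longrightarrow> L (Suc (k + p)) = {\<one>} \<Longrightarrow> (diff ^^ p) F = (diff ^^ p) f" by auto
  define c where "c = inv (F m)"
  \<comment> \<open>F is trivial before m, so F m is its m-th difference at 0.\<close>
  have "F m \<in> L (k + m)"
    using iterated_diff_vanishing[of F m] F poly_seq_carrier[OF F(1)]
      poly_seq_value[OF poly_seq_iterated_diff[OF F(1), of m], of 0] by simp
  then have c: "c \<in> L (k + m)" by (simp add: c_def L_inv)
  then have cC: "c \<in> carrier G" using L_carrier by blast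
  let ?b = "\<lambda>n. c [^] (n choose m)" let ?F = "\<lambda>n. ?b n \<otimes> F n"
  note FC = poly_seq_carrier[OF F(1)]
  have b: "poly_seq k ?b" by (rule poly_seq_binomial[OF c])
  \<comment> \<open>Dividing out the factor of order m does not change the value at p, because p
    divides p choose m for 0 < m < p.\<close>
  have "c [^] p = \<one>" using c expo L_antimono[of "k + 2" "k + m"] step by auto
  moreover have "p dvd p choose m" using p step by (intro dvd_choose_prime) auto
  ultimately have "?b p = \<one>" using cC dvd_pow_eq_one by blast
  then have "?F p = f p" using F(3) FC[of p] by simp
  moreover have "?F n = \<one>" if "n < Suc m" for n
  proof (cases "n = m")
    case True
    then show ?thesis using FC[of m] by (simp add: c_def)
  next
    case False
    then show ?thesis using that F(2) cC by (simp add: binomial_eq_0)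
  qed
  moreover have "(diff ^^ p) ?F = (diff ^^ p) f" if "0 < k" "L (Suc (k + p)) = {\<one>}"
    using iterated_diff_mult[OF b F(1) that] F(4)[OF that] step cC
      poly_seq_carrier[OF poly_seq_iterated_diff[OF F(1), of p]]
    by (simp add: iterated_diff_binomial_top)
  ultimately show ?case using poly_seq_mult[OF b F(1)] by blast
qed

text \<open>Of the Taylor factors, those of orders 2 to p - 1 are trivial at p by the exponent
  hypothesis, so f(1)^p and the factor of order p remain. Order 1 is divided out separately, since
  f(1) may have order other than p.\<close>

lemma poly_seq_at_prime_aux:
  assumes p: "Factorial_Ring.prime p" and f: "poly_seq k f" "f 0 = \<one>"
    and expo: "\<And>c. c \<in> L (k + 2) \<Longrightarrow> c [^] p = \<one>"
  shows "\<exists>F. poly_seq k F \<and> inv (f 1 [^] p) \<otimes> f p = (diff ^^ p) F 0 \<and>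
    (0 < k \<and> L (Suc (k + p)) = {\<one>} \<longrightarrow> (diff ^^ p) F = (diff ^^ p) f)"
proof -
  have p2: "2 \<le> p" using p by (rule prime_ge_2_nat)
  note fC = poly_seq_carrier[OF f(1)]
  let ?c = "inv (f 1)"
  have cC: "?c \<in> carrier G" using fC by simp
  have "?c \<in> L (Suc k)"
    using poly_seq_value[OF poly_seq_diff[OF f(1)], of 0] f(2) fC L_inv[of "f 1" "Suc k"]
    by (simp add: diff_def)
  then have c: "poly_seq k (\<lambda>n. ?c [^] (n choose 1))" by (intro poly_seq_binomial) simp
  let ?g = "\<lambda>n. ?c [^] (n choose 1) \<otimes> f n"
  have "?g 0 = \<one>" "?g 1 = \<one>" using f(2) fC by simp_all
  then obtain F where F: "poly_seq k F" "\<And>n. n < p \<Longrightarrow> F n = \<one>" "F p = ?g p"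
    "0 < k \<Longrightarrow> L (Suc (k + p)) = {\<one>} \<Longrightarrow> (diff ^^ p) F = (diff ^^ p) ?g"
    using poly_seq_truncate[OF p poly_seq_mult[OF c f(1)] _ _ expo p2] by blast
  have "(diff ^^ p) F 0 = ?g p"
    using iterated_diff_vanishing[of F p] F(2,3) poly_seq_carrier[OF F(1)] by simp
  then have "inv (f 1 [^] p) \<otimes> f p = (diff ^^ p) F 0" using fC by (simp add: nat_pow_inv)
  moreover have "(diff ^^ p) F = (diff ^^ p) f" if "0 < k" "L (Suc (k + p)) = {\<one>}"
    using iterated_diff_mult[OF c f(1) that] F(4)[OF that] p2 cC
      poly_seq_carrier[OF poly_seq_iterated_diff[OF f(1), of p]]
      iterated_diff_binomial_top[OF cC, of 1 p]
    by simp
  ultimately show ?thesis using F(1) by blast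
qed

lemma poly_seq_at_prime:
  assumes "Factorial_Ring.prime p" "poly_seq k f" "f 0 = \<one>"
    and "\<And>c. c \<in> L (k + 2) \<Longrightarrow> c [^] p = \<one>" and L1: "L (k + p) = {\<one>}"
  shows "f p = f 1 [^] p"
proof -
  obtain F where F: "poly_seq k F" "inv (f 1 [^] p) \<otimes> f p = (diff ^^ p) F 0"
    using poly_seq_at_prime_aux[OF assms(1-4)] by blast
  then have "inv (f 1 [^] p) \<otimes> f p = \<one>"
    using poly_seq_value[OF poly_seq_iterated_diff[OF F(1), of p], of 0] L1 by simp
  then show ?thesis
    using poly_seq_carrier[OF assms(2)] by (metis inv_equality inv_inv nat_pow_closed inv_closed
        l_inv)
qed

text \<open>The filtration is one term longer than in \<open>poly_seq_at_prime\<close>, so the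
  factor of order p survives. It is the p-th difference of f itself, because the factors divided out
  have orders below p and hence trivial p-th difference.\<close>

lemma poly_seq_at_prime':
  assumes "Factorial_Ring.prime p" "poly_seq k f" "f 0 = \<one>"
    and "\<And>c. c \<in> L (k + 2) \<Longrightarrow> c [^] p = \<one>" and L1: "0 < k" "L (Suc (k + p)) = {\<one>}"
  shows "f p = f 1 [^] p \<otimes> (diff ^^ p) f 0"
proof -
  have "inv (f 1 [^] p) \<otimes> f p = (diff ^^ p) f 0"
    using poly_seq_at_prime_aux[OF assms(1-4)] L1 by force
  then have "f 1 [^] p \<otimes> (diff ^^ p) f 0 = f 1 [^] p \<otimes> (inv (f 1 [^] p) \<otimes> f p)" by simp
  then show ?thesis using poly_seq_carrier[OF assms(2)] by simp
qed

text \<open>Regularity in class less than p: the sequence y^-n x^-n (x y)^n is trivial at 0 and at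
  1, hence at p. The equality of \<open>L 0\<close> and \<open>L 1\<close> makes n -> z^n a sequence
  of degree 0 for every z in \<open>L 0\<close>.\<close>

lemma prime_pow_mult_eq_one:
  assumes p: "Factorial_Ring.prime p" and L01: "L 0 = L 1" and Lp: "L p = {\<one>}"
    and expo: "\<And>c. c \<in> L 2 \<Longrightarrow> c [^] p = \<one>"
    and xy: "x \<in> L 0" "y \<in> L 0" "x [^] p = \<one>" "y [^] p = \<one>"
  shows "(x \<otimes> y) [^] p = \<one>"
proof -
  have C: "x \<in> carrier G" "y \<in> carrier G" using xy L_carrier by auto
  have pow: "poly_seq 0 (\<lambda>n. z [^] n)" if "z \<in> L 0" for z
    using that L01 by (intro poly_seq_pow) simp
  let ?f = "\<lambda>n::nat. inv (y [^] n) \<otimes> (inv (x [^] n) \<otimes> (x \<otimes> y) [^] n)"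
  have f: "poly_seq 0 ?f" using xy by (intro poly_seq_mult poly_seq_inv pow L_mult)
  have f0: "?f 0 = \<one>" by simp
  have L2: "\<And>c. c \<in> L (0 + 2) \<Longrightarrow> c [^] p = \<one>" and Lp': "L (0 + p) = {\<one>}"
    using expo Lp by (simp_all only: add_0)
  have "?f p = ?f 1 [^] p" using poly_seq_at_prime[OF p f f0 L2 Lp'] .
  then show ?thesis using C xy by simp
qed

end

section \<open>Groups of small class with central p-th powers\<close>

text \<open>Telescoping (a + 1)^(e+1) - a^(e+1) over a < p expresses p^(e+1) through the power sums
  with exponents up to e, the last of them with coefficient e + 1, prime to p. For e = 0 the
  convention 0^0 = 1 makes the sum equal to p.\<close>

lemma prime_dvd_power_sum:
  assumes p: "Factorial_Ring.prime (p::nat)" and e: "Suc e < p"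
  shows "p dvd (\<Sum>a<p. a ^ e)"
  using e
proof (induction e rule: less_induct)
  case (less e)
  have "(\<Sum>a<p. (a + 1) ^ Suc e) = (\<Sum>a<p. \<Sum>j\<le>Suc e. (Suc e choose j) * a ^ j)"
    by (simp only: binomial_ring power_one mult_1_right of_nat_id)
  also have "\<dots> = (\<Sum>j\<le>Suc e. (Suc e choose j) * (\<Sum>a<p. a ^ j))"
    by (subst sum.swap) (simp only: sum_distrib_left)
  also have "\<dots> = (\<Sum>j<e. (Suc e choose j) * (\<Sum>a<p. a ^ j)) + Suc e * (\<Sum>a<p. a ^ e)
      + (\<Sum>a<p. a ^ Suc e)"
    by (simp add: lessThan_Suc_atMost[symmetric] del: binomial_Suc_Suc)
  also have "(\<Sum>a<p. (a + 1) ^ Suc e) = p ^ Suc e + (\<Sum>a<p. a ^ Suc e)"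
  proof -
    have "(\<Sum>a<m. (a + 1) ^ Suc e) = m ^ Suc e + (\<Sum>a<m. a ^ Suc e)" for m :: nat
    proof (induction m)
      case (Suc m)
      then show ?case by (simp del: power_Suc)
    qed simp
    then show ?thesis .
  qed
  finally have "p ^ Suc e = (\<Sum>j<e. (Suc e choose j) * (\<Sum>a<p. a ^ j)) + Suc e * (\<Sum>a<p. a ^ e)"
    (is "_ = ?s + ?t") by simp
  then have "p dvd ?s + ?t" by (metis dvd_power zero_less_Suc)
  moreover have "p dvd ?s"
    by (rule dvd_sum, rule dvd_mult, rule less.IH) (use less.prems in auto)
  ultimately have "p dvd ?t" by (simp only: dvd_add_right_iff)
  then show ?case
    using p less.prems prime_dvd_mult_iff[OF p, of "Suc e"] nat_dvd_not_less[of "Suc e" p] by blast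
qed

text \<open>Fermat's little theorem, by expanding (a + 1)^p.\<close>

lemma prime_dvd_power_diff:
  assumes p: "Factorial_Ring.prime (p::nat)"
  shows "int p dvd int a ^ p - int a"
proof (induction a)
  case 0
  then show ?case using prime_gt_0_nat[OF p] by (simp add: power_0_left)
next
  case (Suc a)
  have "(1 + int a) ^ p = (\<Sum>k\<le>p. int (p choose k) * int a ^ k)"
    using binomial_ring[of "int a" 1 p] by (simp add: add.commute)
  also have "\<dots> = (\<Sum>k\<in>{0<..<p}. int (p choose k) * int a ^ k) + 1 + int a ^ p"
  proof -
    have "{..p} = insert 0 (insert p {0<..<p})" using prime_gt_0_nat[OF p] by auto
    then show ?thesis using prime_gt_0_nat[OF p] by simp
  qed
  finally have "int (Suc a) ^ p - int (Suc a)
      = (\<Sum>k\<in>{0<..<p}. int (p choose k) * int a ^ k) + (int a ^ p - int a)" by simp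
  moreover have "int p dvd (\<Sum>k\<in>{0<..<p}. int (p choose k) * int a ^ k)"
    by (intro dvd_sum dvd_mult2) (auto intro!: dvd_choose_prime p)
  ultimately show ?case using Suc by (metis dvd_add)
qed

lemma (in group) pow_eq_of_dvd_diff:
  assumes x: "x \<in> carrier G" "x [^] (p::nat) = \<one>" and d: "int p dvd int m - int n"
  shows "x [^] m = x [^] n"
proof -
  obtain q where q: "int m - int n = int p * q" using d by (elim dvdE)
  have "x [^] (int m - int n) = \<one>"
    using x unfolding q by (simp add: int_pow_int flip: int_pow_pow)
  moreover have "x [^] int m = x [^] (int m - int n) \<otimes> x [^] int n"
    using x by (simp flip: int_pow_mult)
  ultimately show ?thesis using x by (simp add: int_pow_int)
qed

lemma (in group) pow_prime_eq_one_imp: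
  assumes x: "x \<in> carrier G" "x [^] (p::nat) = \<one>" "x [^] (m::nat) = \<one>" and "coprime m p"
  shows "x = \<one>"
proof -
  obtain u v where "u * int m + v * int p = 1"
    using bezout_int[of "int m" "int p"] assms(4) by (auto simp flip: gcd_int_int_eq)
  then have "x = x [^] (int m * u + int p * v)" using x by (simp add: mult.commute)
  also have "\<dots> = (x [^] int m) [^] u \<otimes> (x [^] int p) [^] v"
    using x by (simp add: int_pow_mult int_pow_pow)
  finally show ?thesis using x by (simp add: int_pow_int)
qed

section \<open>The lower central series as a filtration\<close>

context group
begin

text \<open>The Hall--Witt identity, solved for one of its three factors.\<close>

lemma hall_witt:
  assumes "x \<in> carrier G" "y \<in> carrier G" "z \<in> carrier G"
  shows "commutator G (commutator G y z) x =
    conj_by G (inv (conj_by G (commutator G (commutator G x (inv y)) (inv z)) y)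
      \<otimes> inv (conj_by G (commutator G (commutator G (inv z) (inv x)) y) x)) z"
  using assms by (simp add: word_simps)

lemma lower_central_Suc: "lower_central G (Suc i) \<subseteq> lower_central G i"
proof (cases i)
  case (Suc j)
  then show ?thesis
    using commutator_subgroup_least[OF normal_imp_subgroup[OF lower_central_normal[of i]]]
      normal_commutator_left[OF lower_central_normal[of i]] by auto
qed simp

declare lower_central.simps(3) [simp del]

lemma lower_central_commutator_carrier:
  "x \<in> lower_central G (Suc i) \<Longrightarrow> y \<in> carrier G \<Longrightarrow>
    commutator G x y \<in> lower_central G (Suc (Suc i))"
  unfolding lower_central.simps by (rule commutator_subgroup_incl)

text \<open>Induction on the second index. For a generator y = [w, z] the Hall-Witt identity
  expresses [y, x] through [[x, w^-1], z^-1] and [[z^-1, x^-1], w], and w has a smaller index than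
  y.\<close>

lemma lower_central_commutator:
  assumes "x \<in> lower_central G i" "y \<in> lower_central G j"
  shows "commutator G x y \<in> lower_central G (i + j)"
proof -
  note normal = lower_central_normal
  have C: "lower_central G i \<subseteq> carrier G" for i by (rule normal_subset[OF normal])
  have main: "commutator G x y \<in> lower_central G (Suc i + Suc j)"
    if "x \<in> lower_central G (Suc i)" "y \<in> lower_central G (Suc j)" for x y i j
    using that
  proof (induction j arbitrary: i x y)
    case 0
    then have "y \<in> carrier G" using C by blast
    then show ?case
      using lower_central_commutator_carrier[OF 0(1)] by simp
  next
    case (Suc j)
    let ?R = "lower_central G (Suc i + Suc (Suc j))"
    have R: "?R = lower_central G (Suc (Suc (Suc (i + j))))" by simp
    let ?S = "{commutator G h k |h k. h \<in> lower_central G (Suc j) \<and> k \<in> carrier G}"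
    have "commutator G y x \<in> ?R"
    proof (rule generate_commutator_in_normal[OF normal C])
      show "?S \<subseteq> carrier G"
      proof
        fix c assume "c \<in> ?S"
        then obtain h k where "c = commutator G h k" "h \<in> lower_central G (Suc j)" "k \<in> carrier G"
          by blast
        then show "c \<in> carrier G" using subsetD[OF C, of h] by auto
      qed
      show "y \<in> generate G ?S"
        using Suc.prems(2) by (simp add: lower_central.simps(3) commutator_subgroup_def)
      show "x \<in> lower_central G (Suc i)" using Suc.prems(1) .
      fix s g assume "s \<in> ?S" and g: "g \<in> lower_central G (Suc i)"
      then obtain w z where s: "s = commutator G w z" and w: "w \<in> lower_central G (Suc j)"
        and z: "z \<in> carrier G" by blast
      have wC: "w \<in> carrier G" "g \<in> carrier G" using w g C by blast+
      have inv_in: "inv a \<in> lower_central G i" if "a \<in> lower_central G i" for a i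
        using that subgroup.m_inv_closed[OF normal_imp_subgroup[OF normal]] by blast
      have "commutator G g (inv w) \<in> lower_central G (Suc (Suc (i + j)))"
        using Suc.IH[OF g inv_in[OF w]] by simp
      then have 1: "commutator G (commutator G g (inv w)) (inv z) \<in> ?R"
        unfolding R using z lower_central_commutator_carrier by simp
      have "commutator G (inv g) (inv z) \<in> lower_central G (Suc (Suc i))"
        using inv_in[OF g] z lower_central_commutator_carrier by simp
      then have "commutator G (inv z) (inv g) \<in> lower_central G (Suc (Suc i))"
        using inv_in wC z by (subst commutator_swap) auto
      then have 2: "commutator G (commutator G (inv z) (inv g)) w \<in> ?R"
        using Suc.IH[OF _ w, of _ "Suc i"] by simp
      show "commutator G s g \<in> ?R"
        unfolding s hall_witt[OF wC(2,1) z]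
        by (intro normal_conj_by[OF normal] inv_in 1 2 z wC
            subgroup.m_closed[OF normal_imp_subgroup[OF normal]])
    qed
    then have "inv (commutator G y x) \<in> ?R"
      using subgroup.m_inv_closed[OF normal_imp_subgroup[OF normal]] by blast
    moreover have "x \<in> carrier G" "y \<in> carrier G" using Suc.prems C by blast+
    ultimately show ?case using commutator_swap[of y x] by simp
  qed
  show ?thesis
  \<comment> \<open>At the dummy index 0 the series is the whole group, and the claim is normality
    of the other term.\<close>
  proof (cases "i = 0 \<or> j = 0")
    case True
    have "x \<in> carrier G" "y \<in> carrier G" using assms C by blast+
    then show ?thesis
      using True assms normal_commutator_left[OF normal] normal_commutator_right[OF normal] by auto
  next
    case False
    then show ?thesis using main[of x "i - 1" y "j - 1"] assms by simp
  qed
qed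

lemma lower_central_filtered: "filtered_group G (lower_central G)"
  by (intro filtered_group.intro filtered_group_axioms.intro is_group)
    (simp_all add: lower_central_Suc normal_imp_subgroup lower_central_normal
        lower_central_commutator)

end

text \<open>The maximum makes the terms at 0 and 1 both equal to \<open>L k\<close>, as
  \<open>prime_pow_mult_eq_one\<close> requires; the factor k makes the filtration reach the trivial
  group before index p.\<close>

lemma (in filtered_group) scaled_filtered:
  "filtered_group G (\<lambda>i. L (k * max i 1))"
proof (intro filtered_group.intro filtered_group_axioms.intro is_group)
  show "L (k * max (Suc i) 1) \<subseteq> L (k * max i 1)" for i
    by (rule L_antimono) auto
  show "commutator G x y \<in> L (k * max (i + j) 1)"
    if "x \<in> L (k * max i 1)" "y \<in> L (k * max j 1)" for x y i j
  proof -
    have "k * max (i + j) 1 \<le> k * max i 1 + k * max j 1"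
      unfolding distrib_left[symmetric] by (rule mult_le_mono2) auto
    then show ?thesis using L_commutator[OF that] L_antimono by blast
  qed
qed (rule L_subgroup)

section \<open>Iterated commutators in the last term of a filtration\<close>

locale top_filtered_group = filtered_group +
  assumes L_carrier_eq: "L 0 = carrier G" "L 1 = carrier G"
begin

abbreviation icomm :: "'a \<Rightarrow> 'a list \<Rightarrow> 'a" where
  "icomm v gs \<equiv> foldl (commutator G) v gs"

lemma L_commutator_carrier: "v \<in> L j \<Longrightarrow> g \<in> carrier G \<Longrightarrow> commutator G v g \<in> L (Suc j)"
  using L_commutator[of v j g 1] L_carrier_eq by simp

lemma icomm_in: "v \<in> L j \<Longrightarrow> set gs \<subseteq> carrier G \<Longrightarrow> icomm v gs \<in> L (j + length gs)"
proof (induction gs arbitrary: v j)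
  case (Cons g gs)
  then show ?case using Cons.IH[of "commutator G v g" "Suc j"] by (simp add: L_commutator_carrier)
qed simp

text \<open>In [v w, g] = [v, g] [v, g, w] [w, g] the middle factor has degree 2 j + 1, at least j +
  2, and the remaining entries push it into the trivial term.\<close>

lemma icomm_mult:
  assumes "v \<in> L j" "w \<in> L j" "0 < j" "set gs \<subseteq> carrier G" "L (Suc (j + length gs)) = {\<one>}"
  shows "icomm (v \<otimes> w) gs = icomm v gs \<otimes> icomm w gs"
  using assms
proof (induction gs arbitrary: v w j)
  case (Cons g gs)
  let ?a = "commutator G v g" and ?b = "commutator G w g"
  let ?z = "commutator G ?a w"
  have g: "g \<in> carrier G" "set gs \<subseteq> carrier G" using Cons.prems by auto
  have C: "v \<in> carrier G" "w \<in> carrier G" using Cons.prems L_carrier by auto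
  have ab: "?a \<in> L (Suc j)" "?b \<in> L (Suc j)" using Cons.prems g by (auto simp: L_commutator_carrier)
  have z: "?z \<in> L (Suc (Suc j))"
    using L_commutator[OF ab(1) Cons.prems(2)] L_antimono[of "Suc (Suc j)" "Suc j + j"]
        Cons.prems(3)
    by auto
  then have z': "?z \<in> L (Suc j)" using L_Suc by blast
  have L1: "L (Suc (Suc j + length gs)) = {\<one>}" using Cons.prems(5) by simp
  have "icomm ?z gs = \<one>" using icomm_in[OF z g(2)] L1 by simp
  moreover have "commutator G (v \<otimes> w) g = ?a \<otimes> (?z \<otimes> ?b)"
    using C g by (simp add: word_simps)
  moreover have "icomm ?b gs \<in> carrier G" using icomm_in[OF ab(2) g(2)] L_carrier by blast
  ultimately show ?case
    using Cons.IH[OF ab(1) L_mult[OF z' ab(2)] _ g(2) L1] Cons.IH[OF z' ab(2) _ g(2) L1] by simp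
qed simp

lemma icomm_one: "set gs \<subseteq> carrier G \<Longrightarrow> icomm \<one> gs = \<one>"
  by (induction gs) (simp_all add: word_simps)

lemma icomm_inv:
  assumes "v \<in> L j" "0 < j" "set gs \<subseteq> carrier G" "L (Suc (j + length gs)) = {\<one>}"
  shows "icomm (inv v) gs = inv (icomm v gs)"
proof -
  have C: "v \<in> carrier G" "icomm v gs \<in> carrier G" "icomm (inv v) gs \<in> carrier G"
    using icomm_in[OF assms(1,3)] icomm_in[OF L_inv[OF assms(1)] assms(3)] assms(1) L_carrier by
        auto
  have "icomm (inv v) gs \<otimes> icomm v gs = icomm (inv v \<otimes> v) gs"
    using icomm_mult[OF L_inv[OF assms(1)] assms] by simp
  also have "\<dots> = \<one>" using C assms(3) by (simp add: icomm_one)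
  finally show ?thesis using C inv_equality by metis
qed

text \<open>With \<open>icomm_mult\<close> this makes iterated commutators multilinear when they
  land in the last nontrivial term. A later slot is reached by absorbing the entries before it into
  v.\<close>

lemma icomm_slot_mult:
  assumes "v \<in> L j" "0 < j" "g \<in> carrier G" "h \<in> carrier G" "set gs \<subseteq> carrier G"
    and L1: "L (Suc (Suc (j + length gs))) = {\<one>}"
  shows "icomm v ((g \<otimes> h) # gs) = icomm v (h # gs) \<otimes> icomm v (g # gs)"
proof -
  let ?a = "commutator G v g" and ?b = "commutator G v h"
  let ?z = "commutator G ?a h"
  have C: "v \<in> carrier G" using assms L_carrier by auto
  have ab: "?a \<in> L (Suc j)" "?b \<in> L (Suc j)" using assms by (auto simp: L_commutator_carrier)
  have z: "?z \<in> L (Suc (Suc j))" using ab(1) assms(4) by (rule L_commutator_carrier)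
  then have z': "?z \<in> L (Suc j)" using L_Suc by blast
  have L1': "L (Suc (Suc j + length gs)) = {\<one>}" using L1 by simp
  have "icomm ?z gs = \<one>" using icomm_in[OF z assms(5)] L1 by simp
  moreover have "commutator G v (g \<otimes> h) = ?b \<otimes> (?a \<otimes> ?z)"
    using C assms by (simp add: word_simps)
  moreover have "icomm ?a gs \<in> carrier G" using icomm_in[OF ab(1) assms(5)] L_carrier by blast
  ultimately show ?thesis
    using icomm_mult[OF ab(2) L_mult[OF ab(1) z'] _ assms(5) L1']
      icomm_mult[OF ab(1) z' _ assms(5) L1'] by simp
qed

lemma icomm_slot_pow:
  assumes "v \<in> L j" "0 < j" "g \<in> carrier G" "set gs \<subseteq> carrier G"
    and L1: "L (Suc (Suc (j + length gs))) = {\<one>}"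
  shows "icomm v ((g [^] (a::nat)) # gs) = icomm v (g # gs) [^] a"
proof (induction a)
  case 0
  have "v \<in> carrier G" using assms L_carrier by auto
  then have "commutator G v \<one> = \<one>" by (simp add: word_simps)
  then show ?case using icomm_one assms by simp
next
  case (Suc a)
  have "icomm v (g # gs) \<in> carrier G"
    using icomm_in[of v j "g # gs"] assms L_carrier by auto
  moreover have "icomm v ((g [^] a \<otimes> g) # gs) = icomm v (g # gs) \<otimes> icomm v ((g [^] a) # gs)"
    using assms by (intro icomm_slot_mult) auto
  ultimately show ?case using Suc by (simp flip: nat_pow_Suc2)
qed

end

context top_filtered_group
begin

text \<open>Expanding \<open>[v, \<^sub>m x\<^sup>a y]\<close> and summing the terms, with weights \<open>a\<^sup>e\<close>, over all residues
  \<open>a \<noteq> 0\<close>: the power sums modulo \<open>p\<close> kill every mixed term.\<close>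

context
  fixes p q :: nat and v x y :: 'a and j :: nat
  assumes p: "Factorial_Ring.prime p" and pq: "p = Suc q"
    and v: "v \<in> L j" "0 < j" and xy: "x \<in> carrier G" "y \<in> carrier G"
    and top: "L (Suc (j + q)) = {\<one>}"
    and expo: "\<And>c. c \<in> L (j + q) \<Longrightarrow> c [^] p = \<one>"
begin

text \<open>The last term before the filtration becomes trivial is central, so it is a commutative
  group in which products over residues can be written with \<open>finprod\<close>.\<close>

definition B where "B = G\<lparr>carrier := L (j + q)\<rparr>"

lemma comm_group_B: "comm_group B"
proof (rule group.group_comm_groupI)
  show "group B" unfolding B_def by (rule subgroup_imp_group[OF L_subgroup])
  fix a b assume "a \<in> carrier B" "b \<in> carrier B"
  then have ab: "a \<in> L (j + q)" "b \<in> L (j + q)" by (simp_all add: B_def)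
  then have C: "a \<in> carrier G" "b \<in> carrier G" using L_carrier by auto
  then have "commutator G a b = \<one>" using L_commutator_carrier[OF ab(1) C(2)] top by simp
  then show "a \<otimes>\<^bsub>B\<^esub> b = b \<otimes>\<^bsub>B\<^esub> a" using C by (simp add: B_def commutator_eq_one_iff)
qed

interpretation B: comm_group B by (rule comm_group_B)

lemma B_simps [simp]:
  "carrier B = L (j + q)" "\<one>\<^bsub>B\<^esub> = \<one>" "a \<otimes>\<^bsub>B\<^esub> b = a \<otimes> b" "a [^]\<^bsub>B\<^esub> (n::nat) = a [^] n"
  by (simp_all add: B_def nat_pow_def)

lemma icomm_in_B:
  "set s \<subseteq> carrier G \<Longrightarrow> length s = q \<Longrightarrow> icomm v s \<in> L (j + q)"
  using icomm_in[OF v(1)] by metis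

lemma finprod_pow:
  assumes "c \<in> L (j + q)" "finite A"
  shows "finprod B (\<lambda>a. c [^] (f a :: nat)) A = c [^] (\<Sum>a\<in>A. f a)"
  using assms(2)
proof (induction rule: finite_induct)
  case (insert a A)
  then show ?case
    using assms(1) L_carrier[OF assms(1)] by (simp add: L_pow nat_pow_mult Pi_def)
qed simp

text \<open>For 0 < e < q the power sum is divisible by p; for e = q every summand is 1 modulo p by
  Fermat, which leaves the number q of nonzero residues.\<close>

lemma power_sum_mod:
  assumes c: "c \<in> L (j + q)" and e: "0 < e" "e \<le> q"
  shows "c [^] (\<Sum>a\<in>{1..q}. a ^ e) = (if e = q then c [^] q else \<one>)"
proof -
  have C: "c \<in> carrier G" "c [^] p = \<one>" using c L_carrier expo by auto
  have sum0: "(\<Sum>a\<in>{1..q}. a ^ e) = (\<Sum>a<p. a ^ e)"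
  proof -
    have "{..<p} = insert 0 {1..q}" using pq by auto
    then show ?thesis using e by simp
  qed
  show ?thesis
  proof (cases "e = q")
    case False
    then have "p dvd (\<Sum>a\<in>{1..q}. a ^ e)"
      using prime_dvd_power_sum[OF p, of e] e sum0 pq by simp
    then show ?thesis using dvd_pow_eq_one C False by simp
  next
    case True
    have "int p dvd (\<Sum>a\<in>{1..q}. int a ^ q - 1)"
    proof (rule dvd_sum)
      fix a assume a: "a \<in> {1..q}"
      have "int a * (int a ^ q - 1) = int a ^ p - int a"
        by (simp add: pq right_diff_distrib)
      then have "int p dvd int a * (int a ^ q - 1)"
        using prime_dvd_power_diff[OF p, of a] by simp
      moreover have "\<not> int p dvd int a"
        using a pq nat_dvd_not_less[of a p] by (simp only: int_dvd_int_iff) simp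
      ultimately show "int p dvd int a ^ q - 1"
        using p prime_dvd_mult_iff[of "int p"] by auto
    qed
    also have "(\<Sum>a\<in>{1..q}. int a ^ q - 1) = int (\<Sum>a\<in>{1..q}. a ^ q) - int q"
      by (simp add: sum_subtractf)
    finally show ?thesis using pow_eq_of_dvd_diff[OF C] True by simp
  qed
qed

text \<open>The prefix s records the choices made in the slots already expanded; m slots still carry
  x^a y.\<close>

definition expand :: "'a list \<Rightarrow> nat \<Rightarrow> nat \<Rightarrow> 'a" where
  "expand s m a = icomm v (s @ replicate m (x [^] a \<otimes> y))"

lemma expand_in:
  "set s \<subseteq> carrier G \<Longrightarrow> length s + m = q \<Longrightarrow> expand s m a \<in> L (j + q)"
  unfolding expand_def using xy by (intro icomm_in_B) auto

lemma expand_Suc: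
  assumes "set s \<subseteq> carrier G" "length s + Suc m = q"
  shows "expand s (Suc m) a = expand (s @ [y]) m a \<otimes> expand (s @ [x]) m a [^] a"
proof -
  let ?r = "replicate m (x [^] a \<otimes> y)"
  have s: "icomm v s \<in> L (j + length s)" using icomm_in[OF v(1) assms(1)] .
  have "Suc (j + length s + length ?r) = j + q" using assms(2) by simp
  then have L1: "L (Suc (Suc (j + length s + length ?r))) = {\<one>}" using top by (simp only:)
  have r: "set ?r \<subseteq> carrier G" using xy by auto
  have "icomm (icomm v s) ((x [^] a \<otimes> y) # ?r)
      = icomm (icomm v s) (y # ?r) \<otimes> icomm (icomm v s) (x # ?r) [^] a"
    using icomm_slot_mult[OF s _ _ xy(2) r L1, of "x [^] a"] icomm_slot_pow[OF s _ xy(1) r L1, of a]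
      v(2) xy(1) by simp
  then show ?thesis by (simp add: expand_def)
qed

lemma expand_weighted_Suc:
  assumes "set s \<subseteq> carrier G" "length s + Suc m = q"
  shows "finprod B (\<lambda>a. expand s (Suc m) a [^] (a ^ e)) {1..q}
    = finprod B (\<lambda>a. expand (s @ [y]) m a [^] (a ^ e)) {1..q}
      \<otimes> finprod B (\<lambda>a. expand (s @ [x]) m a [^] (a ^ Suc e)) {1..q}"
proof -
  have y: "expand (s @ [y]) m a \<in> L (j + q)" and x: "expand (s @ [x]) m a \<in> L (j + q)" for a
    using assms xy by (intro expand_in; simp)+
  have "expand s (Suc m) a [^] (a ^ e)
      = expand (s @ [y]) m a [^] (a ^ e) \<otimes> expand (s @ [x]) m a [^] (a ^ Suc e)" for a
    using B.nat_pow_distrib[of "expand (s @ [y]) m a" "expand (s @ [x]) m a [^] a" "a ^ e"] x y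
        L_pow
      L_carrier[OF x] by (simp add: expand_Suc[OF assms] nat_pow_pow)
  then show ?thesis
    using B.finprod_multf[of "\<lambda>a. expand (s @ [y]) m a [^] (a ^ e)" "{1..q}"
        "\<lambda>a. expand (s @ [x]) m a [^] (a ^ Suc e)"] x y L_pow by (simp add: Pi_def del: power_Suc)
qed

text \<open>Choosing x in a slot raises the exponent of the weight by 1, choosing y keeps it. A term
  survives only if the exponent ends at q, and e + m <= q allows this only when every remaining slot
  takes x.\<close>

lemma expand_weighted:
  assumes "set s \<subseteq> carrier G" "length s + m = q" "0 < e" "e + m \<le> q"
  shows "finprod B (\<lambda>a. expand s m a [^] (a ^ e)) {1..q}
    = (if e + m = q then icomm v (s @ replicate m x) [^] q else \<one>)"
  using assms
proof (induction m arbitrary: s e)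
  case 0
  have c: "icomm v s \<in> L (j + q)" using 0 by (intro icomm_in_B) auto
  show ?case using 0 power_sum_mod[OF c, of e] by (simp add: expand_def finprod_pow[OF c])
next
  case (Suc m)
  have "finprod B (\<lambda>a. expand (s @ [y]) m a [^] (a ^ e)) {1..q} = \<one>"
    using Suc.IH[of "s @ [y]" e] Suc.prems xy by simp
  moreover have "finprod B (\<lambda>a. expand (s @ [x]) m a [^] (a ^ Suc e)) {1..q}
      = (if Suc e + m = q then icomm v ((s @ [x]) @ replicate m x) [^] q else \<one>)"
    using Suc.prems xy by (intro Suc.IH) auto
  moreover have "icomm v (s @ replicate (Suc m) x) \<in> carrier G"
    using L_carrier[OF icomm_in_B[of "s @ replicate (Suc m) x"]] xy Suc.prems by (simp add:
        set_replicate_conv_if)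
  ultimately show ?case using expand_weighted_Suc[OF Suc.prems(1,2), of e] by auto
qed

text \<open>The all-y term keeps exponent 0 and is counted once for each of the q residues. After
  the first x, \<open>expand_weighted\<close> applies with e = 1 and leaves a term only if no slot
  has taken y.\<close>

lemma expand_unweighted:
  assumes "set s \<subseteq> carrier G" "length s + m = q"
  shows "finprod B (\<lambda>a. expand s m a) {1..q} = icomm v (s @ replicate m y) [^] q
    \<otimes> (if m = q then icomm v (s @ replicate m x) [^] q else \<one>)"
  using assms
proof (induction m arbitrary: s)
  case 0
  have "icomm v s \<in> L (j + q)" using 0 by (intro icomm_in_B) auto
  then show ?case
    using finprod_pow[of "icomm v s" "{1..q}" "\<lambda>_. 1"] L_carrier[of "icomm v s"]
      prime_gt_1_nat[OF p] pq by (simp add: expand_def)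
next
  case (Suc m)
  have C: "icomm v (s @ replicate (Suc m) z) \<in> carrier G" if "z \<in> carrier G" for z
    using L_carrier[OF icomm_in_B[of "s @ replicate (Suc m) z"]] that Suc.prems by (simp add:
        set_replicate_conv_if)
  have s: "set (s @ [x]) \<subseteq> carrier G" "set (s @ [y]) \<subseteq> carrier G" using Suc.prems xy by auto
  have e1: "expand s (Suc m) a [^] (a ^ 0) = expand s (Suc m) a"
    "expand (s @ [y]) m a [^] (a ^ 0) = expand (s @ [y]) m a" for a
    using L_carrier[OF expand_in[of s "Suc m" a]] L_carrier[OF expand_in[of "s @ [y]" m a]]
        Suc.prems s
    by simp_all
  have "finprod B (\<lambda>a. expand s (Suc m) a) {1..q}
      = finprod B (\<lambda>a. expand (s @ [y]) m a) {1..q}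
      \<otimes> finprod B (\<lambda>a. expand (s @ [x]) m a [^] (a ^ Suc 0)) {1..q}"
    using expand_weighted_Suc[OF Suc.prems, of 0] unfolding e1 .
  also have "finprod B (\<lambda>a. expand (s @ [y]) m a) {1..q} = icomm v ((s @ [y]) @ replicate m y) [^]
      q"
    using Suc.IH[OF s(2)] Suc.prems C[OF xy(2)] by simp
  also have "finprod B (\<lambda>a. expand (s @ [x]) m a [^] (a ^ Suc 0)) {1..q}
      = (if Suc 0 + m = q then icomm v ((s @ [x]) @ replicate m x) [^] q else \<one>)"
    using Suc.prems s by (intro expand_weighted) auto
  finally show ?case by (simp flip: replicate_Suc split: if_splits)
qed

text \<open>In the product of the assumed equalities over a = 1, ..., q the all-x terms cancel,
  which leaves [v, y, ..., y]^q = 1 with q = p - 1 prime to p.\<close>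

lemma icomm_eq_one_of_constant:
  assumes const: "\<And>a. 0 < a \<Longrightarrow> a \<le> q \<Longrightarrow>
    icomm v (replicate q (x [^] a \<otimes> y)) = icomm v (replicate q x)"
  shows "icomm v (replicate q y) = \<one>"
proof -
  let ?x = "icomm v (replicate q x)" and ?y = "icomm v (replicate q y)"
  have in_L: "?x \<in> L (j + q)" "?y \<in> L (j + q)" using xy by (simp_all add: icomm_in_B
      set_replicate_conv_if)
  then have C: "?x \<in> carrier G" "?y \<in> carrier G" using L_carrier by blast+
  have "finprod B (\<lambda>a. expand [] q a) {1..q} = finprod B (\<lambda>a. ?x [^] (1::nat)) {1..q}"
    using const in_L C by (intro B.finprod_cong') (auto simp: expand_def Pi_def)
  also have "\<dots> = ?x [^] q"
    using finprod_pow[OF in_L(1), of "{1..q}" "\<lambda>_. 1"] by simp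
  finally have "?y [^] q \<otimes> ?x [^] q = ?x [^] q"
    using expand_unweighted[of "[]" "q"] by simp
  then have "?y [^] q = \<one>" using C by simp
  moreover have "?y [^] p = \<one>" using expo in_L by blast
  moreover have "coprime q p"
    by (simp add: pq coprime_Suc_right_nat)
  ultimately show ?thesis using pow_prime_eq_one_imp[OF C(2)] by blast
qed

end

end

lemma (in group) lower_central_top_filtered: "top_filtered_group G (lower_central G)"
  by (intro top_filtered_group.intro lower_central_filtered top_filtered_group_axioms.intro)
      simp_all

section \<open>Class at most p + 1 with central p-th powers: the derived subgroup has exponent
  p\<close>

context group
begin

context
  fixes p :: nat
  assumes p: "Factorial_Ring.prime p" "odd p"
    and pow_central: "\<And>x g. x \<in> carrier G \<Longrightarrow> g \<in> carrier G \<Longrightarrow> x [^] p \<otimes> g = g \<otimes> x [^] p"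
    and class_bound: "lower_central G (p + 2) = {\<one>}"
begin

interpretation top_filtered_group G "lower_central G"
  by (rule lower_central_top_filtered)

lemma p_ge_3: "3 \<le> p"
  using p prime_ge_2_nat[OF p(1)] by (cases "p = 2") auto

lemma lower_central_beyond_class: "p + 2 \<le> i \<Longrightarrow> lower_central G i = {\<one>}"
  using L_antimono[of "p + 2" i] class_bound L_one[of i] by auto

text \<open>With the filtration scaled by k, the k-th term has class less than p, and the term at 2
  lies in the (k+1)-st, of exponent p. So the elements of the k-th term killed by p form a subgroup,
  and generators suffice.\<close>

lemma lower_central_exponent_from_commutators:
  assumes k: "2 \<le> k"
    and expo: "\<And>c. c \<in> lower_central G (Suc k) \<Longrightarrow> c [^] p = \<one>"
    and gen: "\<And>u y. u \<in> lower_central G (k - 1) \<Longrightarrow> y \<in> carrier G \<Longrightarrow> commutator G u y [^] p = \<one>"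
    and c: "c \<in> lower_central G k"
  shows "c [^] p = \<one>"
proof -
  interpret scaled: filtered_group G "\<lambda>i. lower_central G (k * max i 1)"
    by (rule scaled_filtered)
  obtain i where i: "k = Suc (Suc i)" using k by (metis add_2_eq_Suc le_Suc_ex)
  have "p + 2 \<le> 2 * p" using p_ge_3 by simp
  also have "\<dots> \<le> k * p" using k by simp
  finally have Lp: "lower_central G (k * max p 1) = {\<one>}"
    using p_ge_3 lower_central_beyond_class by (simp add: max_def)
  have "c [^] p = \<one>" if "c \<in> lower_central G (k * max 2 1)" for c
  proof -
    have "Suc k \<le> k * max 2 1" using k by simp
    then show ?thesis using expo that L_antimono by blast
  qed
  then have mult: "(x \<otimes> y) [^] p = \<one>"
    if "x \<in> lower_central G k" "y \<in> lower_central G k" "x [^] p = \<one>" "y [^] p = \<one>" for x y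
    using scaled.prime_pow_mult_eq_one[OF p(1) _ Lp, of x y] that by simp
  have sub: "subgroup {c \<in> lower_central G k. c [^] p = \<one>} G"
  proof (rule subgroupI)
    show "{c \<in> lower_central G k. c [^] p = \<one>} \<noteq> {}"
      using L_one[of k] by (auto intro!: exI[of _ \<one>])
    fix x assume x: "x \<in> {c \<in> lower_central G k. c [^] p = \<one>}"
    then show "inv x \<in> {c \<in> lower_central G k. c [^] p = \<one>}"
      using L_carrier[of x k] by (simp add: nat_pow_inv L_inv)
    fix y assume "y \<in> {c \<in> lower_central G k. c [^] p = \<one>}"
    then show "x \<otimes> y \<in> {c \<in> lower_central G k. c [^] p = \<one>}" using x mult L_mult by auto
  qed (use L_carrier in auto)
  have "lower_central G k \<subseteq> {c \<in> lower_central G k. c [^] p = \<one>}"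
    unfolding i lower_central.simps(3)
    by (rule commutator_subgroup_least)
      (use sub gen i in \<open>auto simp: lower_central.simps(3) intro: commutator_subgroup_incl\<close>)
  then show ?thesis using c by blast
qed

text \<open>Downward induction on k. For u in the (k-1)-st term the sequence n -> [u^n, y] has
  degree k - 1 and is trivial at p. Its Taylor factor of order p lies in the term k - 1 + p, which
  is trivial exactly from k = 3 on by the class bound; k = 2 is left to
  \<open>engel\<close>.\<close>

lemma lower_central_3_exponent:
  assumes "3 \<le> k" "c \<in> lower_central G k"
  shows "c [^] p = \<one>"
proof (cases "k \<le> p + 2")
  case True
  have "\<forall>c\<in>lower_central G k. c [^] p = \<one>"
    using True assms(1)
  proof (induction k rule: inc_induct)
    case base
    then show ?case using class_bound by simp
  next
    case (step k)
    have expo: "\<And>c. c \<in> lower_central G (Suc k) \<Longrightarrow> c [^] p = \<one>" using step by simp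
    have gen: "commutator G u y [^] p = \<one>" if u: "u \<in> lower_central G (k - 1)" and y: "y \<in> carrier
        G" for u y
    proof -
      have C: "u \<in> carrier G" "y \<in> carrier G" using u y L_carrier by auto
      let ?f = "\<lambda>n::nat. commutator G (u [^] n) y"
      have k1: "Suc (k - 2) = k - 1" using step.prems by simp
      have "poly_seq (k - 2) (\<lambda>n. u [^] n)" by (rule poly_seq_pow) (use k1 u in simp)
      moreover have "poly_seq 1 (\<lambda>n. y)" using y L_carrier_eq by (intro poly_seq_const) simp
      ultimately have "poly_seq (k - 2 + 1) ?f" by (rule poly_seq_commutator)
      then have f: "poly_seq (k - 1) ?f" using k1 by simp
      have f0: "?f 0 = \<one>" using C by (simp add: word_simps)
      have "\<And>c. c \<in> lower_central G (k - 1 + 2) \<Longrightarrow> c [^] p = \<one>"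
        using expo step.prems by (simp add: numeral_2_eq_2)
      moreover have "lower_central G (k - 1 + p) = {\<one>}"
        using step.prems by (intro lower_central_beyond_class) simp
      ultimately have "?f p = ?f 1 [^] p" using poly_seq_at_prime[OF p(1) f f0] by blast
      moreover have "?f p = \<one>" using C pow_central by (simp add: commutator_eq_one_iff)
      ultimately show ?thesis using C by simp
    qed
    have "2 \<le> k" using step.prems by simp
    then show ?case using lower_central_exponent_from_commutators[OF _ expo gen] by blast
  qed
  then show ?thesis using assms by blast
next
  case False
  then show ?thesis using assms lower_central_beyond_class[of k] by simp
qed

lemma iterated_diff_conj_by:
  assumes "v \<in> carrier G" "x \<in> carrier G"
  shows "(diff ^^ m) (\<lambda>n. conj_by G v (x [^] n)) = (\<lambda>n. conj_by G (icomm v (replicate m x)) (x [^]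
      n))"
  using assms(1)
proof (induction m arbitrary: v)
  case (Suc m)
  have "diff (\<lambda>n. conj_by G v (x [^] n)) = (\<lambda>n. conj_by G (commutator G v x) (x [^] n))"
  proof
    fix n
    have "x [^] Suc n = x \<otimes> x [^] n" using assms(2) by (rule nat_pow_Suc2)
    then show "diff (\<lambda>n. conj_by G v (x [^] n)) n = conj_by G (commutator G v x) (x [^] n)"
      using Suc.prems assms(2) by (simp add: diff_def word_simps del: nat_pow_Suc)
  qed
  then show ?case
    using Suc.IH[of "commutator G v x"] Suc.prems assms(2)
    by (simp add: funpow_Suc_right del: funpow.simps)
qed simp

text \<open>The sequence \<open>n \<mapsto> [y, x\<^sup>n]\<close> takes the value 1 at \<open>p\<close>.\<close>

lemma commutator_pow_engel:
  assumes x: "x \<in> carrier G" and y: "y \<in> carrier G"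
  shows "commutator G y x [^] p \<otimes> icomm y (replicate p x) = \<one>"
proof -
  let ?f = "\<lambda>n::nat. commutator G y (x [^] n)"
  have "poly_seq 1 (\<lambda>n. y)" using y L_carrier_eq by (intro poly_seq_const) simp
  moreover have "poly_seq 0 (\<lambda>n. x [^] n)" using x by (intro poly_seq_pow) simp
  ultimately have "poly_seq (1 + 0) ?f" by (rule poly_seq_commutator)
  then have f: "poly_seq 1 ?f" by simp
  have f0: "?f 0 = \<one>" using y by (simp add: word_simps)
  have expo: "\<And>c. c \<in> lower_central G (1 + 2) \<Longrightarrow> c [^] p = \<one>"
    by (rule lower_central_3_exponent[of "1 + 2"]) simp_all
  \<comment> \<open>Degree 1 is one short of what \<open>poly_seq_at_prime\<close> asks for, so the
    p-th difference stays in the formula.\<close>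
  have "lower_central G (Suc (1 + p)) = {\<one>}" using class_bound by simp
  then have "?f p = ?f 1 [^] p \<otimes> (diff ^^ p) ?f 0"
    using poly_seq_at_prime'[OF p(1) f f0 expo] by simp
  moreover have "?f p = \<one>"
    using x y pow_central[OF x y] by (simp add: commutator_eq_one_iff)
  moreover have "(diff ^^ p) ?f 0 = icomm y (replicate p x)"
  proof -
    obtain q where q: "p = Suc q" using p_ge_3 by (cases p) auto
    \<comment> \<open>The first difference is the conjugate of [y, x] by x^n, and every further
      difference appends one more x to the commutator.\<close>
    have "diff ?f = (\<lambda>n. conj_by G (commutator G y x) (x [^] n))"
    proof
      fix n
      have "x [^] Suc n = x \<otimes> x [^] n" using x by (rule nat_pow_Suc2)
      then show "diff ?f n = conj_by G (commutator G y x) (x [^] n)"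
        using x y by (simp add: diff_def word_simps del: nat_pow_Suc)
    qed
    moreover have "icomm (commutator G y x) (replicate q x) \<in> carrier G"
      using L_carrier[OF icomm_in[of "commutator G y x" 0 "replicate q x"]] x y
      by (simp add: set_replicate_conv_if split: if_splits)
    ultimately show ?thesis
      using iterated_diff_conj_by[of "commutator G y x" x q] x y
      by (simp add: q funpow_Suc_right conj_by_def del: funpow.simps)
  qed
  ultimately show ?thesis using x by simp
qed

lemma icomm_replicate_pow:
  assumes "v \<in> lower_central G j" "0 < j" "x \<in> carrier G" "lower_central G (Suc (j + m)) = {\<one>}"
  shows "icomm v (replicate m (x [^] (a::nat))) = icomm v (replicate m x) [^] (a ^ m)"
  using assms
proof (induction m arbitrary: v j)
  case 0
  then show ?case using L_carrier by simp
next
  case (Suc m)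
  have r: "set (replicate m (x [^] a)) \<subseteq> carrier G" using Suc.prems by auto
  have top: "lower_central G (Suc (Suc (j + length (replicate m (x [^] a))))) = {\<one>}"
    "lower_central G (Suc (Suc j + m)) = {\<one>}" using Suc.prems by simp_all
  have vx: "commutator G v x \<in> lower_central G (Suc j)"
    using L_commutator_carrier Suc.prems by blast
  have C: "icomm (commutator G v x) (replicate m x) \<in> carrier G"
    using L_carrier[OF icomm_in[OF vx, of "replicate m x"]] Suc.prems by (simp add:
        set_replicate_conv_if)
  have "icomm v (replicate (Suc m) (x [^] a)) = icomm v (x # replicate m (x [^] a)) [^] a"
    using icomm_slot_pow[OF Suc.prems(1-3) r top(1)] by simp
  also have "\<dots> = (icomm (commutator G v x) (replicate m x) [^] (a ^ m)) [^] a"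
    using Suc.IH[OF vx _ Suc.prems(3) top(2)] by simp
  finally show ?case using C by (simp add: nat_pow_pow mult.commute)
qed

text \<open>The relation \<open>commutator_pow_engel\<close> is applied to x^a y and to x^a in place
  of x. The p-th powers in it agree, since [y, x^a y] is a conjugate of [y, x^a]; comparing what is
  left and using a^p = a modulo p shows that [v, x^a y, ..., x^a y], with v = [y, x], is independent
  of a. This is the premise of \<open>icomm_eq_one_of_constant\<close>.\<close>

lemma engel:
  assumes x: "x \<in> carrier G" and y: "y \<in> carrier G"
  shows "icomm x (replicate p y) = \<one>"
proof -
  obtain q where q: "p = Suc q" using p_ge_3 by (cases p) auto
  let ?v = "commutator G y x"
  have v: "?v \<in> lower_central G 2"
    using L_commutator_carrier[of y 1 x] x y L_carrier_eq by (simp add: numeral_2_eq_2)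
  have top: "lower_central G (Suc (2 + q)) = {\<one>}" using class_bound q by (simp add: numeral_2_eq_2)
  have expo: "c [^] p = \<one>" if "c \<in> lower_central G (2 + q)" for c
    using lower_central_3_exponent[OF _ that] p_ge_3 q by simp
  have y1: "y \<in> lower_central G 1" using y L_carrier_eq by simp
  have tail_in: "icomm ?v (replicate q g) \<in> lower_central G (2 + q)" if "g \<in> carrier G" for g
    using icomm_in[OF v, of "replicate q g"] that by (simp add: set_replicate_conv_if)
  have const: "icomm ?v (replicate q (x [^] a \<otimes> y)) = icomm ?v (replicate q x)" if a: "0 < a" "a \<le>
      q" for a
  proof -
    let ?g = "x [^] a \<otimes> y" and ?w = "commutator G y (x [^] a)"
    let ?s = "icomm ?v (replicate q ?g)" and ?t = "icomm ?v (replicate q x)"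
    have g: "?g \<in> carrier G" "set (replicate q ?g) \<subseteq> carrier G" using x y by auto
    have st: "?s \<in> lower_central G (2 + q)" "?t \<in> lower_central G (2 + q)"
      using tail_in x g by auto
    then have stC: "?s \<in> carrier G" "?t \<in> carrier G" using L_carrier by blast+
    have top': "lower_central G (Suc (Suc (1 + length (replicate q ?g)))) = {\<one>}"
      using top by simp
    have yy: "commutator G y y = \<one>" using y by (simp add: word_simps)
    \<comment> \<open>Only the first slot is split: its y-part begins with [y, y] = 1, and its
      x-part gives the exponent a, while the other q slots keep x^a y.\<close>
    have "icomm y (?g # replicate q ?g)
        = icomm y (y # replicate q ?g) \<otimes> icomm y ((x [^] a) # replicate q ?g)"
      using x y by (intro icomm_slot_mult[OF y1 _ _ y g(2) top']) auto
    also have "icomm y ((x [^] a) # replicate q ?g) = ?s [^] a"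
      using icomm_slot_pow[OF y1 _ x g(2) top'] by simp
    also have "icomm y (y # replicate q ?g) = \<one>" using icomm_one[OF g(2)] yy by simp
    finally have E1: "icomm y (replicate p ?g) = ?s [^] a" using stC q by simp
    have top'': "lower_central G (Suc (1 + p)) = {\<one>}" using class_bound by simp
    have E2: "icomm y (replicate p (x [^] a)) = ?t [^] (a ^ p)"
      using icomm_replicate_pow[OF y1 _ x top''] q by simp
    have wC: "?w \<in> carrier G" using x y by simp
    have ta: "?t [^] (a ^ p) \<in> lower_central G (Suc p)" using L_pow[OF st(2)] q by simp
    \<comment> \<open>This puts [y, x^a]^p into the last term of the series, on which conjugation by
      y is trivial.\<close>
    have "?w [^] p = inv (?t [^] (a ^ p))"
      using commutator_pow_engel[of "x [^] a" y] x y stC unfolding E2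
      by (simp add: inv_equality[symmetric])
    then have wp: "?w [^] p \<in> lower_central G (Suc p)" using ta L_inv by simp
    have "commutator G y ?g = conj_by G ?w y" using x y by (simp add: word_simps)
    then have "commutator G y ?g [^] p = conj_by G (?w [^] p) y"
      using wC y by (simp add: conj_by_pow)
    also have "\<dots> = ?w [^] p"
    proof -
      have "commutator G (?w [^] p) y = \<one>"
        using L_commutator_carrier[OF wp y] class_bound by simp
      then show ?thesis
        using wC y mult_commutator_eq_conj_by[of "?w [^] p" y] by simp
    qed
    finally have "?w [^] p \<otimes> ?s [^] a = \<one>" using commutator_pow_engel[OF g(1) y] E1 by simp
    moreover have "?w [^] p \<otimes> ?t [^] (a ^ p) = \<one>"
      using commutator_pow_engel[of "x [^] a" y] x y unfolding E2 by simp
    ultimately have "?s [^] a = ?t [^] (a ^ p)"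
      using wC stC by (metis l_cancel nat_pow_closed)
    also have "\<dots> = ?t [^] a"
      using pow_eq_of_dvd_diff[OF stC(2) expo[OF st(2)]] prime_dvd_power_diff[OF p(1), of a] by simp
    finally have eq: "?s [^] a = ?t [^] a" .
    have comm: "?s \<otimes> inv ?t = inv ?t \<otimes> ?s"
    proof -
      have "commutator G ?s (inv ?t) = \<one>"
        using L_commutator_carrier[OF st(1), of "inv ?t"] stC top by simp
      then show ?thesis using stC by (simp add: commutator_eq_one_iff)
    qed
    have "(?s \<otimes> inv ?t) [^] a = \<one>"
      using pow_mult_distrib[OF comm, of a] eq stC by (simp add: nat_pow_inv)
    moreover have "(?s \<otimes> inv ?t) [^] p = \<one>" by (intro expo L_mult L_inv st)
    moreover have "coprime a p"
      using a q p(1) by (metis coprime_commute less_Suc_eq_le nat_dvd_not_less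
          prime_imp_coprime_nat)
    ultimately have "?s \<otimes> inv ?t = \<one>" using stC pow_prime_eq_one_imp[of "?s \<otimes> inv ?t" p a] by simp
    then show ?thesis using stC by (metis inv_equality inv_inv inv_closed)
  qed
  have "icomm ?v (replicate q y) = \<one>"
    by (rule icomm_eq_one_of_constant[OF p(1) q v _ x y top expo const]) simp_all
  moreover have "icomm (inv ?v) (replicate q y) = inv (icomm ?v (replicate q y))"
    using top y by (intro icomm_inv[OF v]) (auto simp: set_replicate_conv_if)
  ultimately show ?thesis using x y q commutator_swap[of y x] by simp
qed

lemma derived_exponent:
  assumes "c \<in> lower_central G 2"
  shows "c [^] p = \<one>"
proof (rule lower_central_exponent_from_commutators[OF _ _ _ assms])
  fix c assume "c \<in> lower_central G (Suc 2)"
  then show "c [^] p = \<one>" by (intro lower_central_3_exponent) simp_all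
next
  fix u y assume "u \<in> lower_central G (2 - 1)" and y: "y \<in> carrier G"
  then have u: "u \<in> carrier G" using L_carrier by blast
  show "commutator G u y [^] p = \<one>"
    using commutator_pow_engel[OF y u] engel[OF u y] u y by simp
qed simp

end

end

section \<open>Central extensions\<close>

lemma group_exponent_pow:
  assumes "group_exponent G \<noteq> 0" "x \<in> carrier G"
  shows "x [^]\<^bsub>G\<^esub> group_exponent G = \<one>\<^bsub>G\<^esub>"
proof -
  let ?P = "\<lambda>m::nat. m > 0 \<and> (\<forall>x\<in>carrier G. x [^]\<^bsub>G\<^esub> m = \<one>\<^bsub>G\<^esub>)"
  have ex: "\<exists>m. ?P m" using assms(1) by (auto simp: group_exponent_def split: if_splits)
  then have "group_exponent G = (LEAST m. ?P m)" by (simp add: group_exponent_def)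
  then show ?thesis using LeastI_ex[OF ex] assms(2) by simp
qed

lemma (in group) group_exponent_dvd:
  assumes m: "0 < m" "\<And>x. x \<in> carrier G \<Longrightarrow> x [^] (m::nat) = \<one>"
  shows "group_exponent G dvd m"
proof -
  let ?P = "\<lambda>m::nat. m > 0 \<and> (\<forall>x\<in>carrier G. x [^] m = \<one>)" and ?e = "group_exponent G"
  have ex: "\<exists>m. ?P m" using m by blast
  then have e: "?e = (LEAST m. ?P m)" by (simp add: group_exponent_def)
  have Pe: "?P ?e" unfolding e by (rule LeastI_ex[OF ex])
  have "x [^] (m mod ?e) = \<one>" if x: "x \<in> carrier G" for x
  proof -
    have "\<one> = x [^] (?e * (m div ?e) + m mod ?e)" using m x by simp
    also have "\<dots> = (x [^] ?e) [^] (m div ?e) \<otimes> x [^] (m mod ?e)"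
      using x by (simp only: nat_pow_mult nat_pow_pow)
    finally show ?thesis using Pe x by simp
  qed
  moreover have "m mod ?e < ?e" using Pe by simp
  ultimately have "m mod ?e = 0" unfolding e using not_less_Least[of "m mod ?e" ?P] e by auto
  then show ?thesis by (simp add: dvd_eq_mod_eq_0)
qed

lemma (in group) pth_powers_carrier: "pth_powers p (carrier G) = power_subgroup G p"
  by (simp add: pth_powers_def power_subgroup_def)

lemma (in group) commutator_consistent:
  assumes "subgroup N G" "x \<in> N" "y \<in> N"
  shows "commutator (G\<lparr>carrier := N\<rparr>) x y = commutator G x y"
  using assms by (simp add: commutator_def conj_by_def)

lemma (in group) powerful_subgroup_iff:
  assumes N: "subgroup N G"
  shows "powerful p (G\<lparr>carrier := N\<rparr>) \<longleftrightarrow> commutator_subgroup G N N \<subseteq> pth_powers p N"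
proof -
  have "{commutator (G\<lparr>carrier := N\<rparr>) h k |h k. h \<in> N \<and> k \<in> N} = {commutator G h k |h k. h \<in> N \<and> k
      \<in> N}"
    using commutator_consistent[OF N] by metis
  moreover have "{commutator G h k |h k. h \<in> N \<and> k \<in> N} \<subseteq> N"
    using N by (auto simp: commutator_def conj_by_def subgroup.m_closed subgroup.m_inv_closed)
  moreover have "(\<lambda>g. g [^]\<^bsub>G\<lparr>carrier := N\<rparr>\<^esub> p) ` N = (\<lambda>g. g [^] p) ` N"
    by (simp flip: nat_pow_consistent)
  moreover have "(\<lambda>g. g [^] p) ` N \<subseteq> N"
  proof
    fix x assume "x \<in> (\<lambda>g. g [^] p) ` N"
    then obtain g where g: "x = g [^] p" "g \<in> N" by blast
    then show "x \<in> N"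
      using N by (induction p arbitrary: x) (auto simp: subgroup.one_closed subgroup.m_closed)
  qed
  ultimately show ?thesis
    using generate_consistent[OF _ N]
    by (simp add: powerful_def commutator_subgroup_def power_subgroup_def pth_powers_def)
qed

section \<open>The derived subgroup of a central extension\<close>

context group_hom
begin

lemma commutator_subgroup_img:
  assumes "A \<subseteq> carrier G" "B \<subseteq> carrier G"
  shows "h ` commutator_subgroup G A B = commutator_subgroup H (h ` A) (h ` B)"
proof -
  have AB: "a \<in> carrier G" "b \<in> carrier G" if "a \<in> A" "b \<in> B" for a b using that assms by auto
  have "h ` {commutator G a b |a b. a \<in> A \<and> b \<in> B} = {commutator H a b |a b. a \<in> h ` A \<and> b \<in> h ` B}"
    (is "?l = ?r")
  proof
    show "?l \<subseteq> ?r" using AB hom_commutator by blast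
    show "?r \<subseteq> ?l"
    proof
      fix c assume "c \<in> ?r"
      then obtain a b where "c = commutator H (h a) (h b)" "a \<in> A" "b \<in> B" by blast
      then have "c = h (commutator G a b)" using AB by (simp add: hom_commutator)
      then show "c \<in> ?l" using \<open>a \<in> A\<close> \<open>b \<in> B\<close> by blast
    qed
  qed
  moreover have "{commutator G a b |a b. a \<in> A \<and> b \<in> B} \<subseteq> carrier G"
    using AB by (auto intro!: G.commutator_closed)
  ultimately show ?thesis
    using generate_img[of "{commutator G a b |a b. a \<in> A \<and> b \<in> B}"]
    by (simp add: commutator_subgroup_def)
qed

lemma lower_central_img:
  assumes "h ` carrier G = carrier H"
  shows "h ` lower_central G i = lower_central H i"
proof (induction i)
  case (Suc i)
  show ?case
  proof (cases i)
    case (Suc j)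
    then show ?thesis
      using Suc.IH assms commutator_subgroup_img[of "lower_central G (Suc j)" "carrier G"]
        G.normal_subset[OF G.lower_central_normal]
      by (simp add: lower_central.simps(3))
  qed (use assms in simp)
qed (use assms in simp)

lemma preimage_normal:
  assumes "N \<lhd> H"
  shows "{x \<in> carrier G. h x \<in> N} \<lhd> G"
proof (rule G.normal_conjI)
  note N = normal_imp_subgroup[OF assms]
  show "subgroup {x \<in> carrier G. h x \<in> N} G"
  proof (rule G.subgroupI)
    show "{x \<in> carrier G. h x \<in> N} \<noteq> {}"
      using subgroup.one_closed[OF N] by (auto intro!: exI[of _ \<one>])
  qed (auto simp: subgroup.m_inv_closed[OF N] subgroup.m_closed[OF N])
  fix x y assume "x \<in> {x \<in> carrier G. h x \<in> N}" "y \<in> carrier G"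
  then show "conj_by G x y \<in> {x \<in> carrier G. h x \<in> N}"
    using H.normal_conj_by[OF assms, of "h x" "h y"] by (auto simp: conj_by_def)
qed

text \<open>With \<open>M i\<close> the preimage of the \<open>i\<close>-th iterated power subgroup of \<open>H\<^sup>p\<close>, \<open>p\<close>-th powers map
  \<open>[M i, G]\<close> into \<open>[M (i + 1), G]\<close>, and \<open>G / [M 0, G]\<close> has class at most \<open>p + 1\<close> with central
  \<open>p\<close>-th powers.\<close>

theorem central_extension_derived_exponent:
  fixes p n :: nat
  assumes surj: "h ` carrier G = carrier H"
    and central: "\<And>z g. z \<in> carrier G \<Longrightarrow> h z = \<one>\<^bsub>H\<^esub> \<Longrightarrow> g \<in> carrier G \<Longrightarrow> z \<otimes> g = g \<otimes> z"
    and p: "Factorial_Ring.prime p" "odd p"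
    and fin: "finite (carrier H)" and ord: "order H = p ^ k"
    and expH: "group_exponent H = p ^ n"
    and powerful: "powerful p (H\<lparr>carrier := power_subgroup H p\<rparr>)"
    and expN: "group_exponent (H\<lparr>carrier := power_subgroup H p\<rparr>) = p ^ (n - 1)"
    and lc: "lower_central H (p + 1) \<subseteq> power_subgroup H p"
    and c: "c \<in> commutator_subgroup G (carrier G) (carrier G)"
  shows "c [^] (p ^ n) = \<one>"
proof -
  define N where "N = power_subgroup H p"
  have N: "N \<lhd> H"
    using H.pth_powers_normal[OF H.carrier_normal] by (simp add: N_def H.pth_powers_carrier)
  have N_powerful: "commutator_subgroup H N N \<subseteq> H.pth_powers p N"
    using powerful H.powerful_subgroup_iff[OF normal_imp_subgroup[OF N]] by (simp add: N_def)
  have N_exp: "x [^]\<^bsub>H\<^esub> (p ^ (n - 1)) = \<one>\<^bsub>H\<^esub>" if "x \<in> N" for x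
    using group_exponent_pow[of "H\<lparr>carrier := N\<rparr>" x] that prime_gt_0_nat[OF p(1)] expN
    by (simp add: N_def flip: nat_pow_consistent)
  let ?N = "\<lambda>i. (H.pth_powers p ^^ i) N"
  have Nn: "?N i \<lhd> H" for i by (rule H.iterated_pth_powers_normal[OF N])
  have N_last: "?N (n - 1) \<subseteq> {\<one>\<^bsub>H\<^esub>}"
  proof -
    have "?N (n - 1) \<subseteq> H.pth_powers (p ^ (n - 1)) N"
      by (rule H.powerful_iterated_pth_powers[OF p fin ord N N_powerful])
    also have "\<dots> \<subseteq> {\<one>\<^bsub>H\<^esub>}"
      using N_exp by (intro H.pth_powers_least H.triv_subgroup) simp
    finally show ?thesis .
  qed
  define M where "M = (\<lambda>i. {x \<in> carrier G. h x \<in> ?N i})"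
  have M: "M i \<lhd> G" for i unfolding M_def by (rule preimage_normal[OF Nn])
  define C where "C = (\<lambda>i. commutator_subgroup G (M i) (carrier G))"
  have C: "C i \<lhd> G" for i
    unfolding C_def by (rule G.commutator_subgroup_normal[OF M G.carrier_normal])
  have MM: "commutator G x y \<in> M (Suc i)" if "x \<in> M i" "y \<in> M i" for x y i
  proof -
    have xy: "x \<in> carrier G" "y \<in> carrier G" "h x \<in> ?N i" "h y \<in> ?N i" using that by (auto simp:
        M_def)
    then have "h y \<in> N" using H.iterated_pth_powers_subset[OF N] by blast
    then have "commutator H (h x) (h y) \<in> ?N (Suc i)"
      using H.powerful_commutator_iterated_pth_powers[OF p fin ord N N_powerful, of i]
        H.commutator_subgroup_incl[OF xy(3)] by blast
    then show ?thesis using xy by (simp add: M_def hom_commutator)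
  qed
  have Mp: "x [^] p \<in> M (Suc i)" if "x \<in> M i" for x i
    using that H.pth_powers_incl[of "h x" "?N i" p] by (auto simp: M_def hom_nat_pow)
  have step: "d [^] p \<in> C (Suc i)" if "d \<in> C i" for d i
    using G.commutator_subgroup_pow_in[OF M M p(2) MM Mp] that unfolding C_def by blast
  have iter: "d [^] (p ^ i) \<in> C i" if d: "d \<in> C 0" for d i
  proof (induction i)
    case 0
    have "d \<in> carrier G" using d G.normal_subset[OF C] by auto
    then show ?case using d by simp
  next
    case (Suc i)
    have "d \<in> carrier G" using d G.normal_subset[OF C] by auto
    then show ?case using step[OF Suc] by (simp add: G.nat_pow_pow mult.commute)
  qed
  \<comment> \<open>\<open>M (n - 1)\<close> lies over the trivial group, hence in the central
    kernel of h.\<close>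
  have "C (n - 1) \<subseteq> {\<one>}"
    unfolding C_def
  proof (rule G.commutator_subgroup_least[OF G.triv_subgroup])
    fix x g assume "x \<in> M (n - 1)" and g: "g \<in> carrier G"
    then have "x \<in> carrier G" "h x = \<one>\<^bsub>H\<^esub>" using N_last by (auto simp: M_def)
    then show "commutator G x g \<in> {\<one>}" using central g by (simp add: G.commutator_eq_one_iff)
  qed
  then have C0: "d [^] (p ^ (n - 1)) = \<one>" if "d \<in> C 0" for d using iter[OF that] by blast
  have cC: "c \<in> carrier G"
    using c G.normal_subset[OF G.commutator_subgroup_normal[OF G.carrier_normal G.carrier_normal]]
        by blast
  interpret R: normal "C 0" G by (rule C)
  interpret q: group_hom G "G Mod C 0" "\<lambda>x. C 0 #> x" by (rule R.quotient_hom)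
  note [simp del] = mult_FactGroup one_FactGroup
  have q_surj: "(\<lambda>x. C 0 #> x) ` carrier G = carrier (G Mod C 0)" by (simp add: R.quotient_surj)
  have "c [^] p \<in> C 0"
  proof -
    have "x [^]\<^bsub>G Mod C 0\<^esub> p \<otimes>\<^bsub>G Mod C 0\<^esub> g = g \<otimes>\<^bsub>G Mod C 0\<^esub> x [^]\<^bsub>G Mod C 0\<^esub> p"
      if xg: "x \<in> carrier (G Mod C 0)" "g \<in> carrier (G Mod C 0)" for x g
    proof -
      obtain y k where yk: "y \<in> carrier G" "x = C 0 #> y" "k \<in> carrier G" "g = C 0 #> k"
        using xg by (auto simp: R.quotient_surj)
      have "h y [^]\<^bsub>H\<^esub> p \<in> N"
        using yk(1) H.pth_powers_incl[of "h y" "carrier H" p] by (simp add: N_def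
            H.pth_powers_carrier)
      then have "y [^] p \<in> M 0" using yk(1) by (simp add: M_def hom_nat_pow)
      then have "commutator G (y [^] p) k \<in> C 0"
        unfolding C_def using yk(3) by (rule G.commutator_subgroup_incl)
      then have "commutator (G Mod C 0) (C 0 #> (y [^] p)) g = \<one>\<^bsub>G Mod C 0\<^esub>"
        using yk R.quotient_eq_one_iff[of "commutator G (y [^] p) k"] by (simp add:
            q.hom_commutator)
      then show ?thesis
        using yk q.H.commutator_eq_one_iff[of "C 0 #> (y [^] p)" g] by (simp add: q.hom_nat_pow)
    qed
    moreover have "lower_central (G Mod C 0) (p + 2) = {\<one>\<^bsub>G Mod C 0\<^esub>}"
    proof -
      \<comment> \<open>The hypothesis \<open>lc\<close> enters here; one further commutator then
        lands in \<open>C 0\<close>, whence class at most p + 1 for the quotient.\<close>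
      have "lower_central G (p + 1) \<subseteq> M 0"
      proof
        fix x assume x: "x \<in> lower_central G (p + 1)"
        then have "h x \<in> lower_central H (p + 1)" using lower_central_img[OF surj, of "p + 1"] by
            blast
        then have "h x \<in> N" using lc by (auto simp: N_def)
        then show "x \<in> M 0" using x G.normal_subset[OF G.lower_central_normal] by (auto simp: M_def)
      qed
      then have "commutator_subgroup G (lower_central G (p + 1)) (carrier G) \<subseteq> C 0"
        using G.commutator_subgroup_incl[of _ "M 0" _ "carrier G"] unfolding C_def
        by (intro G.commutator_subgroup_least normal_imp_subgroup[OF C[unfolded C_def]]) blast
      then have "lower_central G (p + 2) \<subseteq> C 0" by (simp add: lower_central.simps(3))
      then have "(\<lambda>x. C 0 #> x) ` lower_central G (p + 2) \<subseteq> {\<one>\<^bsub>G Mod C 0\<^esub>}"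
        using R.quotient_eq_one_iff R.mem_carrier by blast
      then show ?thesis
        using q.lower_central_img[OF q_surj, of "p + 2"]
          subgroup.one_closed[OF normal_imp_subgroup[OF q.H.lower_central_normal]] by blast
    qed
    moreover have "c \<in> lower_central G 2"
      using c by (simp add: numeral_2_eq_2 lower_central.simps(3))
    then have "C 0 #> c \<in> lower_central (G Mod C 0) 2" using q.lower_central_img[OF q_surj, of 2]
        by blast
    ultimately have "(C 0 #> c) [^]\<^bsub>G Mod C 0\<^esub> p = \<one>\<^bsub>G Mod C 0\<^esub>"
      by (intro q.H.derived_exponent[OF p])
    then show ?thesis using cC R.quotient_eq_one_iff[of "c [^] p"] by (simp add: q.hom_nat_pow)
  qed
  then have cp: "(c [^] p) [^] (p ^ (n - 1)) = \<one>" by (rule C0)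
  show ?thesis
  \<comment> \<open>For n = 0 the truncated n - 1 makes p times p^(n-1) larger than p^n; but then H
    is trivial and G coincides with the central kernel.\<close>
  proof (cases n)
    case 0
    have triv: "h x = \<one>\<^bsub>H\<^esub>" if "x \<in> carrier G" for x
      using group_exponent_pow[of H "h x"] expH 0 that by simp
    have "commutator_subgroup G (carrier G) (carrier G) \<subseteq> {\<one>}"
      using central[OF _ triv]
      by (intro G.commutator_subgroup_least G.triv_subgroup) (simp add: G.commutator_eq_one_iff)
    then show ?thesis using c by auto
  next
    case (Suc m)
    then show ?thesis using cp cC by (simp add: G.nat_pow_pow)
  qed
qed

end

section \<open>Exterior pairings\<close>

context group
begin

lemma int_antihom_trivial:
  fixes f :: "int \<Rightarrow> 'a"
  assumes "\<And>i. f i \<in> carrier G" "\<And>i j. f (i + j) = f j \<otimes> f i" "f 1 = \<one>"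
  shows "f i = \<one>"
proof (induction i rule: int_induct[where k = 0])
  case base
  then show ?case using assms(1)[of 0] assms(2)[of 0 0] by simp
next
  case (step1 i)
  then show ?case using assms(2)[of i 1] assms(3) by simp
next
  case (step2 i)
  then show ?case using assms(2)[of "i - 1" 1] assms(1)[of "i - 1"] assms(3) by simp
qed

lemma conj_by_int_pow:
  assumes "x \<in> carrier G"
  shows "conj_by G (x [^] (i::int)) (x [^] (j::int)) = x [^] i"
proof -
  have "x [^] i \<otimes> x [^] j = x [^] j \<otimes> x [^] i"
    using assms by (simp add: add.commute flip: int_pow_mult)
  then show ?thesis using assms by (simp add: conj_by_def m_assoc)
qed

end

text \<open>These are the defining relations of the exterior square with an arbitrary target group,
  so that the arguments below use relations only and no words.\<close>

locale exterior_pairing = G: group G + E: group E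
  for G :: "('a, 'm) monoid_scheme" (structure) and E :: "('e, 'n) monoid_scheme" +
  fixes w :: "'a \<Rightarrow> 'a \<Rightarrow> 'e"
  assumes w_closed [simp]: "g \<in> carrier G \<Longrightarrow> h \<in> carrier G \<Longrightarrow> w g h \<in> carrier E"
    and w_mult_left: "\<lbrakk>g \<in> carrier G; h \<in> carrier G; k \<in> carrier G\<rbrakk> \<Longrightarrow>
      w (g \<otimes> h) k = w (conj_by G g h) (conj_by G k h) \<otimes>\<^bsub>E\<^esub> w h k"
    and w_mult_right: "\<lbrakk>g \<in> carrier G; h \<in> carrier G; k \<in> carrier G\<rbrakk> \<Longrightarrow>
      w g (h \<otimes> k) = w g k \<otimes>\<^bsub>E\<^esub> w (conj_by G g k) (conj_by G h k)"
    and w_self: "g \<in> carrier G \<Longrightarrow> w g g = \<one>\<^bsub>E\<^esub>"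
begin

lemma w_one_left: "k \<in> carrier G \<Longrightarrow> w \<one> k = \<one>\<^bsub>E\<^esub>"
  using w_mult_left[of \<one> \<one> k] by (simp add: conj_by_def)

lemma w_one_right: "k \<in> carrier G \<Longrightarrow> w k \<one> = \<one>\<^bsub>E\<^esub>"
  using w_mult_right[of k \<one> \<one>] by (simp add: conj_by_def)

text \<open>Expand 1 = w (h a) (h a), writing h a also as (h a h^-1) h.\<close>

lemma w_skew:
  assumes a: "a \<in> carrier G" and h: "h \<in> carrier G"
  shows "w a h \<otimes>\<^bsub>E\<^esub> w h a = \<one>\<^bsub>E\<^esub>"
proof -
  let ?g = "h \<otimes> a \<otimes> inv h"
  have g: "?g \<in> carrier G" "?g \<otimes> h = h \<otimes> a" "conj_by G ?g h = a" "conj_by G (h \<otimes> a) h = a \<otimes> h"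
    "conj_by G a a = a" "conj_by G h h = h"
    using a h by (simp_all add: conj_by_def G.m_assoc)
  have "\<one>\<^bsub>E\<^esub> = w (?g \<otimes> h) (h \<otimes> a)" using a h by (simp add: g(2) w_self)
  also have "\<dots> = w a (a \<otimes> h) \<otimes>\<^bsub>E\<^esub> w h (h \<otimes> a)"
    using w_mult_left[OF g(1) h, of "h \<otimes> a"] a h by (simp only: g G.m_closed)
  also have "w a (a \<otimes> h) = w a h"
    using w_mult_right[of a a h] w_self[of "conj_by G a h"] a h by simp
  also have "w h (h \<otimes> a) = w h (?g \<otimes> h)" by (simp only: g(2))
  also have "\<dots> = w h a"
    using w_mult_right[OF h g(1) h] w_self[OF h] a h by (simp only: g) simp
  finally show ?thesis by simp
qed

text \<open>Expand \<open>w (g k) (h l)\<close> in two ways.\<close>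

lemma w_interchange:
  assumes C: "g \<in> carrier G" "h \<in> carrier G" "k \<in> carrier G" "l \<in> carrier G"
  shows "w (conj_by G g (l \<otimes> k)) (conj_by G h (l \<otimes> k)) \<otimes>\<^bsub>E\<^esub> w k l
    = w k l \<otimes>\<^bsub>E\<^esub> w (conj_by G g (k \<otimes> l)) (conj_by G h (k \<otimes> l))"
    (is "?A \<otimes>\<^bsub>E\<^esub> _ = _ \<otimes>\<^bsub>E\<^esub> ?B")
proof -
  let ?c = "w (conj_by G g k) (conj_by G l k)" and ?d = "w (conj_by G k l) (conj_by G h l)"
  have cj: "conj_by G (a \<otimes> b) c = conj_by G a c \<otimes> conj_by G b c"
    if "a \<in> carrier G" "b \<in> carrier G" "c \<in> carrier G" for a b c
    using that by (simp add: conj_by_def G.m_assoc)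
  have cc: "conj_by G (conj_by G a k) (conj_by G l k) = conj_by G a (l \<otimes> k)"
    "conj_by G (conj_by G a l) (conj_by G k l) = conj_by G a (k \<otimes> l)" if "a \<in> carrier G" for a
    using that C by (simp_all add: G.word_simps)
  have C': "?A \<in> carrier E" "?B \<in> carrier E" "?c \<in> carrier E" "?d \<in> carrier E" "w k l \<in> carrier E"
    using C by simp_all
  have "w (g \<otimes> k) (h \<otimes> l) = (?c \<otimes>\<^bsub>E\<^esub> ?A) \<otimes>\<^bsub>E\<^esub> (w k l \<otimes>\<^bsub>E\<^esub> ?d)"
    using w_mult_left[of g k "h \<otimes> l"] w_mult_right[of "conj_by G g k" "conj_by G h k" "conj_by G l
        k"]
      w_mult_right[of k h l] C by (simp add: cj cc)
  moreover have "w (g \<otimes> k) (h \<otimes> l) = (?c \<otimes>\<^bsub>E\<^esub> w k l) \<otimes>\<^bsub>E\<^esub> (?B \<otimes>\<^bsub>E\<^esub> ?d)"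
    using w_mult_right[of "g \<otimes> k" h l] w_mult_left[of g k l]
      w_mult_left[of "conj_by G g l" "conj_by G k l" "conj_by G h l"] C by (simp add: cj cc)
  ultimately have "?c \<otimes>\<^bsub>E\<^esub> (?A \<otimes>\<^bsub>E\<^esub> w k l \<otimes>\<^bsub>E\<^esub> ?d) = ?c \<otimes>\<^bsub>E\<^esub> (w k l \<otimes>\<^bsub>E\<^esub> ?B \<otimes>\<^bsub>E\<^esub> ?d)"
    using C' by (simp add: E.m_assoc)
  then show ?thesis using C' by (simp add: E.m_closed)
qed

text \<open>Putting conjugates by (l k)^-1 into \<open>w_interchange\<close> turns the conjugators
  into 1 and (l k)^-1 (k l) = [k, l]. Thus w k l acts on pairing values as [k, l], as in a crossed
  module.\<close>

lemma w_conj_by_w: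
  assumes C: "g \<in> carrier G" "h \<in> carrier G" "k \<in> carrier G" "l \<in> carrier G"
  shows "w g h \<otimes>\<^bsub>E\<^esub> w k l
    = w k l \<otimes>\<^bsub>E\<^esub> w (conj_by G g (commutator G k l)) (conj_by G h (commutator G k l))"
proof -
  have "conj_by G (conj_by G a (inv (l \<otimes> k))) (l \<otimes> k) = a"
    "conj_by G (conj_by G a (inv (l \<otimes> k))) (k \<otimes> l) = conj_by G a (commutator G k l)"
    if "a \<in> carrier G" for a
    using that C by (simp_all add: G.word_simps)
  then show ?thesis
    using w_interchange[of "conj_by G g (inv (l \<otimes> k))" "conj_by G h (inv (l \<otimes> k))" k l] C by simp
qed

lemma w_inv_left:
  assumes "g \<in> carrier G" "x \<in> carrier G"
  shows "w (inv g) x = inv\<^bsub>E\<^esub> (w g (conj_by G x (inv g)))"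
proof -
  have "conj_by G g (inv g) = g" using assms by (simp add: conj_by_def G.m_assoc)
  then have "w g (conj_by G x (inv g)) \<otimes>\<^bsub>E\<^esub> w (inv g) x = \<one>\<^bsub>E\<^esub>"
    using w_mult_left[of g "inv g" x] w_one_left assms by simp
  then show ?thesis using assms by (metis E.inv_equality E.inv_inv G.conj_by_closed G.inv_closed
      w_closed)
qed

text \<open>With [g, h] = g^-1 g^h the left relation gives two factors. The first is evaluated by
  \<open>w_conj_by_w\<close>, the second by expanding w g (h x) also as w g ((h x h^-1) h). The
  result has the shape of [e, x] = e^-1 e^x for e = w g h.\<close>

lemma w_commutator_left:
  assumes C: "g \<in> carrier G" "h \<in> carrier G" "x \<in> carrier G"
  shows "w (commutator G g h) x = inv\<^bsub>E\<^esub> (w g h) \<otimes>\<^bsub>E\<^esub> w (conj_by G g x) (conj_by G h x)"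
proof -
  let ?gh = "conj_by G g h" and ?x' = "conj_by G x (inv h)" and ?c = "commutator G g h"
  have cg: "conj_by G (inv g) ?gh = inv (conj_by G g ?c)" "conj_by G x ?gh \<in> carrier G"
    using C by (simp_all add: G.word_simps)
  have gg: "?c = inv g \<otimes> ?gh" by (simp add: commutator_def)
  have "w ?c x = w (conj_by G (inv g) ?gh) (conj_by G x ?gh) \<otimes>\<^bsub>E\<^esub> w ?gh x"
    unfolding gg using w_mult_left[of "inv g" ?gh x] C by simp
  also have "w (conj_by G (inv g) ?gh) (conj_by G x ?gh)
      = inv\<^bsub>E\<^esub> (w (conj_by G g ?c) (conj_by G x ?c))"
  proof -
    have "conj_by G (conj_by G x ?gh) (inv (conj_by G g ?c)) = conj_by G x ?c"
      using C by (simp add: G.word_simps)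
    then show ?thesis unfolding cg(1) using w_inv_left[of "conj_by G g ?c" "conj_by G x ?gh"] C by
        simp
  qed
  also have "w (conj_by G g ?c) (conj_by G x ?c) = inv\<^bsub>E\<^esub> (w g h) \<otimes>\<^bsub>E\<^esub> (w g x \<otimes>\<^bsub>E\<^esub> w g h)"
    using w_conj_by_w[of g x g h] C by simp
  also have "w ?gh x = inv\<^bsub>E\<^esub> (w g h) \<otimes>\<^bsub>E\<^esub> (w g x \<otimes>\<^bsub>E\<^esub> w (conj_by G g x) (conj_by G h x))"
  proof -
    have "?x' \<otimes> h = h \<otimes> x" "conj_by G ?x' h = x" using C by (simp_all add: G.word_simps)
    then have "w g h \<otimes>\<^bsub>E\<^esub> w ?gh x = w g x \<otimes>\<^bsub>E\<^esub> w (conj_by G g x) (conj_by G h x)"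
      using w_mult_right[of g ?x' h] w_mult_right[of g h x] C by simp
    then have "inv\<^bsub>E\<^esub> (w g h) \<otimes>\<^bsub>E\<^esub> (w g h \<otimes>\<^bsub>E\<^esub> w ?gh x)
        = inv\<^bsub>E\<^esub> (w g h) \<otimes>\<^bsub>E\<^esub> (w g x \<otimes>\<^bsub>E\<^esub> w (conj_by G g x) (conj_by G h x))" by simp
    then show ?thesis using C by simp
  qed
  finally show ?thesis using C by (simp add: E.inv_mult_group E.m_assoc)
qed

text \<open>The cyclic group adjoined in an extension step is commutative, so the pairing has to be
  trivial on the powers of one element.\<close>

lemma w_int_pow:
  assumes x: "x \<in> carrier G"
  shows "w (x [^] (i::int)) (x [^] (j::int)) = \<one>\<^bsub>E\<^esub>"
proof (rule E.int_antihom_trivial[of "\<lambda>i. w (x [^] i) (x [^] j)"])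
  have comm: "x [^] (i + j) = x [^] j \<otimes> x [^] i" for i j :: int
    using x by (metis G.int_pow_mult add.commute)
  show "w (x [^] (i + k)) (x [^] j) = w (x [^] k) (x [^] j) \<otimes>\<^bsub>E\<^esub> w (x [^] i) (x [^] j)" for i k ::
      int
    using w_mult_left[of "x [^] k" "x [^] i" "x [^] j"] x by (simp add: comm G.conj_by_int_pow)
  show "w (x [^] (1::int)) (x [^] j) = \<one>\<^bsub>E\<^esub>"
  proof (rule E.int_antihom_trivial[of "\<lambda>j. w (x [^] (1::int)) (x [^] j)"])
    show "w (x [^] (1::int)) (x [^] (i + k)) = w (x [^] (1::int)) (x [^] k) \<otimes>\<^bsub>E\<^esub> w (x [^]
        (1::int)) (x [^] i)"
      for i k :: int
      using w_mult_right[of "x [^] (1::int)" "x [^] i" "x [^] k"] x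
      by (simp only: G.int_pow_mult G.int_pow_closed G.conj_by_int_pow)
  qed (use x in \<open>simp_all add: w_self\<close>)
qed (use x in simp)

end

section \<open>Realising an exterior pairing as the commutator pairing of a central extension\<close>

text \<open>The image of \<pi> may be a proper subgroup, because extensions grow by one element of G
  at a time. Centrality of the kernel follows from the commutator formula.\<close>

locale pairing_extension = exterior_pairing G E w + H: group H + \<iota>: group_hom E H \<iota> + \<pi>: group_hom
  H G \<pi>
  for G :: "('a, 'm) monoid_scheme" (structure) and E :: "('e, 'n) monoid_scheme" and w
    and H :: "('h, 'k) monoid_scheme" and \<iota> \<pi> +
  assumes \<iota>_inj: "inj_on \<iota> (carrier E)"
    and H_commutator: "\<lbrakk>h \<in> carrier H; k \<in> carrier H\<rbrakk> \<Longrightarrow> commutator H h k = \<iota> (w (\<pi> h) (\<pi> k))"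
    and \<pi>_\<iota>: "\<lbrakk>a \<in> carrier G; b \<in> carrier G\<rbrakk> \<Longrightarrow> \<pi> (\<iota> (w a b)) = commutator G a b"
begin

lemma H_swap:
  assumes "h \<in> carrier H" "k \<in> carrier H"
  shows "h \<otimes>\<^bsub>H\<^esub> k = k \<otimes>\<^bsub>H\<^esub> h \<otimes>\<^bsub>H\<^esub> \<iota> (w (\<pi> h) (\<pi> k))"
  using H.mult_commutator[OF assms] H_commutator[OF assms] by simp

text \<open>The commutator of \<iota> (w a b) with k is a pairing value, which
  \<open>w_commutator_left\<close> evaluates: H acts on pairing values through \<pi>.\<close>

lemma \<iota>_swap:
  assumes C: "a \<in> carrier G" "b \<in> carrier G" and k: "k \<in> carrier H"
  shows "\<iota> (w a b) \<otimes>\<^bsub>H\<^esub> k = k \<otimes>\<^bsub>H\<^esub> \<iota> (w (conj_by G a (\<pi> k)) (conj_by G b (\<pi> k)))"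
proof -
  have "\<iota> (w a b) \<otimes>\<^bsub>H\<^esub> k = k \<otimes>\<^bsub>H\<^esub> (\<iota> (w a b) \<otimes>\<^bsub>H\<^esub> \<iota> (w (commutator G a b) (\<pi> k)))"
    using H_swap[of "\<iota> (w a b)" k] C k by (simp add: \<pi>_\<iota> H.m_assoc)
  also have "\<iota> (w a b) \<otimes>\<^bsub>H\<^esub> \<iota> (w (commutator G a b) (\<pi> k))
      = \<iota> (w a b \<otimes>\<^bsub>E\<^esub> w (commutator G a b) (\<pi> k))"
    using C k by simp
  also have "w a b \<otimes>\<^bsub>E\<^esub> w (commutator G a b) (\<pi> k) = w (conj_by G a (\<pi> k)) (conj_by G b (\<pi> k))"
    using C k by (simp add: w_commutator_left)
  finally show ?thesis .
qed

lemma \<pi>_kernel_central: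
  assumes "z \<in> carrier H" "\<pi> z = \<one>" "h \<in> carrier H"
  shows "z \<otimes>\<^bsub>H\<^esub> h = h \<otimes>\<^bsub>H\<^esub> z"
  using H_swap[of z h] assms by (simp add: w_one_left)

end

text \<open>Adjoining to \<open>H\<close> an infinite cyclic group that acts by \<open>h \<mapsto> h \<cdot> \<iota> (w (\<pi> h) x)\<close>. The new
  integer coordinates are collected in a list, so that the step can be iterated within one type.\<close>

definition cons_coord :: "'c \<Rightarrow> 'c list \<times> 'e \<Rightarrow> 'c list \<times> 'e" where
  "cons_coord k h = (k # fst h, snd h)"

definition hd_coord :: "'c list \<times> 'e \<Rightarrow> 'c" where
  "hd_coord a = hd (fst a)"

definition tl_coord :: "'c list \<times> 'e \<Rightarrow> 'c list \<times> 'e" where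
  "tl_coord a = (tl (fst a), snd a)"

lemma coord_simps [simp]:
  "hd_coord (cons_coord k h) = k" "tl_coord (cons_coord k h) = h"
  "cons_coord k h = cons_coord k' h' \<longleftrightarrow> k = k' \<and> h = h'"
  by (auto simp: cons_coord_def hd_coord_def tl_coord_def prod_eq_iff)

locale pairing_extension_step = pairing_extension G E w H \<iota> \<pi>
  for G :: "('a, 'm) monoid_scheme" (structure) and E :: "('e, 'n) monoid_scheme" and w
    and H :: "(int list \<times> 'e) monoid" and \<iota> \<pi> +
  fixes x
  assumes x [simp]: "x \<in> carrier G"
begin

text \<open>The element with coordinate k and tail h stands for t^k h, where t is a new element over
  x. The middle factor of the product is the commutator [h, t^k'] that arises when t^k' is moved to
  the left of h.\<close>

definition ext :: "(int list \<times> 'e) monoid" where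
  "ext = \<lparr>carrier = {cons_coord k h |k h. h \<in> carrier H},
    monoid.mult = (\<lambda>a b. cons_coord (hd_coord a + hd_coord b)
      (tl_coord a \<otimes>\<^bsub>H\<^esub> \<iota> (w (\<pi> (tl_coord a)) (x [^] hd_coord b)) \<otimes>\<^bsub>H\<^esub> tl_coord b)),
    one = cons_coord 0 \<one>\<^bsub>H\<^esub>\<rparr>"

definition ext_proj :: "int list \<times> 'e \<Rightarrow> 'a" where
  "ext_proj a = x [^] hd_coord a \<otimes> \<pi> (tl_coord a)"

lemma ext_mult:
  "cons_coord k h \<otimes>\<^bsub>ext\<^esub> cons_coord k' h'
    = cons_coord (k + k') (h \<otimes>\<^bsub>H\<^esub> \<iota> (w (\<pi> h) (x [^] k')) \<otimes>\<^bsub>H\<^esub> h')"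
  and ext_one: "\<one>\<^bsub>ext\<^esub> = cons_coord 0 \<one>\<^bsub>H\<^esub>"
  and ext_carrier: "carrier ext = {cons_coord k h |k h. h \<in> carrier H}"
  by (simp_all add: ext_def)

lemma ext_mem [simp]: "cons_coord k h \<in> carrier ext \<longleftrightarrow> h \<in> carrier H"
  unfolding ext_carrier by (simp del: split_paired_Ex)

lemma ext_cases:
  assumes "a \<in> carrier ext"
  obtains k h where "a = cons_coord k h" "h \<in> carrier H"
  using assms by (auto simp: ext_carrier)

lemma \<pi>_twist:
  assumes "h \<in> carrier H"
  shows "\<pi> (h \<otimes>\<^bsub>H\<^esub> \<iota> (w (\<pi> h) (x [^] (k::int)))) = conj_by G (\<pi> h) (x [^] k)"
  using assms by (simp add: \<pi>_\<iota> G.mult_commutator_eq_conj_by)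

text \<open>Associativity expresses that x^k acts on H by h -> h \<iota> (w (\<pi> h) (x^k)),
  compatibly with products in H and with addition of exponents. The former comes from
  \<open>w_mult_left\<close> and \<open>\<iota>_swap\<close>, the latter from
  \<open>w_mult_right\<close>.\<close>

lemma group_ext: "group ext"
proof (rule groupI)
  show "a \<otimes>\<^bsub>ext\<^esub> b \<in> carrier ext" if "a \<in> carrier ext" "b \<in> carrier ext" for a b
    using that by (elim ext_cases) (simp add: ext_mult)
  show "\<one>\<^bsub>ext\<^esub> \<in> carrier ext" by (simp add: ext_one)
  show "\<one>\<^bsub>ext\<^esub> \<otimes>\<^bsub>ext\<^esub> a = a" if "a \<in> carrier ext" for a
    using that by (elim ext_cases) (simp add: ext_mult ext_one w_one_left)
  show "a \<otimes>\<^bsub>ext\<^esub> b \<otimes>\<^bsub>ext\<^esub> c = a \<otimes>\<^bsub>ext\<^esub> (b \<otimes>\<^bsub>ext\<^esub> c)"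
    if abc: "a \<in> carrier ext" "b \<in> carrier ext" "c \<in> carrier ext" for a b c
  proof -
    obtain k1 h1 k2 h2 k3 h3 where a: "a = cons_coord k1 h1" "h1 \<in> carrier H"
      and b: "b = cons_coord k2 h2" "h2 \<in> carrier H" and c: "c = cons_coord k3 h3" "h3 \<in> carrier H"
      using abc by (elim ext_cases)
    let ?u1 = "\<pi> h1" and ?u2 = "\<pi> h2" and ?b2 = "x [^] k2" and ?b3 = "x [^] k3"
    let ?v = "conj_by G ?u1 ?b2"
    have C: "?u1 \<in> carrier G" "?u2 \<in> carrier G" "?b2 \<in> carrier G" "?b3 \<in> carrier G" "?v \<in> carrier G"
      using a b by simp_all
    have "\<iota> (w ?u1 ?b2) \<otimes>\<^bsub>H\<^esub> h2 \<otimes>\<^bsub>H\<^esub> \<iota> (w (?v \<otimes> ?u2) ?b3)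
        = \<iota> (w ?u1 ?b2) \<otimes>\<^bsub>H\<^esub> (h2 \<otimes>\<^bsub>H\<^esub> \<iota> (w (conj_by G ?v ?u2) (conj_by G ?b3 ?u2))) \<otimes>\<^bsub>H\<^esub> \<iota> (w ?u2
            ?b3)"
      using w_mult_left[of ?v ?u2 ?b3] C b by (simp add: H.m_assoc)
    also have "h2 \<otimes>\<^bsub>H\<^esub> \<iota> (w (conj_by G ?v ?u2) (conj_by G ?b3 ?u2)) = \<iota> (w ?v ?b3) \<otimes>\<^bsub>H\<^esub> h2"
      using \<iota>_swap[of ?v ?b3 h2] C b by simp
    also have "\<iota> (w ?u1 ?b2) \<otimes>\<^bsub>H\<^esub> (\<iota> (w ?v ?b3) \<otimes>\<^bsub>H\<^esub> h2) \<otimes>\<^bsub>H\<^esub> \<iota> (w ?u2 ?b3)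
        = \<iota> (w ?u1 ?b2 \<otimes>\<^bsub>E\<^esub> w ?v ?b3) \<otimes>\<^bsub>H\<^esub> h2 \<otimes>\<^bsub>H\<^esub> \<iota> (w ?u2 ?b3)"
      using C b by (simp add: H.m_assoc)
    also have "w ?u1 ?b2 \<otimes>\<^bsub>E\<^esub> w ?v ?b3 = w ?u1 (x [^] (k2 + k3))"
      using w_mult_right[of ?u1 ?b3 ?b2] C G.conj_by_int_pow[OF x, of k3 k2]
      by (simp add: G.int_pow_mult[symmetric] add.commute)
    finally have key: "\<iota> (w ?u1 ?b2) \<otimes>\<^bsub>H\<^esub> h2 \<otimes>\<^bsub>H\<^esub> \<iota> (w (?v \<otimes> ?u2) ?b3)
        = \<iota> (w ?u1 (x [^] (k2 + k3))) \<otimes>\<^bsub>H\<^esub> h2 \<otimes>\<^bsub>H\<^esub> \<iota> (w ?u2 ?b3)" .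
    have "\<pi> (h1 \<otimes>\<^bsub>H\<^esub> \<iota> (w ?u1 ?b2) \<otimes>\<^bsub>H\<^esub> h2) = ?v \<otimes> ?u2"
      using \<pi>_twist[of h1 k2] a b C by simp
    then have "a \<otimes>\<^bsub>ext\<^esub> b \<otimes>\<^bsub>ext\<^esub> c = cons_coord (k1 + k2 + k3)
        (h1 \<otimes>\<^bsub>H\<^esub> (\<iota> (w ?u1 ?b2) \<otimes>\<^bsub>H\<^esub> h2 \<otimes>\<^bsub>H\<^esub> \<iota> (w (?v \<otimes> ?u2) ?b3)) \<otimes>\<^bsub>H\<^esub> h3)"
      using a b c C by (simp add: ext_mult H.m_assoc)
    also have "\<dots> = a \<otimes>\<^bsub>ext\<^esub> (b \<otimes>\<^bsub>ext\<^esub> c)"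
      unfolding key using a b c C by (simp add: ext_mult H.m_assoc add.assoc)
    finally show ?thesis .
  qed
  show "\<exists>b\<in>carrier ext. b \<otimes>\<^bsub>ext\<^esub> a = \<one>\<^bsub>ext\<^esub>" if "a \<in> carrier ext" for a
  proof -
    obtain k h where a: "a = cons_coord k h" "h \<in> carrier H" 
      using \<open>a \<in> carrier ext\<close> by (elim ext_cases)
    let ?u = "\<pi> (inv\<^bsub>H\<^esub> h)" and ?y = "inv\<^bsub>H\<^esub> h \<otimes>\<^bsub>H\<^esub> \<iota> (w (\<pi> (inv\<^bsub>H\<^esub> h)) (x [^] (- k)))"
    have C: "?u \<in> carrier G" "?y \<in> carrier H" "x [^] (- k) \<in> carrier G" "x [^] k \<in> carrier G"
      using a by simp_all
    have "w ?u (x [^] (- k)) \<otimes>\<^bsub>E\<^esub> w (conj_by G ?u (x [^] (- k))) (x [^] k) = \<one>\<^bsub>E\<^esub>"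
      using w_mult_right[of ?u "x [^] k" "x [^] (- k)"] C G.conj_by_int_pow[OF x, of k "- k"]
          w_one_right[of ?u]
        G.int_pow_mult[OF x, of k "- k"] by simp
    then have "\<iota> (w ?u (x [^] (- k))) \<otimes>\<^bsub>H\<^esub> \<iota> (w (conj_by G ?u (x [^] (- k))) (x [^] k)) = \<one>\<^bsub>H\<^esub>"
      using C by (simp flip: \<iota>.hom_mult)
    moreover have "\<pi> ?y = conj_by G ?u (x [^] (- k))" using \<pi>_twist[of "inv\<^bsub>H\<^esub> h" "- k"] a by blast
    ultimately have "?y \<otimes>\<^bsub>H\<^esub> \<iota> (w (\<pi> ?y) (x [^] k)) \<otimes>\<^bsub>H\<^esub> h = \<one>\<^bsub>H\<^esub>"
      using C a by (simp add: H.m_assoc del: \<pi>.hom_inv \<pi>.hom_mult)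
    then have "cons_coord (- k) ?y \<otimes>\<^bsub>ext\<^esub> a = \<one>\<^bsub>ext\<^esub>" by (simp add: a ext_mult ext_one)
    then show ?thesis using C(2) ext_mem by blast
  qed
qed

text \<open>Expand w (x^k u) (x^k' v) with u, v the images of the tails. The part from x^k and x^k'
  is trivial, the part from x^k and v cancels by skewness against the twist in b a, and the parts
  from u with v and with x^k' turn b a into a b.\<close>

lemma ext_extension: "pairing_extension G E w ext (\<lambda>e. cons_coord 0 (\<iota> e)) ext_proj"
proof (intro pairing_extension.intro pairing_extension_axioms.intro exterior_pairing_axioms
  group_ext
    group_hom.intro group_hom_axioms.intro homI E.is_group G.is_group)
  fix a b assume "a \<in> carrier ext" "b \<in> carrier ext"
  then obtain k h k' h' where ab: "a = cons_coord k h" "h \<in> carrier H" "b = cons_coord k' h'" "h'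
      \<in> carrier H"
    by (elim ext_cases)
  let ?u = "\<pi> h" and ?v = "\<pi> h'" and ?a = "x [^] k" and ?b = "x [^] k'"
  have C: "?u \<in> carrier G" "?v \<in> carrier G" "?a \<in> carrier G" "?b \<in> carrier G" using ab by simp_all
  have "?u \<otimes> commutator G ?u ?b = inv ?b \<otimes> (?u \<otimes> ?b)" using C by (simp add: G.word_simps)
  then show "ext_proj (a \<otimes>\<^bsub>ext\<^esub> b) = ext_proj a \<otimes> ext_proj b"
    using ab C \<pi>_twist[of h k']
    by (simp add: ext_proj_def ext_mult G.int_pow_mult G.m_assoc conj_by_def)
  interpret X: group ext by (rule group_ext)
  \<comment> \<open>Conjugation by h' carries w (x^k) (x^k') = 1 to the conjugated arguments inside
    H; injectivity of \<iota> brings the equation back to E.\<close>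
  have "w ?a (?b \<otimes> ?v) = w ?a ?v"
  proof -
    have "\<iota> (w (conj_by G ?a ?v) (conj_by G ?b ?v)) = \<one>\<^bsub>H\<^esub>"
      using \<iota>_swap[of ?a ?b h'] C ab w_int_pow[OF x, of k k'] by simp
    then have "w (conj_by G ?a ?v) (conj_by G ?b ?v) = \<one>\<^bsub>E\<^esub>"
      using \<iota>_inj C by (metis E.one_closed G.conj_by_closed \<iota>.hom_one inj_onD w_closed)
    then show ?thesis using w_mult_right[of ?a ?b ?v] C by simp
  qed
  then have "h \<otimes>\<^bsub>H\<^esub> \<iota> (w (conj_by G ?a ?u) (conj_by G (?b \<otimes> ?v) ?u)) = \<iota> (w ?a ?v) \<otimes>\<^bsub>H\<^esub> h"
    using \<iota>_swap[of ?a "?b \<otimes> ?v" h] C ab by simp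
  moreover have "\<iota> (w (?a \<otimes> ?u) (?b \<otimes> ?v))
      = \<iota> (w (conj_by G ?a ?u) (conj_by G (?b \<otimes> ?v) ?u)) \<otimes>\<^bsub>H\<^esub>
        (\<iota> (w ?u ?v) \<otimes>\<^bsub>H\<^esub> \<iota> (w (conj_by G ?u ?v) (conj_by G ?b ?v)))"
    using w_mult_left[of ?a ?u "?b \<otimes> ?v"] w_mult_right[of ?u ?b ?v] C by simp
  ultimately have "h' \<otimes>\<^bsub>H\<^esub> \<iota> (w ?v ?a) \<otimes>\<^bsub>H\<^esub> h \<otimes>\<^bsub>H\<^esub> \<iota> (w (?a \<otimes> ?u) (?b \<otimes> ?v))
      = h' \<otimes>\<^bsub>H\<^esub> (\<iota> (w ?v ?a) \<otimes>\<^bsub>H\<^esub> \<iota> (w ?a ?v)) \<otimes>\<^bsub>H\<^esub> h \<otimes>\<^bsub>H\<^esub>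
        (\<iota> (w ?u ?v) \<otimes>\<^bsub>H\<^esub> \<iota> (w (conj_by G ?u ?v) (conj_by G ?b ?v)))"
    using C ab by (simp add: H.m_assoc) (simp flip: H.m_assoc)
  also have "\<iota> (w ?v ?a) \<otimes>\<^bsub>H\<^esub> \<iota> (w ?a ?v) = \<one>\<^bsub>H\<^esub>"
    using w_skew[of ?v ?a] C by (simp flip: \<iota>.hom_mult)
  also have "h' \<otimes>\<^bsub>H\<^esub> \<one>\<^bsub>H\<^esub> \<otimes>\<^bsub>H\<^esub> h \<otimes>\<^bsub>H\<^esub> (\<iota> (w ?u ?v) \<otimes>\<^bsub>H\<^esub> \<iota> (w (conj_by G ?u ?v) (conj_by G ?b ?v)))
      = (h' \<otimes>\<^bsub>H\<^esub> h \<otimes>\<^bsub>H\<^esub> \<iota> (w ?u ?v)) \<otimes>\<^bsub>H\<^esub> \<iota> (w (conj_by G ?u ?v) (conj_by G ?b ?v))"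
    using C ab by (simp add: H.m_assoc)
  also have "h' \<otimes>\<^bsub>H\<^esub> h \<otimes>\<^bsub>H\<^esub> \<iota> (w ?u ?v) = h \<otimes>\<^bsub>H\<^esub> h'" using H_swap[of h h'] ab by simp
  also have "h \<otimes>\<^bsub>H\<^esub> h' \<otimes>\<^bsub>H\<^esub> \<iota> (w (conj_by G ?u ?v) (conj_by G ?b ?v)) = h \<otimes>\<^bsub>H\<^esub> \<iota> (w ?u ?b) \<otimes>\<^bsub>H\<^esub> h'"
    using \<iota>_swap[of ?u ?b h'] C ab by (simp add: H.m_assoc)
  finally have eq: "a \<otimes>\<^bsub>ext\<^esub> b = b \<otimes>\<^bsub>ext\<^esub> a \<otimes>\<^bsub>ext\<^esub> cons_coord 0 (\<iota> (w (ext_proj a) (ext_proj b)))"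
    using C ab by (simp add: ext_mult ext_proj_def add.commute w_one_right)
  let ?z = "cons_coord 0 (\<iota> (w (ext_proj a) (ext_proj b)))"
  have z: "?z \<in> carrier ext" using C ab by (simp add: ext_proj_def)
  have "commutator ext a b = inv\<^bsub>ext\<^esub> (b \<otimes>\<^bsub>ext\<^esub> a) \<otimes>\<^bsub>ext\<^esub> (a \<otimes>\<^bsub>ext\<^esub> b)"
    using \<open>a \<in> carrier ext\<close> \<open>b \<in> carrier ext\<close> by (simp add: X.word_simps)
  then show "commutator ext a b = ?z"
    unfolding eq using \<open>a \<in> carrier ext\<close> \<open>b \<in> carrier ext\<close> z
    by (metis X.inv_mult_cancel(1) X.m_closed)
next
  show "inj_on (\<lambda>e. cons_coord 0 (\<iota> e)) (carrier E)"
    using \<iota>_inj by (auto simp: inj_on_def)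
qed (auto elim!: ext_cases simp: ext_mult ext_proj_def w_one_right \<pi>_\<iota>)

lemma ext_proj_image: "\<pi> ` carrier H \<subseteq> ext_proj ` carrier ext" "x \<in> ext_proj ` carrier ext"
proof -
  show "\<pi> ` carrier H \<subseteq> ext_proj ` carrier ext"
  proof
    fix g assume "g \<in> \<pi> ` carrier H"
    then obtain h where h: "h \<in> carrier H" "g = \<pi> h" by blast
    then show "g \<in> ext_proj ` carrier ext"
      by (intro image_eqI[of _ _ "cons_coord 0 h"]) (simp_all add: ext_proj_def)
  qed
  show "x \<in> ext_proj ` carrier ext"
    by (intro image_eqI[of _ _ "cons_coord 1 \<one>\<^bsub>H\<^esub>"]) (simp_all add: ext_proj_def)
qed

end

section \<open>Pairings whose values generate the target, and the iterated extension\<close>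

locale generated_exterior_pairing = exterior_pairing G E w + \<delta>: group_hom E G \<delta>
  for G :: "('a, 'm) monoid_scheme" (structure) and E :: "('e, 'n) monoid_scheme" and w and \<delta> +
  assumes \<delta>_w: "\<lbrakk>g \<in> carrier G; h \<in> carrier G\<rbrakk> \<Longrightarrow> \<delta> (w g h) = commutator G g h"
    and E_generated: "carrier E = generate E {w g h |g h. g \<in> carrier G \<and> h \<in> carrier G}"
begin

lemma E_induct [consumes 1, case_names w one inv mult]:
  assumes "e \<in> carrier E"
    and w: "\<And>g h. g \<in> carrier G \<Longrightarrow> h \<in> carrier G \<Longrightarrow> P (w g h)"
    and one: "P \<one>\<^bsub>E\<^esub>"
    and inv: "\<And>e. e \<in> carrier E \<Longrightarrow> P e \<Longrightarrow> P (inv\<^bsub>E\<^esub> e)"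
    and mult: "\<And>e f. \<lbrakk>e \<in> carrier E; f \<in> carrier E; P e; P f\<rbrakk> \<Longrightarrow> P (e \<otimes>\<^bsub>E\<^esub> f)"
  shows "P e"
proof -
  have "e \<in> generate E {w g h |g h. g \<in> carrier G \<and> h \<in> carrier G}" using assms(1) E_generated by
      simp
  then show ?thesis
  proof induction
    case (eng e f)
    then show ?case using E_generated by (intro mult) simp_all
  next
    case (inv e)
    then obtain g h where "e = w g h" "g \<in> carrier G" "h \<in> carrier G" by blast
    then show ?case using w assms(4) by simp
  qed (use w one in auto)
qed

text \<open>Both sides are actions of E, so \<open>w_conj_by_w\<close>, which is the case of a
  generator, extends to all of E.\<close>

lemma w_conj_by:
  assumes e: "e \<in> carrier E" and ab: "a \<in> carrier G" "b \<in> carrier G"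
  shows "conj_by E (w a b) e = w (conj_by G a (\<delta> e)) (conj_by G b (\<delta> e))"
  using e ab
proof (induction e arbitrary: a b rule: E_induct)
  case (w g h)
  then show ?case
    using w_conj_by_w[of a b g h] by (simp add: \<delta>_w conj_by_def[of E] E.m_assoc)
next
  case one
  then show ?case by (simp add: conj_by_def)
next
  case (inv e)
  let ?a = "conj_by G a (inv (\<delta> e))" and ?b = "conj_by G b (inv (\<delta> e))"
  have cc: "conj_by G (conj_by G c (inv (\<delta> e))) (\<delta> e) = c" if "c \<in> carrier G" for c
    using that inv by (simp add: conj_by_def G.m_assoc)
  have "conj_by E (w ?a ?b) e = w a b" using inv cc by simp
  then have "conj_by E (w a b) (inv\<^bsub>E\<^esub> e) = conj_by E (conj_by E (w ?a ?b) e) (inv\<^bsub>E\<^esub> e)" by simp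
  also have "\<dots> = w ?a ?b"
  proof -
    have "conj_by E (conj_by E z e) (inv\<^bsub>E\<^esub> e) = z" if "z \<in> carrier E" for z
      using that inv(1) by (simp add: conj_by_def E.m_assoc)
    moreover have "w ?a ?b \<in> carrier E" using inv by simp
    ultimately show ?thesis .
  qed
  finally show ?case using inv by simp
next
  case (mult e f)
  have cc: "conj_by G (conj_by G c (\<delta> e)) (\<delta> f) = conj_by G c (\<delta> e \<otimes> \<delta> f)" if "c \<in> carrier G" for c
    using that mult by (simp add: G.word_simps)
  have "conj_by E (w a b) (e \<otimes>\<^bsub>E\<^esub> f) = conj_by E (conj_by E (w a b) e) f"
    using mult(1,2,5,6) by (simp add: E.word_simps)
  then show ?case using mult by (simp add: cc)
qed

text \<open>This makes E a pairing extension of itself, from which the iteration starts. For a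
  generator e it is \<open>w_commutator_left\<close> read through \<open>w_conj_by\<close>.\<close>

lemma commutator_eq_w:
  assumes e: "e \<in> carrier E" and f: "f \<in> carrier E"
  shows "commutator E e f = w (\<delta> e) (\<delta> f)"
  using e
proof (induction e rule: E_induct)
  case (w g h)
  then show ?case
    using f w_conj_by[of f g h] by (simp add: \<delta>_w w_commutator_left commutator_def[of E])
next
  case one
  then show ?case using f by (simp add: w_one_left E.word_simps)
next
  case (inv e)
  have e': "conj_by G (\<delta> e) (inv (\<delta> e)) = \<delta> e" using inv by (simp add: conj_by_def G.m_assoc)
  have inv_conj: "conj_by E (inv\<^bsub>E\<^esub> a) b = inv\<^bsub>E\<^esub> (conj_by E a b)"
    if "a \<in> carrier E" "b \<in> carrier E" for a b
    using that by (simp add: E.word_simps)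
  have "commutator E (inv\<^bsub>E\<^esub> e) f = inv\<^bsub>E\<^esub> (conj_by E (w (\<delta> e) (\<delta> f)) (inv\<^bsub>E\<^esub> e))"
    using inv f by (simp add: E.commutator_inv_left inv_conj)
  also have "\<dots> = inv\<^bsub>E\<^esub> (w (\<delta> e) (conj_by G (\<delta> f) (inv (\<delta> e))))"
    using inv f e' by (simp add: w_conj_by)
  also have "\<dots> = w (\<delta> (inv\<^bsub>E\<^esub> e)) (\<delta> f)" using inv f by (simp add: w_inv_left)
  finally show ?case .
next
  case (mult e g)
  then show ?case
    using f by (simp add: E.commutator_mult_left w_conj_by w_mult_left)
qed

text \<open>A copy of E with an empty list of coordinates, in the type shared by all later
  extensions; here the projection reaches only the image of \<delta>.\<close>

definition base :: "(int list \<times> 'e) monoid" where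
  "base = \<lparr>carrier = {[]} \<times> carrier E,
    monoid.mult = (\<lambda>a b. ([], snd a \<otimes>\<^bsub>E\<^esub> snd b)), one = ([], \<one>\<^bsub>E\<^esub>)\<rparr>"

lemma base_simps:
  "a \<in> carrier base \<longleftrightarrow> (\<exists>e. a = ([], e) \<and> e \<in> carrier E)"
  "([], e) \<otimes>\<^bsub>base\<^esub> ([], f) = ([], e \<otimes>\<^bsub>E\<^esub> f)" "\<one>\<^bsub>base\<^esub> = ([], \<one>\<^bsub>E\<^esub>)"
  by (auto simp: base_def)

lemma group_base: "group base"
proof (rule groupI)
  show "\<exists>b\<in>carrier base. b \<otimes>\<^bsub>base\<^esub> a = \<one>\<^bsub>base\<^esub>" if "a \<in> carrier base" for a
    using that by (intro bexI[of _ "([], inv\<^bsub>E\<^esub> snd a)"]) (auto simp: base_simps)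
  show "a \<otimes>\<^bsub>base\<^esub> b \<otimes>\<^bsub>base\<^esub> c = a \<otimes>\<^bsub>base\<^esub> (b \<otimes>\<^bsub>base\<^esub> c)"
    if "a \<in> carrier base" "b \<in> carrier base" "c \<in> carrier base" for a b c
    using that E.m_assoc by (auto simp: base_simps)
qed (auto simp: base_simps)

lemma base_extension: "pairing_extension G E w base (Pair []) (\<lambda>a. \<delta> (snd a))"
proof -
  interpret \<iota>: group_hom E base "Pair []"
    by (intro group_hom.intro group_hom_axioms.intro homI group_base E.is_group) (auto simp:
        base_simps)
  show ?thesis
  proof (intro pairing_extension.intro pairing_extension_axioms.intro exterior_pairing_axioms
      group_base
      \<iota>.group_hom_axioms group_hom.intro[of base G] group_hom_axioms.intro homI G.is_group)
    fix a b assume "a \<in> carrier base" "b \<in> carrier base"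
    then obtain e f where ef: "a = ([], e)" "b = ([], f)" "e \<in> carrier E" "f \<in> carrier E"
      by (auto simp: base_simps)
    then show "commutator base a b = ([], w (\<delta> (snd a)) (\<delta> (snd b)))"
      using \<iota>.hom_commutator[of e f] commutator_eq_w[of e f] by simp
    show "\<delta> (snd (a \<otimes>\<^bsub>base\<^esub> b)) = \<delta> (snd a) \<otimes> \<delta> (snd b)" 
      unfolding ef(1,2) base_simps snd_conv using ef(3,4) by (rule \<delta>.hom_mult)
  qed (auto simp: base_simps inj_on_def \<delta>_w)
qed

lemma exists_pairing_extension:
  assumes "set xs \<subseteq> carrier G"
  shows "\<exists>(H :: (int list \<times> 'e) monoid) \<iota> \<pi>. pairing_extension G E w H \<iota> \<pi> \<and> set xs \<subseteq> \<pi> ` carrier H"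
  using assms
proof (induction xs)
  case Nil
  then show ?case using base_extension by auto
next
  case (Cons x xs)
  then obtain H :: "(int list \<times> 'e) monoid" and \<iota> \<pi>
    where H: "pairing_extension G E w H \<iota> \<pi>" "set xs \<subseteq> \<pi> ` carrier H" by auto
  interpret pairing_extension_step G E w H \<iota> \<pi> x
    using H(1) Cons.prems by (intro pairing_extension_step.intro
        pairing_extension_step_axioms.intro) auto
  have "set (x # xs) \<subseteq> ext_proj ` carrier ext" using ext_proj_image H(2) by auto
  then show ?case using ext_extension by blast
qed

lemma exists_surjective_pairing_extension:
  assumes "finite (carrier G)"
  shows "\<exists>(H :: (int list \<times> 'e) monoid) \<iota> \<pi>. pairing_extension G E w H \<iota> \<pi> \<and> \<pi> ` carrier H =
      carrier G"
proof -
  obtain xs where xs: "set xs = carrier G" using finite_list[OF assms] by blast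
  then obtain H :: "(int list \<times> 'e) monoid" and \<iota> \<pi>
    where H: "pairing_extension G E w H \<iota> \<pi>" "carrier G \<subseteq> \<pi> ` carrier H"
    using exists_pairing_extension[of xs] by auto
  interpret pairing_extension G E w H \<iota> \<pi> by (rule H(1))
  have "\<pi> ` carrier H = carrier G" using H(2) \<pi>.hom_closed by blast
  then show ?thesis using H(1) by blast
qed

end

section \<open>Homomorphisms out of a presented group\<close>

definition (in group) word_eval :: "('x \<Rightarrow> 'a) \<Rightarrow> 'x word \<Rightarrow> 'a" where
  "word_eval f u = foldr (\<lambda>(b, x) q. (if b then f x else inv (f x)) \<otimes> q) u \<one>"

context group
begin

lemma word_eval_simps [simp]:
  "word_eval f [] = \<one>"
  "word_eval f ((b, x) # u) = (if b then f x else inv (f x)) \<otimes> word_eval f u"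
  by (simp_all add: word_eval_def)

lemma word_eval_closed [simp]:
  assumes "f ` S \<subseteq> carrier G" "u \<in> lists (UNIV \<times> S)"
  shows "word_eval f u \<in> carrier G"
  using assms(2) by (induction rule: lists.induct) (use assms(1) in auto)

lemma word_eval_append:
  assumes "f ` S \<subseteq> carrier G" "u \<in> lists (UNIV \<times> S)" "v \<in> lists (UNIV \<times> S)"
  shows "word_eval f (u @ v) = word_eval f u \<otimes> word_eval f v"
  using assms(2)
proof (induction rule: lists.induct)
  case Nil
  then show ?case using assms by simp
next
  case (Cons a u)
  obtain b x where a: "a = (b, x)" "x \<in> S" using Cons.hyps by (cases a) auto
  then have "f x \<in> carrier G" using assms(1) by blast
  moreover have "word_eval f u \<in> carrier G" "word_eval f v \<in> carrier G"
    using Cons.hyps assms by (auto intro!: word_eval_closed[OF assms(1)])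
  ultimately show ?case using a Cons.IH by (simp add: m_assoc)
qed

lemma word_eval_cong:
  assumes f: "f ` S \<subseteq> carrier G"
    and R: "\<And>u v. \<lbrakk>(u, v) \<in> R; u \<in> lists (UNIV \<times> S); v \<in> lists (UNIV \<times> S)\<rbrakk> \<Longrightarrow>
      word_eval f u = word_eval f v"
    and uv: "(u, v) \<in> word_cong S R"
  shows "word_eval f u = word_eval f v"
  using uv
proof induction
  case (append u u' v v')
  then show ?case using word_eval_append[OF f] word_cong_in_lists by metis
next
  case (cancel x b)
  then have "f x \<in> carrier G" using f by blast
  then show ?case by simp
qed (use R in auto)

lemma presented_group_hom_exists:
  assumes f: "f ` S \<subseteq> carrier G"
    and R: "\<And>u v. \<lbrakk>(u, v) \<in> R; u \<in> lists (UNIV \<times> S); v \<in> lists (UNIV \<times> S)\<rbrakk> \<Longrightarrow>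
      word_eval f u = word_eval f v"
  shows "\<exists>\<phi>. \<phi> \<in> hom (presented_group S R) G \<and> (\<forall>x\<in>S. \<phi> (word_cong S R `` {[(True, x)]}) = f x)"
proof -
  \<comment> \<open>Evaluation is constant on a congruence class, so the image of a class is a
    singleton.\<close>
  define \<phi> where "\<phi> = (\<lambda>A. the_elem (word_eval f ` A))"
  have \<phi>: "\<phi> (word_cong S R `` {u}) = word_eval f u" if u: "u \<in> lists (UNIV \<times> S)" for u
  proof -
    have "word_eval f ` (word_cong S R `` {u}) = {word_eval f u}"
      using word_eval_cong[OF f R] word_cong.refl[OF u] by (auto simp: image_iff)
    then show ?thesis by (simp add: \<phi>_def)
  qed
  have carr: "\<exists>u. u \<in> lists (UNIV \<times> S) \<and> A = word_cong S R `` {u}" if "A \<in> carrier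
      (presented_group S R)" for A
    using that by (auto simp: presented_group_def quotient_def)
  have "\<phi> \<in> hom (presented_group S R) G"
  proof (rule homI)
    fix A assume "A \<in> carrier (presented_group S R)"
    then show "\<phi> A \<in> carrier G" using carr[of A] \<phi> word_eval_closed[OF f] by metis
    fix B assume "B \<in> carrier (presented_group S R)"
    then obtain u v where uv: "u \<in> lists (UNIV \<times> S)" "v \<in> lists (UNIV \<times> S)"
      "A = word_cong S R `` {u}" "B = word_cong S R `` {v}"
      using carr \<open>A \<in> carrier (presented_group S R)\<close> by metis
    then have "u @ v \<in> lists (UNIV \<times> S)" by simp
    then show "\<phi> (A \<otimes>\<^bsub>presented_group S R\<^esub> B) = \<phi> A \<otimes> \<phi> B"
      using uv by (simp add: presented_group_mult \<phi> word_eval_append[OF f])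
  qed
  moreover have "\<phi> (word_cong S R `` {[(True, x)]}) = f x" if "x \<in> S" for x
  proof -
    have "f x \<in> carrier G" using f that by blast
    then show ?thesis using \<phi>[of "[(True, x)]"] that by simp
  qed
  ultimately show ?thesis by blast
qed

end

lemma presented_group_generated:
  "carrier (presented_group S R)
    = generate (presented_group S R) {word_cong S R `` {[(True, x)]} |x. x \<in> S}"
proof
  interpret P: group "presented_group S R" by (rule group_presented_group)
  let ?P = "presented_group S R" and ?c = "\<lambda>u. word_cong S R `` {u}"
  let ?X = "{?c [(True, x)] |x. x \<in> S}"
  have carr: "?c u \<in> carrier ?P" if "u \<in> lists (UNIV \<times> S)" for u
    using that by (auto simp: presented_group_def quotient_def)
  then have X: "?X \<subseteq> carrier ?P" by auto
  then show "generate ?P ?X \<subseteq> carrier ?P" by (rule P.generate_incl)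
  have one: "\<one>\<^bsub>?P\<^esub> = ?c []" by (simp add: presented_group_def)
  have letter: "?c [(b, x)] \<in> generate ?P ?X" if x: "x \<in> S" for b x
  proof (cases b)
    case True
    then show ?thesis using x by (auto intro!: generate.incl)
  next
    case False
    have "?c [(False, x)] \<otimes>\<^bsub>?P\<^esub> ?c [(True, x)] = ?c ([(False, x)] @ [(True, x)])"
      using x by (intro presented_group_mult) auto
    also have "\<dots> = \<one>\<^bsub>?P\<^esub>"
      unfolding one using word_cong.cancel[OF x, of False R]
      by (intro equiv_class_eq[OF equiv_word_cong]) simp
    finally have "?c [(False, x)] = inv\<^bsub>?P\<^esub> (?c [(True, x)])"
      using x by (intro P.inv_equality[symmetric] carr) auto
    then show ?thesis using False x by (auto intro!: generate.inv)
  qed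
  have "?c u \<in> generate ?P ?X" if "u \<in> lists (UNIV \<times> S)" for u
    using that
  proof (induction rule: lists.induct)
    case Nil
    then show ?case using generate.one[of ?P] by (simp add: one)
  next
    case (Cons a u)
    obtain b x where a: "a = (b, x)" "x \<in> S" using Cons.hyps by (cases a) auto
    have "?c (a # u) = ?c [a] \<otimes>\<^bsub>?P\<^esub> ?c u"
      using presented_group_mult[of "[a]" S u R] Cons.hyps by simp
    then show ?case using generate.eng[OF letter[OF a(2)] Cons.IH] a by simp
  qed
  then show "carrier ?P \<subseteq> generate ?P ?X"
    by (auto simp: presented_group_def quotient_def)
qed

section \<open>The exponent of the exterior square\<close>

context group
begin

definition ext_wedge :: "'a \<Rightarrow> 'a \<Rightarrow> ('a \<times> 'a) word set" where
  "ext_wedge g h = word_cong (carrier G \<times> carrier G) (exterior_relations G) `` {wedge g h}"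

lemma exterior_square_pairing: "\<exists>\<delta>. generated_exterior_pairing G (exterior_square G) ext_wedge \<delta>"
proof -
  let ?S = "carrier G \<times> carrier G" and ?R = "exterior_relations G" and ?E = "exterior_square G"
  let ?c = "\<lambda>u. word_cong ?S ?R `` {u}"
  interpret E: group ?E unfolding exterior_square_def by (rule group_presented_group)
  have rel: "?c u = ?c v" if "(u, v) \<in> ?R" "u \<in> lists (UNIV \<times> ?S)" "v \<in> lists (UNIV \<times> ?S)" for u v
    using that by (intro equiv_class_eq[OF equiv_word_cong] word_cong.rel)
  have mult: "ext_wedge a b \<otimes>\<^bsub>?E\<^esub> ext_wedge c d = ?c (wedge a b @ wedge c d)"
    if "a \<in> carrier G" "b \<in> carrier G" "c \<in> carrier G" "d \<in> carrier G" for a b c d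
    using that unfolding ext_wedge_def exterior_square_def by (intro presented_group_mult) auto
  have pairing: "exterior_pairing G ?E ext_wedge"
  proof (intro exterior_pairing.intro exterior_pairing_axioms.intro is_group E.is_group)
    fix g h assume gh: "g \<in> carrier G" "h \<in> carrier G"
    then show "ext_wedge g h \<in> carrier ?E"
      by (auto simp: ext_wedge_def exterior_square_def presented_group_def quotient_def)
    fix k assume k: "k \<in> carrier G"
    have C: "conj_by G a b \<in> carrier G" if "a \<in> carrier G" "b \<in> carrier G" for a b
      using that by simp
    have "?c (wedge (g \<otimes> h) k) = ?c (wedge (conj_by G g h) (conj_by G k h) @ wedge h k)"
      using gh k by (intro rel) (simp_all add: C, auto simp: exterior_relations_def)
    then show "ext_wedge (g \<otimes> h) k = ext_wedge (conj_by G g h) (conj_by G k h) \<otimes>\<^bsub>?E\<^esub> ext_wedge h k"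
      using mult[OF C C, of g h k h h k] gh k by (simp add: ext_wedge_def)
    have "?c (wedge g (h \<otimes> k)) = ?c (wedge g k @ wedge (conj_by G g k) (conj_by G h k))"
      using gh k by (intro rel) (simp_all add: C, auto simp: exterior_relations_def)
    then show "ext_wedge g (h \<otimes> k) = ext_wedge g k \<otimes>\<^bsub>?E\<^esub> ext_wedge (conj_by G g k) (conj_by G h k)"
      using mult[OF _ _ C C, of g k g k h k] gh k by (simp add: ext_wedge_def)
  next
    fix g assume "g \<in> carrier G"
    then have "ext_wedge g g = ?c []"
      unfolding ext_wedge_def by (intro rel) (auto simp: exterior_relations_def)
    then show "ext_wedge g g = \<one>\<^bsub>?E\<^esub>" by (simp add: exterior_square_def presented_group_def)
  qed
  let ?f = "\<lambda>(g, h). commutator G g h"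
  have f: "?f ` ?S \<subseteq> carrier G" by auto
  obtain \<delta> where \<delta>: "\<delta> \<in> hom ?E G" "\<And>x. x \<in> ?S \<Longrightarrow> \<delta> (?c [(True, x)]) = ?f x"
    unfolding exterior_square_def
  proof (rule exE[OF presented_group_hom_exists[OF f, of ?R]])
    fix u v assume "(u, v) \<in> ?R"
    then show "word_eval ?f u = word_eval ?f v"
      by (auto simp: exterior_relations_def word_simps)
  qed blast
  have "generated_exterior_pairing G ?E ext_wedge \<delta>"
  proof (intro generated_exterior_pairing.intro generated_exterior_pairing_axioms.intro pairing
      group_hom.intro group_hom_axioms.intro is_group E.is_group \<delta>(1))
    show "\<delta> (ext_wedge g h) = commutator G g h" if "g \<in> carrier G" "h \<in> carrier G" for g h
      using that \<delta>(2)[of "(g, h)"] by (simp add: ext_wedge_def)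
    have "{?c [(True, x)] |x. x \<in> ?S} = {ext_wedge g h |g h. g \<in> carrier G \<and> h \<in> carrier G}"
      by (auto simp: ext_wedge_def)
    then show "carrier ?E = generate ?E {ext_wedge g h |g h. g \<in> carrier G \<and> h \<in> carrier G}"
      using presented_group_generated[of ?S ?R] by (simp add: exterior_square_def)
  qed
  then show ?thesis by blast
qed

end

section \<open>The central extension defined by a 2-cocycle\<close>

locale two_cocycle = A: comm_group A + G: group G
  for A :: "('c, 'm) monoid_scheme" and G :: "('a, 'n) monoid_scheme" (structure) +
  fixes f :: "'a \<Rightarrow> 'a \<Rightarrow> 'c"
  assumes f_closed [simp]: "g \<in> carrier G \<Longrightarrow> h \<in> carrier G \<Longrightarrow> f g h \<in> carrier A"
    and cocycle: "\<lbrakk>g \<in> carrier G; h \<in> carrier G; k \<in> carrier G\<rbrakk> \<Longrightarrow>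
      f g h \<otimes>\<^bsub>A\<^esub> f (g \<otimes> h) k = f h k \<otimes>\<^bsub>A\<^esub> f g (h \<otimes> k)"
begin

lemma f_one: "k \<in> carrier G \<Longrightarrow> f \<one> k = f \<one> \<one>" "k \<in> carrier G \<Longrightarrow> f k \<one> = f \<one> \<one>"
  using cocycle[of \<one> \<one> k] cocycle[of k \<one> \<one>] by simp_all

text \<open>The cocycle is unnormalised, like the bar complex that it will come from: f 1 1 may be
  nontrivial, and its inverse appears in the unit here and in \<open>coc_incl\<close>.\<close>

definition coc_ext :: "('c \<times> 'a) monoid" where
  "coc_ext = \<lparr>carrier = carrier A \<times> carrier G,
    monoid.mult = (\<lambda>(a, g) (b, h). (a \<otimes>\<^bsub>A\<^esub> b \<otimes>\<^bsub>A\<^esub> f g h, g \<otimes> h)),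
    one = (inv\<^bsub>A\<^esub> (f \<one> \<one>), \<one>)\<rparr>"

lemma coc_ext_simps:
  "carrier coc_ext = carrier A \<times> carrier G"
  "(a, g) \<otimes>\<^bsub>coc_ext\<^esub> (b, h) = (a \<otimes>\<^bsub>A\<^esub> b \<otimes>\<^bsub>A\<^esub> f g h, g \<otimes> h)"
  "\<one>\<^bsub>coc_ext\<^esub> = (inv\<^bsub>A\<^esub> (f \<one> \<one>), \<one>)"
  by (simp_all add: coc_ext_def)

lemma group_coc_ext: "group coc_ext"
proof (rule groupI)
  show "x \<otimes>\<^bsub>coc_ext\<^esub> y \<otimes>\<^bsub>coc_ext\<^esub> z = x \<otimes>\<^bsub>coc_ext\<^esub> (y \<otimes>\<^bsub>coc_ext\<^esub> z)"
    if xyz: "x \<in> carrier coc_ext" "y \<in> carrier coc_ext" "z \<in> carrier coc_ext" for x y z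
  proof -
    obtain a g b h c k where e: "x = (a, g)" "y = (b, h)" "z = (c, k)"
      and C: "a \<in> carrier A" "b \<in> carrier A" "c \<in> carrier A"
      "g \<in> carrier G" "h \<in> carrier G" "k \<in> carrier G"
      using xyz by (auto simp: coc_ext_simps)
    have "a \<otimes>\<^bsub>A\<^esub> b \<otimes>\<^bsub>A\<^esub> f g h \<otimes>\<^bsub>A\<^esub> c \<otimes>\<^bsub>A\<^esub> f (g \<otimes> h) k
        = a \<otimes>\<^bsub>A\<^esub> b \<otimes>\<^bsub>A\<^esub> c \<otimes>\<^bsub>A\<^esub> (f g h \<otimes>\<^bsub>A\<^esub> f (g \<otimes> h) k)"
      using C by (simp add: A.m_ac)
    also have "\<dots> = a \<otimes>\<^bsub>A\<^esub> (b \<otimes>\<^bsub>A\<^esub> c \<otimes>\<^bsub>A\<^esub> f h k) \<otimes>\<^bsub>A\<^esub> f g (h \<otimes> k)"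
      using C by (simp add: cocycle A.m_ac)
    finally show ?thesis using C by (simp add: e coc_ext_simps G.m_assoc)
  qed
  show "\<one>\<^bsub>coc_ext\<^esub> \<otimes>\<^bsub>coc_ext\<^esub> x = x" if "x \<in> carrier coc_ext" for x
  proof -
    obtain a g where e: "x = (a, g)" "a \<in> carrier A" "g \<in> carrier G" using \<open>x \<in> carrier coc_ext\<close>
      by (auto simp: coc_ext_simps)
    have "inv\<^bsub>A\<^esub> (f \<one> \<one>) \<otimes>\<^bsub>A\<^esub> a \<otimes>\<^bsub>A\<^esub> f \<one> \<one> = a \<otimes>\<^bsub>A\<^esub> (inv\<^bsub>A\<^esub> (f \<one> \<one>) \<otimes>\<^bsub>A\<^esub> f \<one> \<one>)"
      using e by (simp add: A.m_ac del: A.l_inv)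
    then show ?thesis using e f_one(1)[OF e(3)] by (simp add: coc_ext_simps)
  qed
  show "\<exists>y\<in>carrier coc_ext. y \<otimes>\<^bsub>coc_ext\<^esub> x = \<one>\<^bsub>coc_ext\<^esub>" if x: "x \<in> carrier coc_ext" for x
  proof -
    obtain a g where e: "x = (a, g)" "a \<in> carrier A" "g \<in> carrier G" using x by (auto simp:
        coc_ext_simps)
    let ?c = "a \<otimes>\<^bsub>A\<^esub> f (inv g) g"
    have "inv\<^bsub>A\<^esub> (f \<one> \<one>) \<otimes>\<^bsub>A\<^esub> inv\<^bsub>A\<^esub> ?c \<otimes>\<^bsub>A\<^esub> a \<otimes>\<^bsub>A\<^esub> f (inv g) g
        = inv\<^bsub>A\<^esub> (f \<one> \<one>) \<otimes>\<^bsub>A\<^esub> (inv\<^bsub>A\<^esub> ?c \<otimes>\<^bsub>A\<^esub> ?c)"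
      using e by (simp add: A.m_assoc del: A.l_inv)
    then show ?thesis
      using e by (intro bexI[of _ "(inv\<^bsub>A\<^esub> (f \<one> \<one>) \<otimes>\<^bsub>A\<^esub> inv\<^bsub>A\<^esub> ?c, inv g)"])
        (simp_all add: coc_ext_simps)
  qed
qed (auto simp: coc_ext_simps)

lemma coc_ext_proj: "group_hom coc_ext G snd"
  by (intro group_hom.intro group_hom_axioms.intro homI group_coc_ext G.is_group)
    (auto simp: coc_ext_simps)

lemma coc_ext_proj_surj: "snd ` carrier coc_ext = carrier G"
  using A.one_closed by (force simp: coc_ext_simps)

lemma coc_ext_kernel_central:
  assumes "z \<in> carrier coc_ext" "snd z = \<one>" "x \<in> carrier coc_ext"
  shows "z \<otimes>\<^bsub>coc_ext\<^esub> x = x \<otimes>\<^bsub>coc_ext\<^esub> z"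
proof -
  obtain a b h where e: "z = (a, \<one>)" "x = (b, h)" "a \<in> carrier A" "b \<in> carrier A" "h \<in> carrier G"
    using assms by (auto simp: coc_ext_simps)
  then show ?thesis using f_one[OF e(5)] by (simp add: coc_ext_simps A.m_comm)
qed

definition coc_incl :: "'c \<Rightarrow> 'c \<times> 'a" where
  "coc_incl a = (a \<otimes>\<^bsub>A\<^esub> inv\<^bsub>A\<^esub> (f \<one> \<one>), \<one>)"

lemma coc_incl_hom: "group_hom A coc_ext coc_incl"
proof (intro group_hom.intro group_hom_axioms.intro homI group_coc_ext A.is_group)
  fix a b assume ab: "a \<in> carrier A" "b \<in> carrier A"
  let ?i = "inv\<^bsub>A\<^esub> (f \<one> \<one>)"
  have "a \<otimes>\<^bsub>A\<^esub> ?i \<otimes>\<^bsub>A\<^esub> (b \<otimes>\<^bsub>A\<^esub> ?i) \<otimes>\<^bsub>A\<^esub> f \<one> \<one> = a \<otimes>\<^bsub>A\<^esub> b \<otimes>\<^bsub>A\<^esub> ?i \<otimes>\<^bsub>A\<^esub> (?i \<otimes>\<^bsub>A\<^esub> f \<one> \<one>)"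
    using ab by (simp add: A.m_ac del: A.l_inv)
  then show "coc_incl (a \<otimes>\<^bsub>A\<^esub> b) = coc_incl a \<otimes>\<^bsub>coc_ext\<^esub> coc_incl b"
    using ab by (simp add: coc_incl_def coc_ext_simps)
qed (simp add: coc_incl_def coc_ext_simps)

lemma coc_incl_eq_one: "a \<in> carrier A \<Longrightarrow> coc_incl a = \<one>\<^bsub>coc_ext\<^esub> \<Longrightarrow> a = \<one>\<^bsub>A\<^esub>"
  by (simp add: coc_incl_def coc_ext_simps)

lemma coc_section_mult:
  assumes "g \<in> carrier G" "h \<in> carrier G"
  shows "(\<one>\<^bsub>A\<^esub>, g) \<otimes>\<^bsub>coc_ext\<^esub> (\<one>\<^bsub>A\<^esub>, h) = coc_incl (f g h) \<otimes>\<^bsub>coc_ext\<^esub> (\<one>\<^bsub>A\<^esub>, g \<otimes> h)"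
  using assms f_one(1)[of "g \<otimes> h"] by (simp add: coc_incl_def coc_ext_simps A.m_assoc)

end

lemma (in group) comm_group_abelianization:
  "comm_group (G Mod commutator_subgroup G (carrier G) (carrier G))"
proof -
  let ?D = "commutator_subgroup G (carrier G) (carrier G)"
  interpret D: normal ?D G by (intro commutator_subgroup_normal carrier_normal)
  interpret q: group_hom G "G Mod ?D" "\<lambda>x. ?D #> x" by (rule D.quotient_hom)
  show ?thesis
  proof (rule q.H.group_comm_groupI)
    fix a b assume ab: "a \<in> carrier (G Mod ?D)" "b \<in> carrier (G Mod ?D)"
    then obtain x y where xy: "x \<in> carrier G" "a = ?D #> x" "y \<in> carrier G" "b = ?D #> y"
      by (auto simp: D.quotient_surj)
    have "?D #> commutator G x y = \<one>\<^bsub>G Mod ?D\<^esub>"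
      using xy commutator_subgroup_incl D.quotient_eq_one_iff by (metis commutator_closed)
    then have "commutator (G Mod ?D) a b = \<one>\<^bsub>G Mod ?D\<^esub>" using xy by (metis q.hom_commutator)
    then show "a \<otimes>\<^bsub>G Mod ?D\<^esub> b = b \<otimes>\<^bsub>G Mod ?D\<^esub> a" using ab q.H.commutator_eq_one_iff by blast
  qed
qed

lemma hom_free_Abelian_group_diff:
  assumes "group_hom (free_Abelian_group S) H h"
    and "Poly_Mapping.keys a \<subseteq> S" "Poly_Mapping.keys b \<subseteq> S"
  shows "h (a - b) = h a \<otimes>\<^bsub>H\<^esub> inv\<^bsub>H\<^esub> (h b)"
proof -
  interpret group_hom "free_Abelian_group S" H h by fact
  have "h (a \<otimes>\<^bsub>free_Abelian_group S\<^esub> inv\<^bsub>free_Abelian_group S\<^esub> b) = h a \<otimes>\<^bsub>H\<^esub> inv\<^bsub>H\<^esub> (h b)"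
    using assms(2,3) by (metis carrier_free_Abelian_group_iff G.inv_closed hom_inv hom_mult)
  then show ?thesis using assms(2,3) by simp
qed

section \<open>The exponent of the Schur multiplier\<close>

context group
begin

abbreviation "bar_chains2 \<equiv> free_Abelian_group (carrier G \<times> carrier G)"
abbreviation "bar_chains1 \<equiv> free_Abelian_group (carrier G)"
abbreviation "bar_quotient \<equiv> bar_chains2 Mod bar_boundaries2 G"

lemma bar_boundaries2_subgroup: "subgroup (bar_boundaries2 G) bar_chains2"
  unfolding bar_boundaries2_def by (rule group_hom.img_is_subgroup[OF bar_boundary3_hom])

lemma bar_boundaries2_normal: "bar_boundaries2 G \<lhd> bar_chains2"
  by (rule comm_group.subgroup_imp_normal[OF abelian_free_Abelian_group bar_boundaries2_subgroup])

definition bar_class :: "('a \<times> 'a \<Rightarrow>\<^sub>0 int) \<Rightarrow> ('a \<times> 'a \<Rightarrow>\<^sub>0 int) set" where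
  "bar_class c = bar_boundaries2 G #>\<^bsub>bar_chains2\<^esub> c"

lemma bar_class_hom: "group_hom bar_chains2 bar_quotient bar_class"
  unfolding bar_class_def using normal.quotient_hom[OF bar_boundaries2_normal] .

lemma bar_class_eq_one_iff:
  "Poly_Mapping.keys c \<subseteq> carrier G \<times> carrier G \<Longrightarrow>
    bar_class c = \<one>\<^bsub>bar_quotient\<^esub> \<longleftrightarrow> c \<in> bar_boundaries2 G"
  unfolding bar_class_def by (rule normal.quotient_eq_one_iff[OF bar_boundaries2_normal]) simp

text \<open>The cocycle identity says that the boundary of the 3-chain [g|h|k] has trivial class.
  The coefficients are all 2-chains modulo boundaries, a group in which the Schur multiplier
  consists of the classes of cycles.\<close>

lemma bar_two_cocycle:
  "two_cocycle bar_quotient G (\<lambda>g h. bar_class (frag_of (g, h)))"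
proof (intro two_cocycle.intro two_cocycle_axioms.intro is_group
    comm_group.abelian_FactGroup[OF abelian_free_Abelian_group bar_boundaries2_subgroup])
  interpret q: group_hom bar_chains2 bar_quotient bar_class
    by (rule bar_class_hom)
  note [simp del] = mult_FactGroup one_FactGroup
  show "bar_class (frag_of (g, h)) \<in> carrier bar_quotient"
    if "g \<in> carrier G" "h \<in> carrier G" for g h
    using that by (intro q.hom_closed) simp
  fix g h k assume C: "g \<in> carrier G" "h \<in> carrier G" "k \<in> carrier G"
  let ?x = "frag_of (g, h) + frag_of (g \<otimes> h, k)" and ?y = "frag_of (h, k) + frag_of (g, h \<otimes> k)"
  have keys: "Poly_Mapping.keys ?x \<subseteq> carrier G \<times> carrier G" "Poly_Mapping.keys ?y \<subseteq> carrier G \<times>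
      carrier G"
    using C by (auto dest!: subsetD[OF keys_add])
  have "bar_boundary3 G (frag_of (g, h, k)) = ?y - ?x" by (simp add: bar_boundary3_def)
  moreover have "bar_boundary3 G (frag_of (g, h, k)) \<in> bar_boundaries2 G"
    unfolding bar_boundaries2_def using C by (intro imageI) simp
  moreover have "Poly_Mapping.keys (?y - ?x) \<subseteq> carrier G \<times> carrier G"
    using keys keys_diff[of ?y ?x] by blast
  ultimately have "bar_class (?y - ?x) = \<one>\<^bsub>bar_quotient\<^esub>"
    using bar_class_eq_one_iff by metis
  then have "bar_class ?y \<otimes>\<^bsub>bar_quotient\<^esub>
      inv\<^bsub>bar_quotient\<^esub> (bar_class ?x) = \<one>\<^bsub>bar_quotient\<^esub>"
    using hom_free_Abelian_group_diff[OF q.group_hom_axioms keys(2,1)] by simp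
  then have "bar_class ?x = bar_class ?y"
    using keys by (metis carrier_free_Abelian_group_iff q.H.inv_closed q.H.inv_equality
        q.H.inv_inv q.hom_closed)
  moreover have "bar_class ?x = bar_class (frag_of (g, h))
      \<otimes>\<^bsub>bar_quotient\<^esub> bar_class (frag_of (g \<otimes> h, k))"
    using q.hom_mult[of "frag_of (g, h)" "frag_of (g \<otimes> h, k)"] C by simp
  moreover have "bar_class ?y = bar_class (frag_of (h, k))
      \<otimes>\<^bsub>bar_quotient\<^esub> bar_class (frag_of (g, h \<otimes> k))"
    using q.hom_mult[of "frag_of (h, k)" "frag_of (g, h \<otimes> k)"] C by simp
  ultimately show "bar_class (frag_of (g, h))
      \<otimes>\<^bsub>bar_quotient\<^esub> bar_class (frag_of (g \<otimes> h, k))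
    = bar_class (frag_of (h, k)) \<otimes>\<^bsub>bar_quotient\<^esub> bar_class (frag_of (g, h \<otimes> k))"
    by simp
qed

interpretation bar: two_cocycle bar_quotient G "\<lambda>g h. bar_class (frag_of (g, h))"
  by (rule bar_two_cocycle)

text \<open>On 2-chains, \<open>bar.coc_incl \<circ> bar_class\<close> followed by abelianisation factors through the
  boundary; so cycles become products of commutators.\<close>

lemma bar_cycle_in_derived:
  assumes z: "z \<in> bar_cycles2 G"
  shows "bar.coc_incl (bar_class z)
    \<in> commutator_subgroup bar.coc_ext (carrier bar.coc_ext) (carrier bar.coc_ext)"
proof -
  let ?A = bar_quotient and ?H = "bar.coc_ext"
  let ?D = "commutator_subgroup ?H (carrier ?H) (carrier ?H)"
  let ?Q = "?H Mod ?D" and ?q = "\<lambda>x. ?D #>\<^bsub>?H\<^esub> x"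
  note [simp del] = mult_FactGroup one_FactGroup
  interpret H: group ?H by (rule bar.group_coc_ext)
  interpret D: normal ?D ?H by (intro H.commutator_subgroup_normal H.carrier_normal)
  interpret q: group_hom ?H ?Q ?q by (rule D.quotient_hom)
  interpret Q: comm_group ?Q by (rule H.comm_group_abelianization)
  interpret cls: group_hom bar_chains2 ?A bar_class by (rule bar_class_hom)
  interpret i: group_hom ?A ?H bar.coc_incl by (rule bar.coc_incl_hom)
  interpret d: group_hom bar_chains2 bar_chains1 "bar_boundary2 G" by (rule bar_boundary2_hom)
  let ?s = "\<lambda>g. (\<one>\<^bsub>?A\<^esub>, g)"
  have s: "?s g \<in> carrier ?H" if "g \<in> carrier G" for g using that by (simp add: bar.coc_ext_simps)
  have qs: "(\<lambda>g. ?q (?s g)) ` carrier G \<subseteq> carrier ?Q" using s q.hom_closed by blast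
  \<comment> \<open>\<psi> sends the 1-chain [g] to the abelianised section value at g. By
    \<open>bar.coc_section_mult\<close>, \<phi> agrees with \<psi> after the boundary map on every
    [g|h], hence on all 2-chains.\<close>
  obtain \<psi> where \<psi>: "\<psi> \<in> hom bar_chains1 ?Q" "\<And>g. g \<in> carrier G \<Longrightarrow> \<psi> (frag_of g) = ?q (?s g)"
    using Q.free_Abelian_group_universal[OF qs] by blast
  interpret \<psi>: group_hom bar_chains1 ?Q \<psi> by unfold_locales (rule \<psi>(1))
  define \<phi> where "\<phi> = (\<lambda>c. ?q (bar.coc_incl (bar_class c)))"
  interpret \<phi>: group_hom bar_chains2 ?Q \<phi>
  proof unfold_locales
    show "\<phi> \<in> hom bar_chains2 ?Q"
      unfolding \<phi>_def by (intro homI) (simp_all only: cls.hom_closed i.hom_closed q.hom_closed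
          cls.hom_mult i.hom_mult q.hom_mult)
  qed
  have "\<phi> c = \<psi> (bar_boundary2 G c)" if "Poly_Mapping.keys c \<subseteq> carrier G \<times> carrier G" for c
    using that
  proof (rule free_Abelian_group_induct)
    show "\<phi> 0 = \<psi> (bar_boundary2 G 0)"
      using \<phi>.hom_one d.hom_one \<psi>.hom_one by simp
  next
    fix x y assume xy: "Poly_Mapping.keys x \<subseteq> carrier G \<times> carrier G" "Poly_Mapping.keys y \<subseteq>
        carrier G \<times> carrier G"
      "\<phi> x = \<psi> (bar_boundary2 G x)" "\<phi> y = \<psi> (bar_boundary2 G y)"
    have dxy: "Poly_Mapping.keys (bar_boundary2 G x) \<subseteq> carrier G" "Poly_Mapping.keys
        (bar_boundary2 G y) \<subseteq> carrier G"
      using d.hom_closed[of x] d.hom_closed[of y] xy by simp_all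
    have "bar_boundary2 G (x - y) = bar_boundary2 G x - bar_boundary2 G y"
      by (simp add: bar_boundary2_def frag_extend_diff)
    then show "\<phi> (x - y) = \<psi> (bar_boundary2 G (x - y))"
      using hom_free_Abelian_group_diff[OF \<phi>.group_hom_axioms xy(1,2)]
          hom_free_Abelian_group_diff[OF \<psi>.group_hom_axioms dxy] xy by simp
  next
    fix a assume "a \<in> carrier G \<times> carrier G"
    then obtain g h where a: "a = (g, h)" "g \<in> carrier G" "h \<in> carrier G" by blast
    let ?f = "\<lambda>g. \<psi> (frag_of g)"
    have fC: "?f k \<in> carrier ?Q" if "k \<in> carrier G" for k using that by (intro \<psi>.hom_closed) simp
    have \<phi>C: "\<phi> (frag_of a) \<in> carrier ?Q" using a by (intro \<phi>.hom_closed) simp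
    have iC: "bar.coc_incl (bar_class (frag_of (g, h))) \<in> carrier ?H"
      using a by (intro i.hom_closed cls.hom_closed) simp
    have "?q (?s g \<otimes>\<^bsub>?H\<^esub> ?s h) = ?q (bar.coc_incl (bar_class (frag_of (g, h))) \<otimes>\<^bsub>?H\<^esub> ?s (g \<otimes> h))"
      using bar.coc_section_mult[OF a(2,3)] by simp
    then have "?f g \<otimes>\<^bsub>?Q\<^esub> ?f h = \<phi> (frag_of a) \<otimes>\<^bsub>?Q\<^esub> ?f (g \<otimes> h)"
      using a s iC \<psi>(2) by (simp add: \<phi>_def)
    then have "\<phi> (frag_of a) = ?f g \<otimes>\<^bsub>?Q\<^esub> ?f h \<otimes>\<^bsub>?Q\<^esub> inv\<^bsub>?Q\<^esub> (?f (g \<otimes> h))"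
      using fC a \<phi>C by (simp add: q.H.inv_solve_right)
    also have "\<dots> = ?f h \<otimes>\<^bsub>?Q\<^esub> inv\<^bsub>?Q\<^esub> (?f (g \<otimes> h)) \<otimes>\<^bsub>?Q\<^esub> ?f g"
      using fC a by (simp add: Q.m_ac)
    also have "\<dots> = \<psi> (frag_of h - frag_of (g \<otimes> h)) \<otimes>\<^bsub>?Q\<^esub> ?f g"
      using hom_free_Abelian_group_diff[OF \<psi>.group_hom_axioms, of "frag_of h" "frag_of (g \<otimes> h)"] a
          by simp
    also have "\<dots> = \<psi> (frag_of h - frag_of (g \<otimes> h) + frag_of g)"
    proof -
      have "Poly_Mapping.keys (frag_of h - frag_of (g \<otimes> h)) \<subseteq> carrier G"
        using a by (auto dest!: subsetD[OF keys_diff])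
      then show ?thesis using \<psi>.hom_mult[of "frag_of h - frag_of (g \<otimes> h)" "frag_of g"] a by simp
    qed
    finally show "\<phi> (frag_of a) = \<psi> (bar_boundary2 G (frag_of a))"
      by (simp add: a bar_boundary2_def)
  qed
  moreover have zC: "Poly_Mapping.keys z \<subseteq> carrier G \<times> carrier G" "bar_boundary2 G z = 0"
    using z by (auto simp: bar_cycles2_def kernel_def)
  ultimately have "?q (bar.coc_incl (bar_class z)) = \<one>\<^bsub>?Q\<^esub>"
    using \<psi>.hom_one by (simp add: \<phi>_def)
  moreover have "bar.coc_incl (bar_class z) \<in> carrier ?H"
    using zC by (intro i.hom_closed cls.hom_closed) simp
  ultimately show ?thesis using D.quotient_eq_one_iff by blast
qed

lemma schur_multiplier_exponent_dvd:
  assumes m: "0 < m"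
    and pow: "\<And>z. z \<in> bar_cycles2 G \<Longrightarrow> z [^]\<^bsub>bar_chains2\<^esub> (m::nat) \<in> bar_boundaries2 G"
  shows "group_exponent (schur_multiplier G) dvd m"
proof (rule group.group_exponent_dvd[OF group_schur_multiplier m])
  let ?Z = "bar_chains2\<lparr>carrier := bar_cycles2 G\<rparr>"
  have Z: "subgroup (bar_cycles2 G) bar_chains2"
    unfolding bar_cycles2_def by (rule group_hom.subgroup_kernel[OF bar_boundary2_hom])
  have BZ: "bar_boundaries2 G \<subseteq> bar_cycles2 G"
  proof
    fix c assume c: "c \<in> bar_boundaries2 G"
    then have "c \<in> carrier bar_chains2" by (rule subgroup.mem_carrier[OF bar_boundaries2_subgroup])
    with c show "c \<in> bar_cycles2 G"
      by (auto simp only: bar_boundaries2_def bar_cycles2_def kernel_def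
          carrier_free_Abelian_group_iff one_free_Abelian_group bar_boundary2_boundary3)
  qed
  have "subgroup (bar_boundaries2 G) ?Z"
    by (rule group.subgroup_incl[OF group_free_Abelian_group bar_boundaries2_subgroup Z BZ])
  moreover have "comm_group ?Z"
    using subgroup.subgroup_is_group[OF Z group_free_Abelian_group]
    by (rule group.group_comm_groupI) simp
  ultimately have N: "bar_boundaries2 G \<lhd> ?Z" by (simp add: comm_group.subgroup_imp_normal)
  interpret q: group_hom ?Z "?Z Mod bar_boundaries2 G" "\<lambda>z. bar_boundaries2 G #>\<^bsub>?Z\<^esub> z"
    by (rule normal.quotient_hom[OF N])
  fix x assume "x \<in> carrier (schur_multiplier G)"
  then obtain z where z: "z \<in> carrier ?Z" "x = bar_boundaries2 G #>\<^bsub>?Z\<^esub> z"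
    by (auto simp: schur_multiplier_def normal.quotient_surj[OF N])
  have "z [^]\<^bsub>?Z\<^esub> m = z [^]\<^bsub>bar_chains2\<^esub> m"
    by (rule monoid.nat_pow_consistent[OF group.is_monoid[OF group_free_Abelian_group], symmetric])
  then have "z [^]\<^bsub>?Z\<^esub> m \<in> bar_boundaries2 G" using pow z by simp
  then have "bar_boundaries2 G #>\<^bsub>?Z\<^esub> (z [^]\<^bsub>?Z\<^esub> m) = \<one>\<^bsub>?Z Mod bar_boundaries2 G\<^esub>"
    using normal.quotient_eq_one_iff[OF N] q.G.nat_pow_closed[OF z(1)] by blast
  then show "x [^]\<^bsub>schur_multiplier G\<^esub> m = \<one>\<^bsub>schur_multiplier G\<^esub>"
    using q.hom_nat_pow[OF z(1), of m] z(2) by (simp only: schur_multiplier_def)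
qed

lemma schur_multiplier_exponent_dvd_of_derived:
  assumes m: "0 < m"
    and derived: "\<And>c. c \<in> commutator_subgroup bar.coc_ext (carrier bar.coc_ext) (carrier
        bar.coc_ext)
      \<Longrightarrow> c [^]\<^bsub>bar.coc_ext\<^esub> (m::nat) = \<one>\<^bsub>bar.coc_ext\<^esub>"
  shows "group_exponent (schur_multiplier G) dvd m"
proof (rule schur_multiplier_exponent_dvd[OF m])
  let ?A = bar_quotient
  interpret cls: group_hom bar_chains2 ?A bar_class by (rule bar_class_hom)
  interpret i: group_hom ?A bar.coc_ext bar.coc_incl by (rule bar.coc_incl_hom)
  fix z assume z: "z \<in> bar_cycles2 G"
  then have zC: "z \<in> carrier bar_chains2" by (simp add: bar_cycles2_def kernel_def)
  have "bar.coc_incl (bar_class (z [^]\<^bsub>bar_chains2\<^esub> m)) = bar.coc_incl (bar_class z)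
      [^]\<^bsub>bar.coc_ext\<^esub> m"
    by (simp only: cls.hom_nat_pow[OF zC] i.hom_nat_pow[OF cls.hom_closed[OF zC]])
  also have "\<dots> = \<one>\<^bsub>bar.coc_ext\<^esub>" by (rule derived[OF bar_cycle_in_derived[OF z]])
  finally have "bar_class (z [^]\<^bsub>bar_chains2\<^esub> m) = \<one>\<^bsub>?A\<^esub>"
    by (rule bar.coc_incl_eq_one[OF cls.hom_closed[OF cls.G.nat_pow_closed[OF zC]]])
  moreover have "Poly_Mapping.keys (z [^]\<^bsub>bar_chains2\<^esub> m) \<subseteq> carrier G \<times> carrier G"
    using cls.G.nat_pow_closed[OF zC, of m] unfolding carrier_free_Abelian_group_iff .
  ultimately show "z [^]\<^bsub>bar_chains2\<^esub> m \<in> bar_boundaries2 G" using bar_class_eq_one_iff by blast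
qed

text \<open>Since \<pi> is onto, every generator \<open>ext_wedge g h\<close> becomes a commutator
  of lifts in H, so the injective \<iota> takes the exterior square into [H, H].\<close>

lemma exterior_square_exponent_dvd:
  fixes \<delta>
  assumes "generated_exterior_pairing G (exterior_square G) ext_wedge \<delta>"
    and H: "pairing_extension G (exterior_square G) ext_wedge H \<iota> \<pi>"
    and surj: "\<pi> ` carrier H = carrier G" and m: "0 < m"
    and derived: "\<And>c. c \<in> commutator_subgroup H (carrier H) (carrier H) \<Longrightarrow> c [^]\<^bsub>H\<^esub> (m::nat) = \<one>\<^bsub>H\<^esub>"
  shows "group_exponent (exterior_square G) dvd m"
proof -
  interpret E: generated_exterior_pairing G "exterior_square G" ext_wedge \<delta> by fact
  interpret H: pairing_extension G "exterior_square G" ext_wedge H \<iota> \<pi> by (rule H)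
  let ?D = "commutator_subgroup H (carrier H) (carrier H)"
  have D: "subgroup ?D H"
    by (intro normal_imp_subgroup H.H.commutator_subgroup_normal H.H.carrier_normal)
  have "\<iota> e \<in> ?D" if "e \<in> carrier (exterior_square G)" for e
    using that
  proof (induction e rule: E.E_induct)
    case (w g h)
    then obtain a b where "a \<in> carrier H" "b \<in> carrier H" "g = \<pi> a" "h = \<pi> b" using surj by blast
    then show ?case using H.H_commutator[of a b] H.H.commutator_subgroup_incl[of a "carrier H" b
        "carrier H"] by simp
  qed (simp_all add: subgroup.one_closed[OF D] subgroup.m_closed[OF D] subgroup.m_inv_closed[OF D])
  then have \<iota>_pow: "\<iota> (e [^]\<^bsub>exterior_square G\<^esub> m) = \<iota> \<one>\<^bsub>exterior_square G\<^esub>"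
    if "e \<in> carrier (exterior_square G)" for e
    using that derived by (simp add: H.\<iota>.hom_nat_pow)
  show ?thesis
  proof (rule E.E.group_exponent_dvd[OF m])
    fix e assume e: "e \<in> carrier (exterior_square G)"
    show "e [^]\<^bsub>exterior_square G\<^esub> m = \<one>\<^bsub>exterior_square G\<^esub>"
      by (rule inj_onD[OF H.\<iota>_inj \<iota>_pow[OF e]]) (use e in simp_all)
  qed
qed

end

theorem lemma1p1:
  fixes G :: "('a, 'b) monoid_scheme" and p n :: nat
  assumes "Factorial_Ring.prime p" and "odd p"
    and "group G" and "finite (carrier G)" and "\<exists>k. order G = p ^ k"
    and "group_exponent G = p ^ n"
    and "powerful p (G\<lparr>carrier := power_subgroup G p\<rparr>)"
    and "group_exponent (G\<lparr>carrier := power_subgroup G p\<rparr>) = p ^ (n - 1)"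
    and "lower_central G (p + 1) \<subseteq> power_subgroup G p"
  shows "group_exponent (exterior_square G) dvd group_exponent G
    \<and> group_exponent (schur_multiplier G) dvd group_exponent G"
proof
  interpret group G by fact
  obtain k where k: "order G = p ^ k" using assms(5) by blast
  have pn: "0 < p ^ n" using prime_gt_0_nat[OF assms(1)] by simp
  obtain \<delta> where \<delta>: "generated_exterior_pairing G (exterior_square G) ext_wedge \<delta>"
    using exterior_square_pairing by blast
  obtain H :: "(int list \<times> ('a \<times> 'a) word set) monoid" and \<iota> \<pi>
    where H: "pairing_extension G (exterior_square G) ext_wedge H \<iota> \<pi>" "\<pi> ` carrier H = carrier G"
    using generated_exterior_pairing.exists_surjective_pairing_extension[OF \<delta> assms(4)] by blast
  interpret H: pairing_extension G "exterior_square G" ext_wedge H \<iota> \<pi> by (rule H(1))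
  show "group_exponent (exterior_square G) dvd group_exponent G"
    unfolding assms(6)
    by (rule exterior_square_exponent_dvd[OF \<delta> H pn]) (rule
        H.\<pi>.central_extension_derived_exponent[OF
        H(2) H.\<pi>_kernel_central assms(1,2,4) k assms(6-9)])
  interpret bar: two_cocycle bar_quotient G "\<lambda>g h. bar_class (frag_of (g, h))"
    by (rule bar_two_cocycle)
  show "group_exponent (schur_multiplier G) dvd group_exponent G"
    unfolding assms(6)
    by (rule schur_multiplier_exponent_dvd_of_derived[OF pn])
      (rule group_hom.central_extension_derived_exponent[OF bar.coc_ext_proj bar.coc_ext_proj_surj
        bar.coc_ext_kernel_central assms(1,2,4) k assms(6-9)])
qed

end
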